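(* Let $T>0$, let $\mathcal{U}\subset\mathbb{R}^d$ and $\mathcal{S}\subset\mathbb{R}$ be compact, and let $b:\mathbb{R}^d\times\mathcal{U}\to\mathbb{R}^d$, $\Gamma:\mathbb{R}^d\times\mathcal{S}\to\mathbb{R}$ be continuous with $|b(x,\alpha)|\le M$ and $\lambda_1<\Gamma(x,\sigma)<\lambda_2$ for all $x\in\mathbb{R}^d$, $\alpha\in\mathcal{U}$, $\sigma\in\mathcal{S}$, for some constants $M>0$, $\lambda_2>\lambda_1>0$. Suppose that $L^1:[0,T]\times\mathbb{R}^d\times\mathcal{U}\to\mathbb{R}$ and $L^2:[0,T]\times\mathbb{R}^d\times\mathcal{S}\to\mathbb{R}$ are continuous in all variables and Lipschitz in $x$, uniformly in $t\in[0,T]$ and in the control, that $b$ and $\Gamma$ are Lipschitz in the space variable (uniformly in the control), and that $G:\mathbb{R}^d\to\mathbb{R}$ is globally Lipschitz. Set $$H^1(t,x,p)=\inf_{\alpha\in\mathcal{U}}\{\langle p,b(x,\alpha)\rangle+L^1(t,x,\alpha)\},\qquad H^2(t,x,q)=\inf_{\sigma\in\mathcal{S}}\Big\{\tfrac{\Gamma(x,\sigma)^2}{2}q+L^2(t,x,\sigma)\Big\},$$ and, for $\lambda>0$, $H^i_\lambda(t,x,r)=e^{-\lambda(T-t)}H^i(t,x,e^{\lambda(T-t)}r)$, $i=1,2$. Then every solution $u$ of $$\begin{cases}-u_t-H^2_\lambda(t,x,\Delta u)-H^1_\lambda(t,x,\nabla u)+\lambda u=0, & (t,x)\in[0,T]\times\mathbb{R}^d,\\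 u(T,x)=G(x), & x\in\mathbb{R}^d,\end{cases}$$ and consequently every solution $u$ of $$\begin{cases}u_t+H^2(t,x,\Delta u)+H^1(t,x,\nabla u)=0, & (t,x)\in[0,T]\times\mathbb{R}^d,\\ u(T,x)=G(x), & x\in\mathbb{R}^d,\end{cases}$$ is globally Lipschitz in the space variable, with a Lipschitz constant bounded uniformly in $t$.
   Context: For $u:(0,T)\times\mathbb{R}^d\to\mathbb{R}$, $\mathcal{P}^{2,+}u(t_0,x_0)$ is the set of $(a,p,X)\in\mathbb{R}\times\mathbb{R}^d\times Sym(d,d)$ with $$u(t,x)\le u(t_0,x_0)+a(t-t_0)+\langle p,x-x_0\rangle+\tfrac12\langle X(x-x_0),x-x_0\rangle+o(|t-t_0|+|x-x_0|^2)$$ as $(t,x)\to(t_0,x_0)$, and $\mathcal{P}^{2,-}u=-\mathcal{P}^{2,+}(-u)$. For the equation $-u_t-K^2(t,x,\Delta u)-K^1(t,x,\nabla u)+\lambda u=0$, $u(T,\cdot)=G$, with $\lambda\ge0$: a subsolution is an upper semicontinuous function $u$ on $(0,T]\times\mathbb{R}^d$, bounded from above, with $-a-K^2(t,x,\mathrm{tr}(X))-K^1(t,x,p)+\lambda u(t,x)\le0$ for all $(t,x)\in(0,T)\times\mathbb{R}^d$ and $(a,p,X)\in\mathcal{P}^{2,+}u(t,x)$, and $u(T,\cdot)\le G$. A supersolution is a lower semicontinuous function $u$ on $(0,T]\times\mathbb{R}^d$, bounded from below, with the inequality $\ge0$ for all $(a,p,X)\in\mathcal{P}^{2,-}u(t,x)$,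 and $u(T,\cdot)\ge G$. A solution is a bounded continuous function that is both a subsolution and a supersolution. The first equation corresponds to $K^i=H^i_\lambda$; the second is the case $\lambda=0$, $K^i=H^i$. *)

theory Defs
  imports "HOL-Analysis.Analysis" "HOL-Library.Landau_Symbols"
begin

definition upper_semicontinuous_on :: "'a::topological_space set \<Rightarrow> ('a \<Rightarrow> real) \<Rightarrow> bool" where
  "upper_semicontinuous_on S f \<longleftrightarrow>
     (\<forall>z\<in>S. \<forall>c>f z. eventually (\<lambda>w. f w < c) (at z within S))"

definition lower_semicontinuous_on :: "'a::topological_space set \<Rightarrow> ('a \<Rightarrow> real) \<Rightarrow> bool" where
  "lower_semicontinuous_on S f \<longleftrightarrow>
     (\<forall>z\<in>S. \<forall>c<f z. eventually (\<lambda>w. c < f w) (at z within S))"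

text \<open>
  The space-time functions below are total; only their values on (0,T] x R^d matter. In the
  semijets only values on the open time interval (0,T) are used, so the relative filter
  agrees with the full one at every point where the semijets are considered.
\<close>

definition P2plus ::
  "real \<Rightarrow> (real \<times> (real^'n) \<Rightarrow> real) \<Rightarrow> real \<times> (real^'n) \<Rightarrow> (real \<times> (real^'n) \<times> (real^'n^'n)) set" where
  "P2plus T u = (\<lambda>(t0, x0). {(a, p, X). transpose X = X \<and>
     (let F = at (t0, x0) within ({0<..<T} \<times> UNIV) in
      \<exists>r \<in> o[F](\<lambda>(t, x). \<bar>t - t0\<bar> + (norm (x - x0))\<^sup>2).
        eventually (\<lambda>(t, x). u (t, x) \<le> u (t0, x0) + a * (t - t0) + p \<bullet> (x - x0)
           + 1/2 * ((X *v (x - x0)) \<bullet> (x - x0)) + r (t, x)) F)})"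

definition P2minus ::
  "real \<Rightarrow> (real \<times> (real^'n) \<Rightarrow> real) \<Rightarrow> real \<times> (real^'n) \<Rightarrow> (real \<times> (real^'n) \<times> (real^'n^'n)) set" where
  "P2minus T u z = uminus ` P2plus T (\<lambda>w. - u w) z"

text \<open>
  Viscosity sub-/supersolutions of -u_t - K2(t,x,Laplace u) - K1(t,x,grad u) + lam u = 0
  with terminal condition u(T,.) = G.
\<close>

definition visc_subsolution ::
  "real \<Rightarrow> real \<Rightarrow> (real \<Rightarrow> real^'n \<Rightarrow> real \<Rightarrow> real) \<Rightarrow> (real \<Rightarrow> real^'n \<Rightarrow> real^'n \<Rightarrow> real)
    \<Rightarrow> (real^'n \<Rightarrow> real) \<Rightarrow> (real \<times> (real^'n) \<Rightarrow> real) \<Rightarrow> bool" where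
  "visc_subsolution T lam K2 K1 G u \<longleftrightarrow>
     upper_semicontinuous_on ({0<..T} \<times> UNIV) u \<and>
     bdd_above (u ` ({0<..T} \<times> UNIV)) \<and>
     (\<forall>t\<in>{0<..<T}. \<forall>x. \<forall>(a, p, X) \<in> P2plus T u (t, x).
        - a - K2 t x (trace X) - K1 t x p + lam * u (t, x) \<le> 0) \<and>
     (\<forall>x. u (T, x) \<le> G x)"

definition visc_supersolution ::
  "real \<Rightarrow> real \<Rightarrow> (real \<Rightarrow> real^'n \<Rightarrow> real \<Rightarrow> real) \<Rightarrow> (real \<Rightarrow> real^'n \<Rightarrow> real^'n \<Rightarrow> real)
    \<Rightarrow> (real^'n \<Rightarrow> real) \<Rightarrow> (real \<times> (real^'n) \<Rightarrow> real) \<Rightarrow> bool" where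
  "visc_supersolution T lam K2 K1 G u \<longleftrightarrow>
     lower_semicontinuous_on ({0<..T} \<times> UNIV) u \<and>
     bdd_below (u ` ({0<..T} \<times> UNIV)) \<and>
     (\<forall>t\<in>{0<..<T}. \<forall>x. \<forall>(a, p, X) \<in> P2minus T u (t, x).
        - a - K2 t x (trace X) - K1 t x p + lam * u (t, x) \<ge> 0) \<and>
     (\<forall>x. u (T, x) \<ge> G x)"

definition visc_solution ::
  "real \<Rightarrow> real \<Rightarrow> (real \<Rightarrow> real^'n \<Rightarrow> real \<Rightarrow> real) \<Rightarrow> (real \<Rightarrow> real^'n \<Rightarrow> real^'n \<Rightarrow> real)
    \<Rightarrow> (real^'n \<Rightarrow> real) \<Rightarrow> (real \<times> (real^'n) \<Rightarrow> real) \<Rightarrow> bool" where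
  "visc_solution T lam K2 K1 G u \<longleftrightarrow>
     bounded (u ` ({0<..T} \<times> UNIV)) \<and>
     continuous_on ({0<..T} \<times> UNIV) u \<and>
     visc_subsolution T lam K2 K1 G u \<and>
     visc_supersolution T lam K2 K1 G u"

definition Ham1 ::
  "(real^'n) set \<Rightarrow> (real^'n \<Rightarrow> real^'n \<Rightarrow> real^'n) \<Rightarrow> (real \<Rightarrow> real^'n \<Rightarrow> real^'n \<Rightarrow> real)
    \<Rightarrow> real \<Rightarrow> real^'n \<Rightarrow> real^'n \<Rightarrow> real" where
  "Ham1 U b L1 t x p = (INF \<alpha>\<in>U. p \<bullet> b x \<alpha> + L1 t x \<alpha>)"

definition Ham2 ::
  "real set \<Rightarrow> (real^'n \<Rightarrow> real \<Rightarrow> real) \<Rightarrow> (real \<Rightarrow> real^'n \<Rightarrow> real \<Rightarrow> real)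
    \<Rightarrow> real \<Rightarrow> real^'n \<Rightarrow> real \<Rightarrow> real" where
  "Ham2 S \<Gamma> L2 t x q = (INF \<sigma>\<in>S. (\<Gamma> x \<sigma>)\<^sup>2 / 2 * q + L2 t x \<sigma>)"

text \<open>The type of \<open>r\<close> is R^d for \<open>Ham1\<close> and R for \<open>Ham2\<close>.\<close>

definition rescaled_Ham ::
  "real \<Rightarrow> real \<Rightarrow> (real \<Rightarrow> real^'n \<Rightarrow> 'r::real_vector \<Rightarrow> real) \<Rightarrow> real \<Rightarrow> real^'n \<Rightarrow> 'r \<Rightarrow> real" where
  "rescaled_Ham T lam H t x r = exp (- lam * (T - t)) * H t x (exp (lam * (T - t)) *\<^sub>R r)"

end

theory Submission
  imports Defs "HOL-Library.Function_Algebras"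
begin

text \<open>
  Double the variables with \<open>\<Phi>(t,x,y) = C exp(k(T-t)) (\<bar>x-y\<bar>\<^sup>2/m + m)/2 + \<nu>\<bar>x\<bar>\<^sup>2 + \<theta>/t\<close> and suppose that
  \<open>u(t,x) - u(t,y) - \<Phi>(t,x,y)\<close> is positive somewhere. Replace \<open>u\<close> and \<open>-u\<close> by their sup-convolutions in
  space-time. Near a maximum point the coefficients of the equation are then frozen up to small errors, and since the equation
  sees the Hessian only through the Laplacian, each of the two functions becomes a viscosity subsolution of
  a Poisson equation with constant right-hand side in the space variable alone. After rescaling space by \<open>\<Gamma>\<close>
  at the two points, the required inequality says that the sum of two such subsolutions is
  a subsolution. This replaces the theorem on sums and needs neither Alexandrov's theorem nor Jensen's
  lemma: on a small ball each subsolution lies below the polynomial solution of the Poisson equation whose boundary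
  values approximate its own (Weierstrass), and the maximum principle for polynomials applies to the sum. Letting
  \<open>\<theta> \<rightarrow> 0\<close> and taking \<open>m = \<bar>x-y\<bar>\<close> gives the Lipschitz bound.
\<close>

section \<open>The Dirichlet problem for polynomials on a ball\<close>

text \<open>For a merely continuous \<open>u\<close> a maximum of the doubled function carries no
  second-order information by itself, and the equation controls only \<open>\<Gamma>\<^sup>2\<close>
  times a trace at each of two different points. Moving along z -> (x + \<Gamma>(x) z, y +
  \<Gamma>(y) z) produces exactly these two weighted Laplacians, while the penalty becomes a
  quadratic polynomial in z in which the coefficient of |x-y|^2 meets only the factor (\<Gamma>(x) -
  \<Gamma>(y))^2. Since \<Gamma> is Lipschitz, this is at most a multiple of the penalty itself, and
  the exponential growth rate k pays for it, as it does for the drift and the running cost. The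
  sup-convolution is there for two reasons: it is Lipschitz in time, so that time can be frozen, and
  the position of its maximiser determines the first-order part of every jet. The term \<theta>/t is
  a barrier at t = 0, where nothing is known about \<open>u\<close>, and its derivative supplies the
  strict surplus that beats all small errors. The supersolution inequality holds only for some
  unknown control. The control that minimises its frozen trace bound is therefore chosen, and the
  subsolution inequality, valid for all controls, is used with the same one.\<close>

inductive poly_deg_le :: "nat \<Rightarrow> (real^'n \<Rightarrow> real) \<Rightarrow> bool" where
  const: "poly_deg_le m (\<lambda>x. c)"
| add: "poly_deg_le m f \<Longrightarrow> poly_deg_le m g \<Longrightarrow> poly_deg_le m (\<lambda>x. f x + g x)"
| var: "poly_deg_le m f \<Longrightarrow> poly_deg_le (Suc m) (\<lambda>x. x$i * f x)"

lemma poly_deg_le_cmult: "poly_deg_le m f \<Longrightarrow> poly_deg_le m (\<lambda>x. c * f x)"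
proof (induction rule: poly_deg_le.induct)
  case (var m f i)
  have "poly_deg_le (Suc m) (\<lambda>x. x$i * (c * f x))" by (rule poly_deg_le.var[OF var.IH])
  then show ?case by (simp add: mult.left_commute)
qed (auto simp: distrib_left intro: poly_deg_le.intros)

lemma poly_deg_le_mono: "poly_deg_le m f \<Longrightarrow> m \<le> k \<Longrightarrow> poly_deg_le k f"
proof (induction arbitrary: k rule: poly_deg_le.induct)
  case (var m f i)
  then obtain k' where "k = Suc k'" "m \<le> k'" by (cases k) auto
  with var show ?case by (auto intro: poly_deg_le.var)
qed (auto intro: poly_deg_le.intros)

lemma poly_deg_le_diff:
  "poly_deg_le m f \<Longrightarrow> poly_deg_le m g \<Longrightarrow> poly_deg_le m (\<lambda>x. f x - g x)"
  using poly_deg_le.add[of m f "\<lambda>x. (-1) * g x"] poly_deg_le_cmult[of m g "-1"] by simp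

lemma poly_deg_le_mult:
  "poly_deg_le m f \<Longrightarrow> poly_deg_le k g \<Longrightarrow> poly_deg_le (m + k) (\<lambda>x. f x * g x)"
proof (induction rule: poly_deg_le.induct)
  case (const m c)
  then show ?case by (auto intro: poly_deg_le_cmult poly_deg_le_mono)
next
  case (add m f h)
  then show ?case by (auto simp: distrib_right intro: poly_deg_le.add)
next
  case (var m f i)
  then show ?case by (auto simp: mult.assoc intro: poly_deg_le.var)
qed

lemma poly_deg_le_component: "poly_deg_le (Suc 0) (\<lambda>x. x$i)"
  using poly_deg_le.var[OF poly_deg_le.const[of 0 1], of i] by simp

lemma poly_deg_le_sum:
  "finite I \<Longrightarrow> (\<And>i. i \<in> I \<Longrightarrow> poly_deg_le m (f i)) \<Longrightarrow> poly_deg_le m (\<lambda>x. \<Sum>i\<in>I. f i x)"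
  by (induction rule: finite_induct) (auto intro: poly_deg_le.intros)

lemma poly_deg_le_inner: "poly_deg_le (Suc 0) (\<lambda>x. a \<bullet> x)"
  unfolding inner_vec_def
  by (auto intro!: poly_deg_le_sum poly_deg_le_cmult poly_deg_le_component)

lemma poly_deg_le_norm_square: "poly_deg_le 2 (\<lambda>x. (norm x)\<^sup>2)"
  unfolding power2_norm_eq_inner inner_vec_def
  by (auto simp: numeral_2_eq_2 intro!: poly_deg_le_sum poly_deg_le.var poly_deg_le_component)

lemma real_polynomial_function_imp_poly_deg_le:
  fixes f :: "real^'n \<Rightarrow> real"
  assumes "real_polynomial_function f"
  shows "\<exists>m. poly_deg_le m f"
  using assms
proof (induction rule: real_polynomial_function.induct)
  case (linear f)
  then interpret bounded_linear f .
  have "f x = (\<Sum>i\<in>UNIV. f (axis i 1) * x$i)" for x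
  proof -
    have "f x = f (\<Sum>i\<in>UNIV. x$i *\<^sub>R axis i 1)"
      by (simp add: basis_expansion flip: scalar_mult_eq_scaleR)
    then show ?thesis by (simp add: sum scaleR mult.commute)
  qed
  then have "f = (\<lambda>x. \<Sum>i\<in>UNIV. f (axis i 1) * x$i)" by blast
  moreover have "poly_deg_le (Suc 0) (\<lambda>x. \<Sum>i\<in>UNIV. f (axis i 1) * x$i)"
    by (auto intro!: poly_deg_le_sum poly_deg_le_cmult poly_deg_le_component)
  ultimately show ?case by metis
next
  case (add f g)
  then obtain m k where "poly_deg_le m f" "poly_deg_le k g" by blast
  then have "poly_deg_le (max m k) (\<lambda>x. f x + g x)"
    by (intro poly_deg_le.add) (auto intro: poly_deg_le_mono)
  then show ?case ..
qed (auto intro: poly_deg_le.const poly_deg_le_mult)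

lemma poly_deg_le_continuous: "poly_deg_le m f \<Longrightarrow> continuous_on A f"
  by (induction rule: poly_deg_le.induct) (auto intro!: continuous_intros)

text \<open>A Taylor expansion with explicit cubic remainder is closed under sums and under
  multiplication by a coordinate, which is all that induction over \<open>poly_deg_le\<close> asks
  for. The restriction to \<open>norm h \<le> 1\<close> is what allows a cubic bound for polynomials
  of any degree.\<close>

definition has_jet :: "(real^'n \<Rightarrow> real) \<Rightarrow> real^'n \<Rightarrow> real^'n \<Rightarrow> real^'n^'n \<Rightarrow> bool" where
  "has_jet f x p X \<longleftrightarrow> transpose X = X \<and>
     (\<exists>K\<ge>0. \<forall>h. norm h \<le> 1 \<longrightarrow>
        \<bar>f (x + h) - f x - p \<bullet> h - 1/2 * ((X *v h) \<bullet> h)\<bar> \<le> K * norm h ^ 3)"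

lemma has_jet_const: "has_jet (\<lambda>x. c) x 0 0"
  by (auto simp: has_jet_def transpose_def vec_eq_iff)

lemma has_jet_add:
  assumes "has_jet f x p X" "has_jet g x q Y"
  shows "has_jet (\<lambda>x. f x + g x) x (p + q) (X + Y)"
proof -
  obtain K L where K: "K \<ge> 0" "\<And>h. norm h \<le> 1 \<Longrightarrow>
      \<bar>f (x + h) - f x - p \<bullet> h - 1/2 * ((X *v h) \<bullet> h)\<bar> \<le> K * norm h ^ 3"
    and L: "L \<ge> 0" "\<And>h. norm h \<le> 1 \<Longrightarrow>
      \<bar>g (x + h) - g x - q \<bullet> h - 1/2 * ((Y *v h) \<bullet> h)\<bar> \<le> L * norm h ^ 3"
    using assms unfolding has_jet_def by metis
  have "\<bar>f (x + h) + g (x + h) - (f x + g x) - (p + q) \<bullet> h - 1/2 * (((X + Y) *v h) \<bullet> h)\<bar>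
      \<le> (K + L) * norm h ^ 3" if "norm h \<le> 1" for h
    using K(2)[OF that] L(2)[OF that]
    by (simp add: matrix_vector_mult_add_rdistrib inner_add_left algebra_simps)
  moreover have "transpose (X + Y) = X + Y"
    using assms by (simp add: has_jet_def transpose_def vec_eq_iff)
  ultimately show ?thesis
    unfolding has_jet_def using K(1) L(1) by (intro conjI exI[of _ "K + L"]) auto
qed

lemma matrix_vector_scaleR: "(c *\<^sub>R (X :: real^'n^'m)) *v h = c *\<^sub>R (X *v h)"
  by (simp add: scaleR_matrix_vector_assoc)

lemma has_jet_cmult:
  assumes "has_jet f x p X"
  shows "has_jet (\<lambda>x. c * f x) x (c *\<^sub>R p) (c *\<^sub>R X)"
proof -
  obtain K where K: "K \<ge> 0" "\<And>h. norm h \<le> 1 \<Longrightarrow>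
      \<bar>f (x + h) - f x - p \<bullet> h - 1/2 * ((X *v h) \<bullet> h)\<bar> \<le> K * norm h ^ 3"
    using assms unfolding has_jet_def by metis
  have "\<bar>c * f (x + h) - c * f x - (c *\<^sub>R p) \<bullet> h - 1/2 * (((c *\<^sub>R X) *v h) \<bullet> h)\<bar>
      \<le> (\<bar>c\<bar> * K) * norm h ^ 3" if "norm h \<le> 1" for h
  proof -
    have "c * f (x + h) - c * f x - (c *\<^sub>R p) \<bullet> h - 1/2 * (((c *\<^sub>R X) *v h) \<bullet> h)
      = c * (f (x + h) - f x - p \<bullet> h - 1/2 * ((X *v h) \<bullet> h))"
      by (simp add: matrix_vector_scaleR algebra_simps)
    then show ?thesis
      using mult_left_mono[OF K(2)[OF that], of "\<bar>c\<bar>"] by (simp add: abs_mult mult.assoc)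
  qed
  moreover have "transpose (c *\<^sub>R X) = c *\<^sub>R X"
    using assms by (simp add: has_jet_def transpose_def vec_eq_iff)
  ultimately show ?thesis
    unfolding has_jet_def using K(1) by (intro conjI exI[of _ "\<bar>c\<bar> * K"]) auto
qed

lemma inner_matrix_bound: "\<exists>C\<ge>0. \<forall>h::real^'n. \<bar>(X *v h) \<bullet> h\<bar> \<le> C * (norm h)\<^sup>2"
proof -
  obtain C where C: "C > 0" "\<And>h. norm (X *v h) \<le> norm h * C"
    using bounded_linear.pos_bounded[OF matrix_vector_mul_bounded_linear[of X]] by blast
  have "\<bar>(X *v h) \<bullet> h\<bar> \<le> C * (norm h)\<^sup>2" for h
    using order_trans[OF Cauchy_Schwarz_ineq2[of "X *v h" h] mult_right_mono[OF C(2)]]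
    by (simp add: power2_eq_square algebra_simps)
  with C(1) show ?thesis by (intro exI[of _ C]) auto
qed

text \<open>The second matrix is the symmetrised product of the two gradients
  \<open>axis i 1\<close> and \<open>p\<close>; its quadratic form is twice the product of the two
  linear parts.\<close>

lemma has_jet_var:
  fixes f :: "real^'n \<Rightarrow> real"
  assumes "has_jet f x p X"
  shows "has_jet (\<lambda>x. x$i * f x) x (f x *\<^sub>R axis i 1 + x$i *\<^sub>R p)
    (x$i *\<^sub>R X + (\<chi> j k. axis i 1 $ j * p $ k + p $ j * axis i 1 $ k))" (is "has_jet _ _ ?p (_ + ?E)")
proof -
  obtain K where K: "K \<ge> 0" "\<And>h. norm h \<le> 1 \<Longrightarrow>
      \<bar>f (x + h) - f x - p \<bullet> h - 1/2 * ((X *v h) \<bullet> h)\<bar> \<le> K * norm h ^ 3"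
    using assms unfolding has_jet_def by metis
  obtain C where C: "C \<ge> 0" "\<And>h. \<bar>(X *v h) \<bullet> h\<bar> \<le> C * (norm h)\<^sup>2"
    using inner_matrix_bound[of X] by blast
  have E: "(?E *v h) \<bullet> h = 2 * h$i * (p \<bullet> h)" for h
  proof -
    have "?E *v h = (p \<bullet> h) *\<^sub>R axis i 1 + (h$i) *\<^sub>R p"
      by (simp add: vec_eq_iff matrix_vector_mult_def inner_vec_def algebra_simps sum.distrib
          sum_distrib_left axis_def if_distrib[where f="\<lambda>a. a * _"] if_distrib[where f="\<lambda>a. _ * a"] cong: if_cong)
    then show ?thesis
      by (simp add: inner_add_left inner_axis' algebra_simps)
  qed
  have "\<bar>(x + h)$i * f (x + h) - x$i * f x - ?p \<bullet> h - 1/2 * (((x$i *\<^sub>R X + ?E) *v h) \<bullet> h)\<bar>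
      \<le> ((\<bar>x$i\<bar> + 1) * K + C) * norm h ^ 3" if h: "norm h \<le> 1" for h
  proof -
    define r where "r = f (x + h) - f x - p \<bullet> h - 1/2 * ((X *v h) \<bullet> h)"
    have r: "\<bar>r\<bar> \<le> K * norm h ^ 3" using K(2)[OF h] by (simp add: r_def)
    have hi: "\<bar>h$i\<bar> \<le> norm h" using component_le_norm_cart[of h i] .
    \<comment> \<open>What remains is the old remainder times a bounded factor and the product of
      \<open>h$i\<close> with the quadratic part of \<open>f\<close>; both are cubic in
      \<open>h\<close>.\<close>
    have eq: "(x + h)$i * f (x + h) - x$i * f x - ?p \<bullet> h - 1/2 * (((x$i *\<^sub>R X + ?E) *v h) \<bullet> h)
      = (x$i + h$i) * r + h$i * (1/2 * ((X *v h) \<bullet> h))"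
      unfolding matrix_vector_mult_add_rdistrib inner_add_left E matrix_vector_scaleR r_def
      by (simp add: inner_axis' algebra_simps)
    have "\<bar>(x$i + h$i) * r\<bar> \<le> (\<bar>x$i\<bar> + 1) * (K * norm h ^ 3)"
      unfolding abs_mult by (intro mult_mono r) (use hi h in auto)
    moreover have "\<bar>h$i * (1/2 * ((X *v h) \<bullet> h))\<bar> \<le> norm h * (C * (norm h)\<^sup>2)"
      unfolding abs_mult[of "h$i"] using C(2)[of h] by (intro mult_mono hi) auto
    ultimately show ?thesis unfolding eq
      by (simp add: algebra_simps power3_eq_cube power2_eq_square)
  qed
  moreover have "transpose (x$i *\<^sub>R X + ?E) = x$i *\<^sub>R X + ?E"
    using assms by (simp add: has_jet_def transpose_def vec_eq_iff algebra_simps)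
  ultimately show ?thesis
    unfolding has_jet_def using K(1) C(1)
    by (intro conjI exI[of _ "(\<bar>x$i\<bar> + 1) * K + C"]) auto
qed

lemma poly_deg_le_has_jet:
  "poly_deg_le m f \<Longrightarrow> \<exists>p X. has_jet f x p X"
  by (induction rule: poly_deg_le.induct) (blast intro: has_jet_const has_jet_add has_jet_var)+

text \<open>Along a ray \<open>s *\<^sub>R v\<close> with small \<open>s\<close> the linear term
  would dominate if \<open>p\<close> were nonzero, and once it is gone the quadratic term dominates
  the cubic one. For the trace the coordinate directions suffice.\<close>

lemma has_jet_local_max:
  fixes f :: "real^'n \<Rightarrow> real"
  assumes jet: "has_jet f x p X" and e: "e > 0"
    and max: "\<And>h. norm h < e \<Longrightarrow> f (x + h) \<le> f x"
  shows "p = 0" "trace X \<le> 0"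
proof -
  obtain K where K: "K \<ge> 0" "\<And>h. norm h \<le> 1 \<Longrightarrow>
      \<bar>f (x + h) - f x - p \<bullet> h - 1/2 * ((X *v h) \<bullet> h)\<bar> \<le> K * norm h ^ 3"
    using jet unfolding has_jet_def by metis
  obtain C where C: "C \<ge> 0" "\<And>h. \<bar>(X *v h) \<bullet> h\<bar> \<le> C * (norm h)\<^sup>2"
    using inner_matrix_bound[of X] by blast
  have ub: "s * (p \<bullet> v) + s\<^sup>2 / 2 * ((X *v v) \<bullet> v) \<le> K * s ^ 3"
    if s: "0 < s" "s < e" "s \<le> 1" and v: "norm v = 1" for s v
  proof -
    have n: "norm (s *\<^sub>R v) = s" using s v by simp
    have "(X *v (s *\<^sub>R v)) \<bullet> (s *\<^sub>R v) = s\<^sup>2 * ((X *v v) \<bullet> v)"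
      by (simp add: matrix_vector_mult_scaleR power2_eq_square)
    with K(2)[of "s *\<^sub>R v"] max[of "s *\<^sub>R v"] n s show ?thesis
      by simp
  qed
  show p: "p = 0"
  proof (rule ccontr)
    assume "p \<noteq> 0"
    define v where "v = p /\<^sub>R norm p"
    have v: "norm v = 1" "p \<bullet> v = norm p" using \<open>p \<noteq> 0\<close>
      by (auto simp: v_def norm_eq_sqrt_inner real_div_sqrt field_simps power2_norm_eq_inner)
    \<comment> \<open>For this \<open>s\<close> the quadratic and cubic terms together are at most
      half of the linear gain \<open>s * norm p\<close>.\<close>
    define s where "s = min (e/2) (min 1 (norm p / (2 * (K + C + 1))))"
    have s: "0 < s" "s < e" "s \<le> 1" "s \<le> norm p / (2 * (K + C + 1))"
      using e \<open>p \<noteq> 0\<close> K(1) C(1) by (simp_all add: s_def min_less_iff_disj)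
    have "- ((X *v v) \<bullet> v) \<le> C" using C(2)[of v] v(1) by simp
    then have "s * norm p \<le> K * s ^ 3 + s\<^sup>2 / 2 * C"
      using ub[OF s(1-3) v(1)] C(2)[of v] v s(1)
        mult_left_mono[of "- ((X *v v) \<bullet> v)" C "s\<^sup>2/2"] by simp
    also have "\<dots> \<le> s\<^sup>2 * (K + C)"
    proof -
      have "K * s ^ 3 \<le> s\<^sup>2 * K"
        using s K(1) mult_right_mono[of s 1 "K * s\<^sup>2"]
        by (simp add: power2_eq_square power3_eq_cube algebra_simps)
      moreover have "s\<^sup>2 / 2 * C \<le> s\<^sup>2 * C" using C(1) by (intro mult_right_mono) auto
      ultimately show ?thesis unfolding distrib_left by linarith
    qed
    finally have "norm p \<le> s * (K + C)" using s(1) by (simp add: power2_eq_square)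
    moreover have "s * (2 * (K + C + 1)) \<le> norm p"
      using s(4) K(1) C(1) by (simp add: field_simps)
    moreover have "s * (K + C) \<le> s * (K + C + 1)" using s(1) by simp
    moreover have "s * (K + C) \<ge> 0" using s(1) K C by simp
    ultimately show False using s(1) \<open>p \<noteq> 0\<close> by (auto simp: algebra_simps)
  qed
  have "(X *v v) \<bullet> v \<le> 0" if v: "norm v = 1" for v
  proof (rule ccontr)
    assume pos: "\<not> (X *v v) \<bullet> v \<le> 0"
    define s where "s = min (e/2) (min 1 (((X *v v) \<bullet> v) / (4 * (K + 1))))"
    have s: "0 < s" "s < e" "s \<le> 1" "s \<le> ((X *v v) \<bullet> v) / (4 * (K + 1))"
      using e pos K(1) by (simp_all add: s_def min_less_iff_disj)
    have "s\<^sup>2 / 2 * ((X *v v) \<bullet> v) \<le> s\<^sup>2 * (K * s)"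
      using ub[OF s(1-3) v] p by (simp add: power2_eq_square power3_eq_cube algebra_simps)
    then have "((X *v v) \<bullet> v) / 2 \<le> K * s" using s(1) by simp
    moreover have "s * (4 * (K + 1)) \<le> ((X *v v) \<bullet> v)"
      using s(4) K(1) by (simp add: field_simps)
    moreover have "0 \<le> K * s" using s K by simp
    ultimately show False using s(1) pos by (auto simp: algebra_simps)
  qed
  moreover have "(X *v axis i 1) \<bullet> axis i 1 = X $ i $ i" for i
    by (simp add: matrix_vector_mult_basis inner_axis column_def)
  ultimately have "X $ i $ i \<le> 0" for i by (metis norm_axis_1)
  then show "trace X \<le> 0"
    unfolding trace_def by (intro sum_nonpos)
qed

text \<open>The function f - f is zero, so every point is a maximum;
  \<open>has_jet_local_max\<close> applies to the difference of the two jets and to its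
  negative.\<close>

lemma has_jet_unique:
  assumes "has_jet f x p X" "has_jet f x q Y"
  shows "p = q" "trace X = trace Y"
proof -
  have 1: "has_jet (\<lambda>x. f x + (-1) * f x) x (p + (-1) *\<^sub>R q) (X + (-1) *\<^sub>R Y)"
    by (intro has_jet_add has_jet_cmult assms)
  have 2: "has_jet (\<lambda>x. f x + (-1) * f x) x (q + (-1) *\<^sub>R p) (Y + (-1) *\<^sub>R X)"
    by (intro has_jet_add has_jet_cmult assms)
  have "p + (-1) *\<^sub>R q = 0" "trace (X + (-1) *\<^sub>R Y) \<le> 0" "trace (Y + (-1) *\<^sub>R X) \<le> 0"
    using has_jet_local_max[OF 1, of 1] has_jet_local_max[OF 2, of 1] by auto
  then show "p = q" "trace X = trace Y"
    by (auto simp: trace_def sum_subtractf sum_negf sum.distrib)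
qed

section \<open>Gradient and Laplacian of polynomials, with their degrees\<close>

definition lap :: "(real^'n \<Rightarrow> real) \<Rightarrow> real^'n \<Rightarrow> real" where
  "lap f x = (THE l. \<exists>p X. has_jet f x p X \<and> trace X = l)"

definition grad :: "(real^'n \<Rightarrow> real) \<Rightarrow> real^'n \<Rightarrow> real^'n" where
  "grad f x = (THE p. \<exists>X. has_jet f x p X)"

lemma lap_eq: "has_jet f x p X \<Longrightarrow> lap f x = trace X"
  unfolding lap_def by (rule the_equality) (auto dest: has_jet_unique)

lemma grad_eq: "has_jet f x p X \<Longrightarrow> grad f x = p"
  unfolding grad_def by (rule the_equality) (auto dest: has_jet_unique)

lemma poly_jet:
  assumes "poly_deg_le m f"
  obtains X where "has_jet f x (grad f x) X" "lap f x = trace X"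
  using poly_deg_le_has_jet[OF assms, of x] lap_eq grad_eq by metis

lemma lap_const [simp]: "lap (\<lambda>x. c) x = 0"
  using lap_eq[OF has_jet_const] by (simp add: trace_def)

lemma grad_const [simp]: "grad (\<lambda>x. c) x = 0"
  using grad_eq[OF has_jet_const] .

lemma poly_add:
  assumes "poly_deg_le m f" "poly_deg_le k g"
  shows "lap (\<lambda>x. f x + g x) x = lap f x + lap g x"
    "grad (\<lambda>x. f x + g x) x = grad f x + grad g x"
proof -
  obtain X Y where 1: "has_jet f x (grad f x) X" "lap f x = trace X"
    and 2: "has_jet g x (grad g x) Y" "lap g x = trace Y"
    using assms by (metis poly_jet)
  show "lap (\<lambda>x. f x + g x) x = lap f x + lap g x"
    "grad (\<lambda>x. f x + g x) x = grad f x + grad g x"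
    using lap_eq[OF has_jet_add[OF 1(1) 2(1)]] grad_eq[OF has_jet_add[OF 1(1) 2(1)]] 1 2
    by (simp_all add: trace_add)
qed

lemma poly_cmult:
  assumes "poly_deg_le m f"
  shows "lap (\<lambda>x. c * f x) x = c * lap f x" "grad (\<lambda>x. c * f x) x = c *\<^sub>R grad f x"
proof -
  obtain X where 1: "has_jet f x (grad f x) X" "lap f x = trace X"
    using assms by (metis poly_jet)
  show "lap (\<lambda>x. c * f x) x = c * lap f x" "grad (\<lambda>x. c * f x) x = c *\<^sub>R grad f x"
    using lap_eq[OF has_jet_cmult[OF 1(1), of c]] grad_eq[OF has_jet_cmult[OF 1(1), of c]] 1
    by (simp_all add: trace_def sum_distrib_left)
qed

lemma poly_diff_lap:
  assumes "poly_deg_le m f" "poly_deg_le k g"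
  shows "lap (\<lambda>x. f x - g x) x = lap f x - lap g x"
  using poly_add(1)[OF assms(1) poly_deg_le_cmult[OF assms(2), of "-1"], of x]
    poly_cmult(1)[OF assms(2), of "-1" x] by simp

lemma poly_var:
  assumes "poly_deg_le m f"
  shows "lap (\<lambda>x. x$i * f x) x = x$i * lap f x + 2 * grad f x $ i"
    "grad (\<lambda>x. x$i * f x) x = f x *\<^sub>R axis i 1 + x$i *\<^sub>R grad f x"
proof -
  obtain X where 1: "has_jet f x (grad f x) X" "lap f x = trace X"
    using assms by (metis poly_jet)
  have "trace (\<chi> j k. axis i 1 $ j * grad f x $ k + grad f x $ j * axis i 1 $ k) = 2 * grad f x $ i"
    by (simp add: trace_def axis_def sum.distrib
          if_distrib[where f="\<lambda>a. a * _"] if_distrib[where f="\<lambda>a. _ * a"] cong: if_cong)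
  then show "lap (\<lambda>x. x$i * f x) x = x$i * lap f x + 2 * grad f x $ i"
    "grad (\<lambda>x. x$i * f x) x = f x *\<^sub>R axis i 1 + x$i *\<^sub>R grad f x"
    using lap_eq[OF has_jet_var[OF 1(1), of i]] grad_eq[OF has_jet_var[OF 1(1), of i]] 1
    by (simp_all add: trace_def sum_distrib_left sum.distrib)
qed

lemma poly_deg_le_0: "poly_deg_le m f \<Longrightarrow> m = 0 \<Longrightarrow> \<exists>c. f = (\<lambda>x. c)"
  by (induction rule: poly_deg_le.induct) auto

lemma poly_deg_le_grad: "poly_deg_le m f \<Longrightarrow> poly_deg_le (m - 1) (\<lambda>x. grad f x $ i)"
proof (induction rule: poly_deg_le.induct)
  case (const m c)
  then show ?case by (simp add: poly_deg_le.const)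
next
  case (add m f g)
  then show ?case by (simp add: poly_add poly_deg_le.add)
next
  case (var m f j)
  have "poly_deg_le m (\<lambda>x. x$j * grad f x $ i)"
  proof (cases m)
    \<comment> \<open>Truncated subtraction makes the induction hypothesis too weak here: it gives
      degree 0, and the factor \<open>x$j\<close> would raise it to 1. Constancy of \<open>f\<close>
      makes the gradient vanish instead.\<close>
    case 0
    then obtain c where "f = (\<lambda>x. c)" using var poly_deg_le_0 by blast
    then show ?thesis by (simp add: poly_deg_le.const)
  next
    case (Suc m')
    then show ?thesis using poly_deg_le.var[OF var.IH] by simp
  qed
  moreover have "poly_deg_le m (\<lambda>x. axis j 1 $ i * f x)" by (intro poly_deg_le_cmult var)
  moreover have "(\<lambda>x. grad (\<lambda>x. x$j * f x) x $ i) = (\<lambda>x. axis j 1 $ i * f x + x$j * grad f x $ i)"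
    using var by (auto simp: poly_var)
  ultimately show ?case
    by (simp add: poly_deg_le.add)
qed

text \<open>Covers the degrees where \<open>m - 2\<close> is truncated, in which the induction for
  \<open>poly_deg_le_lap\<close> would otherwise be off by one.\<close>

lemma poly_deg_le_1_lap: "poly_deg_le m f \<Longrightarrow> m \<le> 1 \<Longrightarrow> lap f x = 0"
proof (induction rule: poly_deg_le.induct)
  case (var m f j)
  then obtain c where "f = (\<lambda>x. c)" using poly_deg_le_0 by auto
  then show ?case by (simp add: poly_var[OF poly_deg_le.const])
qed (auto simp: poly_add)

lemma poly_deg_le_lap: "poly_deg_le m f \<Longrightarrow> poly_deg_le (m - 2) (lap f)"
proof (induction rule: poly_deg_le.induct)
  case (const m c)
  have "lap (\<lambda>x::real^'n. c) = (\<lambda>x. 0)" by auto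
  then show ?case by (simp add: poly_deg_le.const)
next
  case (add m f g)
  have "lap (\<lambda>x. f x + g x) = (\<lambda>x. lap f x + lap g x)"
    using add by (auto simp: poly_add)
  then show ?case using add by (simp add: poly_deg_le.add)
next
  case (var m f j)
  have eq: "lap (\<lambda>x. x$j * f x) = (\<lambda>x. x$j * lap f x + 2 * grad f x $ j)"
    using var by (auto simp: poly_var)
  have "poly_deg_le (m - 1) (\<lambda>x. x$j * lap f x)"
  proof (cases "m \<le> 1")
    case True
    then have "(\<lambda>x. x$j * lap f x) = (\<lambda>x. 0)" using poly_deg_le_1_lap[OF var.hyps] by simp
    then show ?thesis by (simp add: poly_deg_le.const)
  next
    case False
    then have "Suc (m - 2) = m - 1" by auto
    then show ?thesis using poly_deg_le.var[OF var.IH, of j] by simp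
  qed
  moreover have "poly_deg_le (m - 1) (\<lambda>x. 2 * grad f x $ j)"
    by (intro poly_deg_le_cmult poly_deg_le_grad var)
  ultimately show ?case unfolding eq by (simp add: poly_deg_le.add)
qed

lemma lap_norm_square: "lap (\<lambda>x. (norm x)\<^sup>2) (x::real^'n) = 2 * real CARD('n)"
proof -
  have "has_jet (\<lambda>x. (norm x)\<^sup>2) x (2 *\<^sub>R x) (2 *\<^sub>R mat 1)"
  proof -
    have "transpose (2 *\<^sub>R mat 1 :: real^'n^'n) = 2 *\<^sub>R mat 1"
      by (auto simp: transpose_def mat_def vec_eq_iff)
    moreover have "(norm (x + h))\<^sup>2 - (norm x)\<^sup>2 - (2 *\<^sub>R x) \<bullet> h - 1/2 * (((2 *\<^sub>R mat 1) *v h) \<bullet> h) = 0" for h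
      by (simp add: matrix_vector_scaleR power2_norm_eq_inner inner_add_left inner_add_right inner_commute)
    ultimately show ?thesis unfolding has_jet_def by (intro conjI exI[of _ 0]) auto
  qed
  from lap_eq[OF this] show ?thesis
    by (simp add: trace_def mat_def)
qed

section \<open>The maximum principle for polynomials\<close>

lemma poly_max_principle_strict:
  assumes f: "poly_deg_le m f" and r: "r > 0"
    and lap: "\<And>x. x \<in> ball 0 r \<Longrightarrow> lap f x > 0"
    and bd: "\<And>x. x \<in> sphere 0 r \<Longrightarrow> f x \<le> c" and x: "x \<in> cball 0 r"
  shows "f x \<le> c"
proof -
  obtain y where y: "y \<in> cball 0 r" "\<And>z. z \<in> cball 0 r \<Longrightarrow> f z \<le> f y"
    using continuous_attains_sup[of "cball 0 r" f] poly_deg_le_continuous[OF f] r by auto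
  have "norm y = r"
  proof (rule ccontr)
    assume "norm y \<noteq> r"
    then have "y \<in> ball 0 r" using y(1) by auto
    obtain X where X: "has_jet f y (grad f y) X" "lap f y = trace X"
      using poly_jet[OF f] by blast
    have "trace X \<le> 0"
    proof (rule has_jet_local_max(2)[OF X(1)])
      show "r - norm y > 0" using \<open>y \<in> ball 0 r\<close> by simp
      fix h :: "real^'a" assume "norm h < r - norm y"
      then show "f (y + h) \<le> f y" by (intro y(2)) (use norm_triangle_ineq[of y h] in auto)
    qed
    then show False using lap[OF \<open>y \<in> ball 0 r\<close>] X(2) by simp
  qed
  then show ?thesis using bd[of y] y(2)[OF x] by auto
qed

lemma poly_max_principle:
  fixes f :: "real^'n \<Rightarrow> real"
  assumes f: "poly_deg_le m f" and r: "r > 0"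
    and lap: "\<And>x. x \<in> ball 0 r \<Longrightarrow> lap f x \<ge> 0"
    and bd: "\<And>x. x \<in> sphere 0 r \<Longrightarrow> f x \<le> c" and x: "x \<in> cball 0 r"
  shows "f x \<le> c"
proof (rule field_le_epsilon)
  fix e :: real assume e: "e > 0"
  \<comment> \<open>Adding \<open>d * (norm x)\<^sup>2\<close> makes the Laplacian strictly positive
    and raises the boundary values by exactly \<open>e\<close>.\<close>
  define d where "d = e / r\<^sup>2"
  have d: "d > 0" using e r by (simp add: d_def)
  have m: "poly_deg_le 2 (\<lambda>x::real^'n. d * (norm x)\<^sup>2)"
    by (intro poly_deg_le_cmult poly_deg_le_norm_square)
  have p: "poly_deg_le (max m 2) (\<lambda>x. f x + d * (norm x)\<^sup>2)"
    using f m by (intro poly_deg_le.add) (auto intro: poly_deg_le_mono)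
  have "f x + d * (norm x)\<^sup>2 \<le> c + e"
  proof (rule poly_max_principle_strict[OF p r _ _ x])
    show "lap (\<lambda>x. f x + d * (norm x)\<^sup>2) x > 0" if "x \<in> ball 0 r" for x
      using lap[OF that] d
      by (simp add: poly_add(1)[OF f m] poly_cmult(1)[OF poly_deg_le_norm_square] lap_norm_square
          add_nonneg_pos)
    show "f x + d * (norm x)\<^sup>2 \<le> c + e" if "x \<in> sphere 0 r" for x
      using bd[OF that] that r by (simp add: d_def)
  qed
  moreover have "0 \<le> d * (norm x)\<^sup>2" using d by simp
  ultimately show "f x \<le> c + e" by linarith
qed

text \<open>A dimension count inside an infinite-dimensional function space: the image of a basis of
  the span is independent and as large as the basis, so a missed vector would give an independent
  set that is too large. Linearity is asked only on the span, because \<open>lap\<close> has meaning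
  only for functions that have a jet.\<close>

lemma (in vector_space) injective_on_finite_span_surjective:
  assumes F: "finite F"
    and add: "\<And>x y. x \<in> span F \<Longrightarrow> y \<in> span F \<Longrightarrow> T (x + y) = T x + T y"
    and scl: "\<And>c x. x \<in> span F \<Longrightarrow> T (scale c x) = scale c (T x)"
    and into: "\<And>x. x \<in> span F \<Longrightarrow> T x \<in> span F"
    and inj: "\<And>x. x \<in> span F \<Longrightarrow> T x = 0 \<Longrightarrow> x = 0"
    and w: "w \<in> span F"
  shows "\<exists>x\<in>span F. T x = w"
proof -
  obtain B where B: "B \<subseteq> span F" "independent B" "span F \<subseteq> span B"
    using maximal_independent_subset[of "span F"] by blast
  have span: "span B = span F" using B(1,3) by (metis span_minimal subspace_span subset_antisym)
  have finB: "finite B" using independent_span_bound[OF F B(2,1)] by simp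
  interpret p: vector_space_pair scale scale ..
  \<comment> \<open>A globally linear map that agrees with \<open>T\<close> on the span, so that the
    general facts on linear maps apply.\<close>
  define T' where "T' = p.construct B T"
  have lin: "Vector_Spaces.linear scale scale T'"
    unfolding T'_def by (rule p.linear_construct[OF B(2)])
  interpret T': Vector_Spaces.linear scale scale T' by (rule lin)
  have T': "T' x = T x" if "x \<in> span F" for x
  proof -
    have "x \<in> span B" using that span by simp
    then have "x \<in> span F \<and> T' x = T x"
    proof (induction rule: span_induct_alt)
      case base
      then show ?case using scl[of 0 0] by (auto simp: span_zero)
    next
      case (step c b y)
      moreover have "b \<in> span F" using step B(1) by blast
      moreover have "T' b = T b" unfolding T'_def using step by (intro p.construct_basis B(2))
      ultimately show ?case
        by (auto simp: T'.add T'.scale add scl span_add span_scale)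
    qed
    then show ?thesis by simp
  qed
  have injT: "inj_on T' (span B)"
    using T'.inj_on_iff_eq_0[OF subspace_span, of B] T' inj span by auto
  have ind: "independent (T' ` B)"
    by (rule T'.independent_injective_image[OF B(2) injT])
  have sub: "T' ` B \<subseteq> span F" using into T' B(1) by force
  have card: "card (T' ` B) = card B"
    by (rule card_image) (use injT span_superset in \<open>auto intro: inj_on_subset\<close>)
  have "w \<in> span (T' ` B)"
  proof (rule ccontr)
    assume n: "w \<notin> span (T' ` B)"
    then have "independent (insert w (T' ` B))" using ind by (rule independent_insertI)
    moreover have "insert w (T' ` B) \<subseteq> span B" using w sub span by auto
    ultimately have "card (insert w (T' ` B)) \<le> card B"
      using independent_span_bound[OF finB] by blast
    moreover have "w \<notin> T' ` B" using n span_superset by blast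
    ultimately show False using card finB by simp
  qed
  then obtain x where "x \<in> span B" "w = T' x" using T'.span_image by auto
  then show ?thesis using T' span by auto
qed

lemma poly_line:
  "poly_deg_le m f \<Longrightarrow> \<exists>c. \<forall>s. f (s *\<^sub>R x) = (\<Sum>i\<le>m. c i * s ^ i)"
proof (induction rule: poly_deg_le.induct)
  case (const m c)
  have "c = (\<Sum>i\<le>m. (if i = 0 then c else 0) * s ^ i)" for s :: real
    by (simp add: if_distrib[where f="\<lambda>a. a * _"] cong: if_cong)
  then show ?case by (intro exI[of _ "\<lambda>i. if i = 0 then c else 0"] allI)
next
  case (add m f g)
  then obtain a b where "\<forall>s. f (s *\<^sub>R x) = (\<Sum>i\<le>m. a i * s ^ i)" "\<forall>s. g (s *\<^sub>R x) = (\<Sum>i\<le>m. b i * s ^ i)"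
    by blast
  then show ?case by (intro exI[of _ "\<lambda>i. a i + b i"]) (simp add: distrib_right sum.distrib)
next
  case (var m f j)
  then obtain a where a: "\<forall>s. f (s *\<^sub>R x) = (\<Sum>i\<le>m. a i * s ^ i)" by blast
  have "(s *\<^sub>R x)$j * f (s *\<^sub>R x) = (\<Sum>i\<le>Suc m. (case i of 0 \<Rightarrow> 0 | Suc k \<Rightarrow> x$j * a k) * s ^ i)" for s
    unfolding sum.atMost_Suc_shift using a by (simp add: sum_distrib_left mult_ac)
  then show ?case by (intro exI[of _ "\<lambda>i. case i of 0 \<Rightarrow> 0 | Suc k \<Rightarrow> x$j * a k"]) blast
qed

text \<open>On the ray through \<open>x\<close> the polynomial has one real variable and infinitely
  many zeros near 0, so all its coefficients vanish; then evaluate at parameter 1.\<close>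

lemma poly_zero_on_ball:
  assumes f: "poly_deg_le m f" and r: "r > 0" and z: "\<And>x. x \<in> ball 0 r \<Longrightarrow> f x = 0"
  shows "f x = 0"
proof -
  obtain c where c: "\<And>s. f (s *\<^sub>R x) = (\<Sum>i\<le>m. c i * s ^ i)" using poly_line[OF f, of x] by metis
  define e where "e = r / (norm x + 1)"
  have e: "e > 0" using r by (simp add: e_def add_nonneg_pos)
  have "{0<..<e} \<subseteq> {s. (\<Sum>i\<le>m. c i * s ^ i) = 0}"
  proof
    fix s assume s: "s \<in> {0<..<e}"
    have "norm (s *\<^sub>R x) \<le> s * (norm x + 1)" using s by (simp add: algebra_simps)
    also have "\<dots> < e * (norm x + 1)"
      using s by (intro mult_strict_right_mono) (auto intro: add_nonneg_pos)
    also have "\<dots> = r" using add_nonneg_pos[of "norm x" 1] by (simp add: e_def)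
    finally have "s *\<^sub>R x \<in> ball 0 r" by simp
    from z[OF this] show "s \<in> {s. (\<Sum>i\<le>m. c i * s ^ i) = 0}" by (simp add: c)
  qed
  then have "infinite {s. (\<Sum>i\<le>m. c i * s ^ i) = 0}"
    using e infinite_Ioo finite_subset by blast
  then have "c i = 0" if "i \<le> m" for i
    using polyfun_roots_finite[of c i m] that by auto
  then have "f (1 *\<^sub>R x) = 0" unfolding c by simp
  then show ?thesis by simp
qed

section \<open>Finite dimension of the polynomials of bounded degree, and the Dirichlet
  problem\<close>

lemma vector_space_fun: "vector_space (\<lambda>(c::real) (f::'a \<Rightarrow> real) x. c * f x)"
  by unfold_locales (auto simp: fun_eq_iff algebra_simps)

lemma poly_deg_le_span:
  defines "scl \<equiv> (\<lambda>(c::real) (f::real^'n \<Rightarrow> real) x. c * f x)"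
  shows "\<exists>F. finite F \<and> module.span scl F = Collect (poly_deg_le m)"
proof -
  interpret vector_space scl unfolding scl_def by (rule vector_space_fun)
  have sub: "subspace (Collect (poly_deg_le m))" for m
    unfolding subspace_def
    by (auto simp: scl_def zero_fun_def plus_fun_def intro: poly_deg_le.intros poly_deg_le_cmult)
  have "\<exists>F. finite F \<and> F \<subseteq> Collect (poly_deg_le m) \<and> Collect (poly_deg_le m) \<subseteq> span F"
  proof (induction m)
    case 0
    have "f \<in> span {\<lambda>x. 1}" if f: "poly_deg_le 0 f" for f
    proof -
      obtain c where "f = (\<lambda>x. c)" using poly_deg_le_0[OF f refl] by blast
      then have "f = scl c (\<lambda>x. 1)" by (simp add: scl_def)
      then show ?thesis by (simp add: span_scale span_base)
    qed
    then show ?case by (intro exI[of _ "{\<lambda>x. 1}"]) (auto intro: poly_deg_le.const)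
  next
    case (Suc m)
    then obtain F where F: "finite F" "F \<subseteq> Collect (poly_deg_le m)" "Collect (poly_deg_le m) \<subseteq> span F"
      by blast
    \<comment> \<open>Degree m + 1 is generated by the constants and by the products of a coordinate
      with a generator of degree m.\<close>
    define F' where "F' = insert (\<lambda>x. 1) ((\<lambda>(i, f) x. x$i * f x) ` (UNIV \<times> F))"
    have "f \<in> span F'" if "poly_deg_le k f" "k = Suc m" for f k
      using that
    proof (induction rule: poly_deg_le.induct)
      case (const m c)
      have "(\<lambda>x. c) = scl c (\<lambda>x. 1)" by (simp add: scl_def)
      then show ?case by (simp add: span_scale span_base F'_def)
    next
      case (add m f g)
      then have "f + g \<in> span F'" by (auto intro: span_add)
      then show ?case by (simp add: plus_fun_def)
    next
      case (var k f i)
      then have "f \<in> span F" using F by auto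
      then show ?case
      proof (induction rule: span_induct_alt)
        case base
        show ?case using span_zero by (simp add: zero_fun_def)
      next
        case (step c g h)
        have "(\<lambda>x. x$i * g x) \<in> F'" using step by (force simp: F'_def)
        then have "scl c (\<lambda>x. x$i * g x) + (\<lambda>x. x$i * h x) \<in> span F'"
          using step by (intro span_add span_scale) (auto intro: span_base)
        moreover have "scl c (\<lambda>x. x$i * g x) + (\<lambda>x. x$i * h x) = (\<lambda>x. x$i * (scl c g + h) x)"
          by (auto simp: scl_def algebra_simps)
        ultimately show ?case by simp
      qed
    qed
    moreover have "finite F'" using F by (simp add: F'_def)
    moreover have "F' \<subseteq> Collect (poly_deg_le (Suc m))"
      using F(2) by (auto simp: F'_def intro: poly_deg_le.intros)
    ultimately show ?case by (intro exI[of _ F']) auto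
  qed
  then show ?thesis using sub span_minimal by (metis subset_antisym)
qed

text \<open>The map \<open>q \<mapsto> \<Delta>((r\<^sup>2 - \<bar>x\<bar>\<^sup>2) q)\<close> preserves the polynomials of degree at most \<open>k\<close> and is
  injective by the maximum principle, hence surjective.\<close>

lemma poly_dirichlet:
  fixes g w :: "real^'n \<Rightarrow> real"
  assumes r: "r > 0" and g: "poly_deg_le m g" and w: "poly_deg_le k w"
  shows "\<exists>h j. poly_deg_le j h \<and> (\<forall>x. lap h x = w x) \<and> (\<forall>x\<in>sphere 0 r. h x = g x)"
proof -
  define scl where "scl = (\<lambda>(c::real) (f::real^'n \<Rightarrow> real) x. c * f x)"
  interpret vector_space scl unfolding scl_def by (rule vector_space_fun)
  define N where "N = max k m"
  define b where "b = (\<lambda>x::real^'n. r\<^sup>2 - (norm x)\<^sup>2)"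
  define T where "T = (\<lambda>q. lap (\<lambda>x. b x * q x))"
  obtain F where F: "finite F" "span F = Collect (poly_deg_le N)"
    using poly_deg_le_span[of N] unfolding scl_def by blast
  have b: "poly_deg_le 2 b"
    unfolding b_def by (intro poly_deg_le_diff poly_deg_le.const poly_deg_le_norm_square)
  have bq: "poly_deg_le (2 + N) (\<lambda>x. b x * q x)" if "q \<in> span F" for q
    using poly_deg_le_mult[OF b, of N q] that F by auto
  \<comment> \<open>The solution is sought as g + b q. Since b vanishes on the sphere the boundary
    values are right, and \<open>b * q\<close> has to supply the missing Laplacian
    \<open>v\<close>.\<close>
  define v where "v = (\<lambda>x. w x - lap g x)"
  have v: "v \<in> span F"
    unfolding F v_def N_def
    by (auto intro!: poly_deg_le_diff intro: poly_deg_le_mono[OF w] poly_deg_le_mono[OF poly_deg_le_lap[OF g]])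
  have "\<exists>q\<in>span F. T q = v"
  proof (rule injective_on_finite_span_surjective[OF F(1)])
    fix p q assume pq: "p \<in> span F" "q \<in> span F"
    show "T (p + q) = T p + T q"
      using poly_add(1)[OF bq[OF pq(1)] bq[OF pq(2)]]
      by (auto simp: T_def fun_eq_iff distrib_left)
  next
    fix c q assume q: "q \<in> span F"
    show "T (scl c q) = scl c (T q)"
      using poly_cmult(1)[OF bq[OF q], of c]
      by (auto simp: T_def scl_def fun_eq_iff mult.left_commute)
  next
    fix q assume q: "q \<in> span F"
    show "T q \<in> span F"
      using poly_deg_le_lap[OF bq[OF q]] by (simp add: T_def F)
    assume 0: "T q = 0"
    have l: "lap (\<lambda>x. c * (b x * q x)) x = 0" for c x
      using 0 poly_cmult(1)[OF bq[OF q], of c x] by (simp add: T_def fun_eq_iff)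
    \<comment> \<open>The free factor \<open>c\<close> gives both signs, so the one-sided maximum
      principle yields b q = 0.\<close>
    have le: "c * (b x * q x) \<le> 0" if "x \<in> cball 0 r" for c x
      by (rule poly_max_principle[OF poly_deg_le_cmult[OF bq[OF q]] r _ _ that])
        (auto simp: l, simp add: b_def)
    have "b x * q x = 0" if "x \<in> cball 0 r" for x
      using le[OF that, of 1] le[OF that, of "-1"] by simp
    moreover have "b x \<noteq> 0" if "x \<in> ball 0 r" for x
      using that power_strict_mono[of "norm x" r 2] by (auto simp: b_def)
    ultimately have "q x = 0" if "x \<in> ball 0 r" for x using that by force
    then show "q = 0" using poly_zero_on_ball[of N q r] q F r by (auto simp: fun_eq_iff)
  qed (rule v)
  then obtain q where q: "q \<in> span F" "T q = v" by blast
  have "lap (\<lambda>x. g x + b x * q x) x = w x" for x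
    using q(2) by (simp add: poly_add(1)[OF g bq[OF q(1)]] T_def v_def fun_eq_iff)
  moreover have "poly_deg_le (2 + N) (\<lambda>x. g x + b x * q x)"
    by (intro poly_deg_le.add bq[OF q(1)] poly_deg_le_mono[OF g]) (simp add: N_def)
  ultimately show ?thesis
    by (intro exI[of _ "\<lambda>x. g x + b x * q x"] exI[of _ "2 + N"]) (auto simp: b_def)
qed

section \<open>Sums of viscosity subsolutions of Poisson equations\<close>

text \<open>The viscosity inequality \<open>\<Delta>U \<ge> q\<close> near \<open>0\<close>, encoded as a comparison principle against polynomials.\<close>

definition laplace_sub :: "(real^'n \<Rightarrow> real) \<Rightarrow> real \<Rightarrow> real \<Rightarrow> bool" where
  "laplace_sub U q r \<longleftrightarrow> (\<forall>\<rho> h m. 0 < \<rho> \<longrightarrow> \<rho> < r \<longrightarrow> poly_deg_le m h \<longrightarrow>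
     (\<forall>z\<in>ball 0 \<rho>. lap h z < q) \<longrightarrow> (\<forall>z\<in>sphere 0 \<rho>. U z < h z) \<longrightarrow> (\<forall>z\<in>cball 0 \<rho>. U z \<le> h z))"

lemma laplace_sub_dominated:
  fixes U :: "real^'n \<Rightarrow> real"
  assumes U: "laplace_sub U q r" "continuous_on UNIV U" and rho: "0 < \<rho>" "\<rho> < r"
    and d: "d > 0" and q': "q' < q"
  obtains h m where "poly_deg_le m h" "\<And>z. lap h z = q'" "U 0 \<le> h 0"
    "\<And>z. z \<in> sphere 0 \<rho> \<Longrightarrow> h z < U z + d"
proof -
  \<comment> \<open>Approximating \<open>U + d/2\<close> with error below \<open>d/2\<close> puts
    the boundary values strictly between \<open>U\<close> and \<open>U + d\<close>. The strict lower
    bound and \<open>q' < q\<close> are the hypotheses under which \<open>laplace_sub\<close> gives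
    comparison.\<close>
  obtain g where g: "real_polynomial_function g" "\<And>x. x \<in> sphere 0 \<rho> \<Longrightarrow> \<bar>U x + d/2 - g x\<bar> < d/2"
  proof -
    have "continuous_on (sphere 0 \<rho>) (\<lambda>x. U x + d/2)"
      using continuous_on_subset[OF U(2)] by (intro continuous_intros) auto
    moreover have "d/2 > 0" using d by simp
    ultimately show thesis
      using Stone_Weierstrass_real_polynomial_function[OF compact_sphere] that by blast
  qed
  obtain m where m: "poly_deg_le m g" using real_polynomial_function_imp_poly_deg_le[OF g(1)] by blast
  obtain h j where h: "poly_deg_le j h" "\<forall>x. lap h x = q'" "\<forall>x\<in>sphere 0 \<rho>. h x = g x"
    using poly_dirichlet[OF rho(1) m poly_deg_le.const[of 0 q']] by blast
  have bd: "U x < h x \<and> h x < U x + d" if "x \<in> sphere 0 \<rho>" for x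
  proof -
    have "h x = g x" using h(3) that by blast
    then show ?thesis using g(2)[OF that, unfolded abs_less_iff] by linarith
  qed
  then have "U 0 \<le> h 0"
    using U(1)[unfolded laplace_sub_def, rule_format, OF rho h(1)] h(2) q' rho by auto
  with that h bd show thesis by blast
qed

lemma laplace_sub_sum:
  fixes U W Q :: "real^'n \<Rightarrow> real"
  assumes U: "laplace_sub U q1 r" "continuous_on UNIV U"
    and W: "laplace_sub W q2 r" "continuous_on UNIV W"
    and Q: "poly_deg_le k Q" "\<And>z. lap Q z = l" and r: "r > 0"
    and le: "\<And>z. z \<in> ball 0 r \<Longrightarrow> U z + W z \<le> Q z" and eq: "U 0 + W 0 = Q 0"
  shows "q1 + q2 \<le> l"
proof (rule ccontr)
  assume "\<not> q1 + q2 \<le> l"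
  define d where "d = real CARD('n)"
  have d: "d > 0" by (simp add: d_def)
  \<comment> \<open>The assumed excess q1 + q2 - l is used up exactly: one \<beta> is taken from
    each right-hand side, and 2 d \<beta> is the Laplacian of
    \<open>\<beta> * (norm z)\<^sup>2\<close>. The final comparison function is therefore
    harmonic.\<close>
  define \<beta> where "\<beta> = (q1 + q2 - l) / (2 + 2 * d)"
  have beta: "\<beta> > 0" "\<beta> * (2 + 2 * d) = q1 + q2 - l"
    using \<open>\<not> q1 + q2 \<le> l\<close> d by (auto simp: \<beta>_def)
  define \<rho> where "\<rho> = r / 2"
  have rho: "0 < \<rho>" "\<rho> < r" using r by (auto simp: \<rho>_def)
  \<comment> \<open>On the sphere the quadratic term is worth 3 \<gamma>. The two approximations
    spend 2 \<gamma>, so \<open>?f\<close> is at most -\<gamma> there, whereas at the centre it is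
    nonnegative.\<close>
  define \<gamma> where "\<gamma> = \<beta> * \<rho>\<^sup>2 / 3"
  have gam: "\<gamma> > 0" using beta rho by (simp add: \<gamma>_def)
  obtain h1 m1 where h1: "poly_deg_le m1 h1" "\<And>z. lap h1 z = q1 - \<beta>" "U 0 \<le> h1 0"
    "\<And>z. z \<in> sphere 0 \<rho> \<Longrightarrow> h1 z < U z + \<gamma>"
    using laplace_sub_dominated[OF U rho gam, of "q1 - \<beta>"] beta(1) by (metis diff_less_eq less_add_same_cancel1)
  obtain h2 m2 where h2: "poly_deg_le m2 h2" "\<And>z. lap h2 z = q2 - \<beta>" "W 0 \<le> h2 0"
    "\<And>z. z \<in> sphere 0 \<rho> \<Longrightarrow> h2 z < W z + \<gamma>"
    using laplace_sub_dominated[OF W rho gam, of "q2 - \<beta>"] beta(1) by (metis diff_less_eq less_add_same_cancel1)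
  define n where "n = max (max m1 m2) (max k 2)"
  have b: "poly_deg_le 2 (\<lambda>z::real^'n. \<beta> * (norm z)\<^sup>2)"
    by (intro poly_deg_le_cmult poly_deg_le_norm_square)
  have p: "poly_deg_le n (\<lambda>z. h1 z + h2 z)" "poly_deg_le n (\<lambda>z. Q z + \<beta> * (norm z)\<^sup>2)"
    unfolding n_def
    by (intro poly_deg_le.add poly_deg_le_mono[OF h1(1)] poly_deg_le_mono[OF h2(1)]
        poly_deg_le_mono[OF Q(1)] poly_deg_le_mono[OF b]; simp)+
  let ?f = "\<lambda>z. (h1 z + h2 z) - (Q z + \<beta> * (norm z)\<^sup>2)"
  have lap: "lap ?f z = 0" for z
    using beta(2) unfolding d_def
    by (simp add: poly_diff_lap[OF p] poly_add(1)[OF h1(1) h2(1)] poly_add(1)[OF Q(1) b] h1 h2 Q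
        poly_cmult(1)[OF poly_deg_le_norm_square] lap_norm_square algebra_simps)
  have "?f 0 \<le> - \<gamma>"
  proof (rule poly_max_principle[OF poly_deg_le_diff[OF p] rho(1)])
    fix z :: "real^'n" assume z: "z \<in> sphere 0 \<rho>"
    then have "U z + W z \<le> Q z" using le rho by simp
    moreover have "\<beta> * (norm z)\<^sup>2 = 3 * \<gamma>" using z by (simp add: \<gamma>_def)
    ultimately show "?f z \<le> - \<gamma>" using h1(4)[OF z] h2(4)[OF z] by simp
  qed (use rho lap in auto)
  then show False using gam h1(3) h2(3) eq by simp
qed

section \<open>Sup-convolutions\<close>

text \<open>The supremum runs over a set \<open>K\<close>, later compact, so that it is attained and
  values of \<open>f\<close> outside \<open>K\<close> never enter.\<close>

definition supconv :: "'a::real_normed_vector set \<Rightarrow> real \<Rightarrow> ('a \<Rightarrow> real) \<Rightarrow> 'a \<Rightarrow> real" where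
  "supconv K e f z = (SUP w\<in>K. f w - (norm (w - z))\<^sup>2 / (2 * e))"

definition supconv_star :: "'a::real_normed_vector set \<Rightarrow> real \<Rightarrow> ('a \<Rightarrow> real) \<Rightarrow> 'a \<Rightarrow> 'a \<Rightarrow> bool" where
  "supconv_star K e f z w \<longleftrightarrow> w \<in> K \<and> supconv K e f z = f w - (norm (w - z))\<^sup>2 / (2 * e)"

lemma supconv_attained:
  fixes f :: "'a::real_normed_vector \<Rightarrow> real"
  assumes "compact K" "K \<noteq> {}" "continuous_on K f"
  shows "\<exists>w. supconv_star K e f z w"
    and "w \<in> K \<Longrightarrow> f w - (norm (w - z))\<^sup>2 / (2 * e) \<le> supconv K e f z"
proof -
  have "continuous_on K (\<lambda>w. f w - (norm (w - z))\<^sup>2 / (2 * e))"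
    unfolding divide_inverse by (intro continuous_intros assms)
  then obtain v where v: "v \<in> K"
      "\<And>w. w \<in> K \<Longrightarrow> f w - (norm (w - z))\<^sup>2 / (2 * e) \<le> f v - (norm (v - z))\<^sup>2 / (2 * e)"
    using continuous_attains_sup[OF assms(1,2)] by blast
  have eq: "supconv K e f z = f v - (norm (v - z))\<^sup>2 / (2 * e)"
    unfolding supconv_def using v by (intro cSup_eq_maximum) auto
  then show "\<exists>w. supconv_star K e f z w"
    unfolding supconv_star_def using v(1) by blast
  show "w \<in> K \<Longrightarrow> f w - (norm (w - z))\<^sup>2 / (2 * e) \<le> supconv K e f z"
    unfolding eq by (rule v(2))
qed

text \<open>The maximiser for \<open>z\<close> is a competitor for \<open>z'\<close>, and the
  difference of the two squared distances is linear in z - z' with a factor of size at most 4 R.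
  This gives a Lipschitz bound in time although \<open>f\<close> is only continuous.\<close>

lemma supconv_lipschitz:
  fixes f :: "'a::real_inner \<Rightarrow> real"
  assumes K: "compact K" "K \<noteq> {}" "continuous_on K f" and e: "e > 0"
    and R: "K \<subseteq> cball 0 R" "norm z \<le> R" "norm z' \<le> R"
  shows "supconv K e f z \<le> supconv K e f z' + 2 * R / e * norm (z - z')"
proof -
  obtain w where w: "w \<in> K" "supconv K e f z = f w - (norm (w - z))\<^sup>2 / (2 * e)"
    using supconv_attained(1)[OF K] unfolding supconv_star_def by blast
  have "(norm (w - z'))\<^sup>2 - (norm (w - z))\<^sup>2 = (z - z') \<bullet> (2 *\<^sub>R w - z - z')"
    by (simp add: power2_norm_eq_inner inner_diff_left inner_diff_right inner_commute algebra_simps)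
  also have "\<dots> \<le> norm (z - z') * norm (2 *\<^sub>R w - z - z')" by (rule norm_cauchy_schwarz)
  also have "\<dots> \<le> norm (z - z') * (4 * R)"
  proof (rule mult_left_mono)
    have "norm (2 *\<^sub>R w - z - z') \<le> norm (2 *\<^sub>R w) + norm z + norm z'"
      using norm_triangle_ineq4[of "2 *\<^sub>R w - z" z'] norm_triangle_ineq4[of "2 *\<^sub>R w" z] by linarith
    moreover have "norm w \<le> R" using w R by auto
    ultimately show "norm (2 *\<^sub>R w - z - z') \<le> 4 * R" using R by simp
  qed simp
  finally have "((norm (w - z'))\<^sup>2 - (norm (w - z))\<^sup>2) / (2 * e) \<le> norm (z - z') * (4 * R) / (2 * e)"
    using e by (intro divide_right_mono) auto
  moreover have "f w - (norm (w - z'))\<^sup>2 / (2 * e) \<le> supconv K e f z'"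
    by (rule supconv_attained(2)[OF K w(1)])
  ultimately show ?thesis using w(2) by (simp add: diff_divide_distrib mult_ac)
qed

lemma supconv_continuous:
  fixes f :: "'a::real_inner \<Rightarrow> real"
  assumes K: "compact K" "K \<noteq> {}" "continuous_on K f" and e: "e > 0"
  shows "continuous_on UNIV (supconv K e f)"
proof -
  obtain R0 where "\<forall>x\<in>K. norm x \<le> R0"
    using compact_imp_bounded[OF K(1)] unfolding bounded_iff by blast
  then have R0: "K \<subseteq> cball 0 R0" by auto
  have "isCont (supconv K e f) z" for z
  proof -
    define R where "R = max R0 (norm z + 1)"
    have R: "K \<subseteq> cball 0 R" "norm z < R" "R > 0"
      using R0 subset_cball[of R0 R] norm_ge_zero[of z] by (auto simp: R_def less_max_iff_disj simp del: norm_ge_zero)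
    have "(2 * R / e)-lipschitz_on (ball 0 R) (supconv K e f)"
    proof (rule lipschitz_onI)
      fix x y :: 'a assume "x \<in> ball 0 R" "y \<in> ball 0 R"
      then show "dist (supconv K e f x) (supconv K e f y) \<le> 2 * R / e * dist x y"
        using supconv_lipschitz[OF K e R(1), of x y] supconv_lipschitz[OF K e R(1), of y x]
        by (simp add: dist_norm norm_minus_commute abs_le_iff)
    qed (use R e in auto)
    from lipschitz_on_continuous_on[OF this] show ?thesis
      using continuous_on_eq_continuous_at[OF open_ball, of 0 R "supconv K e f"] R(2) by auto
  qed
  then show ?thesis by (simp add: continuous_on_eq_continuous_at)
qed

text \<open>Removing a ball about the unique maximiser leaves a compact set over which the supremum
  at \<open>z0\<close> is strictly smaller. Both sup-convolutions are continuous, so the strict gap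
  persists near \<open>z0\<close> and no maximiser lies in the remaining set.\<close>

lemma supconv_star_near:
  fixes f :: "'a::real_inner \<Rightarrow> real"
  assumes K: "compact K" "continuous_on K f" and e: "e > 0"
    and star: "supconv_star K e f z0 w0" and uniq: "\<And>w. supconv_star K e f z0 w \<Longrightarrow> w = w0"
    and rho: "\<rho> > 0"
  shows "\<exists>\<delta>>0. \<forall>z w. norm (z - z0) < \<delta> \<longrightarrow> supconv_star K e f z w \<longrightarrow> norm (w - w0) < \<rho>"
proof -
  have ne: "K \<noteq> {}" using star by (auto simp: supconv_star_def)
  define K' where "K' = K - ball w0 \<rho>"
  have K': "compact K'" "continuous_on K' f"
    using K by (auto simp: K'_def intro: compact_diff continuous_on_subset)
  show ?thesis
  proof (cases "K' = {}")
    case True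
    then show ?thesis
      by (intro exI[of _ 1]) (auto simp: K'_def supconv_star_def dist_norm norm_minus_commute subset_iff)
  next
    case False
    obtain v where v: "v \<in> K'" "supconv K' e f z0 = f v - (norm (v - z0))\<^sup>2 / (2 * e)"
      using supconv_attained(1)[OF K'(1) False K'(2)] unfolding supconv_star_def by blast
    have "v \<in> K" "v \<noteq> w0" using v rho by (auto simp: K'_def)
    then have lt: "supconv K' e f z0 < supconv K e f z0"
      using v supconv_attained(2)[OF K(1) ne K(2), of v z0 e] uniq[of v]
      by (auto simp: supconv_star_def order_less_le)
    have "isCont (\<lambda>z. supconv K e f z - supconv K' e f z) z0"
      using supconv_continuous[OF K(1) ne K(2) e] supconv_continuous[OF K'(1) False K'(2) e]
      by (intro isCont_diff) (auto simp: continuous_on_eq_continuous_at)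
    then obtain \<delta> where d: "\<delta> > 0" "\<And>z. dist z z0 < \<delta> \<Longrightarrow>
        dist (supconv K e f z - supconv K' e f z) (supconv K e f z0 - supconv K' e f z0)
          < supconv K e f z0 - supconv K' e f z0"
      unfolding continuous_at_eps_delta using lt by (metis diff_gt_0_iff_gt)
    have "norm (w - w0) < \<rho>" if z: "norm (z - z0) < \<delta>" and w: "supconv_star K e f z w" for z w
    proof (rule ccontr)
      assume "\<not> norm (w - w0) < \<rho>"
      then have "w \<in> K'" using w by (auto simp: K'_def supconv_star_def dist_norm norm_minus_commute)
      then have "supconv K e f z \<le> supconv K' e f z"
        using supconv_attained(2)[OF K'(1) False K'(2), of w z e] w by (auto simp: supconv_star_def)
      then show False using d(2)[of z] z by (auto simp: dist_norm)
    qed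
    with d(1) show ?thesis by blast
  qed
qed

section \<open>Jets of a function and of its sup-convolution\<close>

lemma P2plusI:
  fixes u :: "real \<times> (real^'n) \<Rightarrow> real"
  assumes X: "transpose X = X" and d: "d > 0" and K: "K \<ge> 0"
    and le: "\<And>t x. \<bar>t - t0\<bar> < d \<Longrightarrow> norm (x - x0) < d \<Longrightarrow>
      u (t, x) \<le> u (t0, x0) + a * (t - t0) + p \<bullet> (x - x0) + 1/2 * ((X *v (x - x0)) \<bullet> (x - x0))
        + K * ((t - t0)\<^sup>2 + norm (x - x0) ^ 3)"
  shows "(a, p, X) \<in> P2plus T u (t0, x0)"
proof -
  define F where "F = at (t0, x0) within ({0<..<T} \<times> (UNIV :: (real^'n) set))"
  define r where "r = (\<lambda>(t, x). K * ((t - t0)\<^sup>2 + norm (x - x0) ^ 3))"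
  have near: "\<forall>\<^sub>F z in F. \<bar>fst z - t0\<bar> < b \<and> norm (snd z - x0) < b" if "b > 0" for b
  proof -
    have "\<bar>fst z - t0\<bar> \<le> dist z (t0, x0)" "norm (snd z - x0) \<le> dist z (t0, x0)" for z
      using dist_fst_le[of z "(t0, x0)"] dist_snd_le[of z "(t0, x0)"] by (auto simp: dist_norm)
    then show ?thesis
      unfolding F_def eventually_at using that by (intro exI[of _ b]) (meson order_le_less_trans)
  qed
  have "r \<in> o[F](\<lambda>(t, x). \<bar>t - t0\<bar> + (norm (x - x0))\<^sup>2)"
  proof (rule landau_o.smallI)
    fix c :: real assume c: "c > 0"
    \<comment> \<open>Both parts of the remainder have one factor to spare: the square of the time
      increment against its modulus, the cube of the space increment against its square. The summand
      1 covers K = 0.\<close>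
    have "c / (K + 1) > 0" using c K by simp
    from near[OF this]
    show "\<forall>\<^sub>F z in F. norm (r z) \<le> c * norm (case z of (t, x) \<Rightarrow> \<bar>t - t0\<bar> + (norm (x - x0))\<^sup>2)"
    proof eventually_elim
      case (elim z)
      define s y where "s = \<bar>fst z - t0\<bar>" and "y = norm (snd z - x0)"
      have s: "s \<ge> 0" "(K + 1) * s \<le> c" and y: "y \<ge> 0" "(K + 1) * y \<le> c"
        using elim K by (auto simp: s_def y_def field_simps)
      have "K * s \<le> c" "K * y \<le> c" using s y by (auto simp: algebra_simps)
      then have "(K * s) * s \<le> c * s" "(K * y) * y\<^sup>2 \<le> c * y\<^sup>2"
        using s y by (auto intro: mult_right_mono)
      then have "K * (s\<^sup>2 + y ^ 3) \<le> c * (s + y\<^sup>2)"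
        by (simp add: algebra_simps power2_eq_square power3_eq_cube)
      moreover have "norm (r z) = K * (s\<^sup>2 + y ^ 3)"
        using K by (simp add: r_def s_def y_def split_beta abs_mult)
      moreover have "norm (case z of (t, x) \<Rightarrow> \<bar>t - t0\<bar> + (norm (x - x0))\<^sup>2) = s + y\<^sup>2"
        by (simp add: s_def y_def split_beta)
      ultimately show ?case by simp
    qed
  qed
  moreover have "\<forall>\<^sub>F z in F. (case z of (t, x) \<Rightarrow> u (t, x) \<le> u (t0, x0) + a * (t - t0) + p \<bullet> (x - x0)
           + 1/2 * ((X *v (x - x0)) \<bullet> (x - x0)) + r (t, x))"
    using near[OF d]
  proof eventually_elim
    case (elim z)
    then show ?case using le[of "fst z" "snd z"] by (simp add: split_beta r_def)
  qed
  ultimately show ?thesis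
    using X unfolding P2plus_def F_def Let_def by blast
qed

text \<open>A jet with explicit remainder, quadratic in time and cubic in space. The cubic part is
  the one in \<open>has_jet\<close>, and the form is unchanged when the increments are moved from
  one base point to another.\<close>

definition touched_above ::
  "(real \<times> (real^'n) \<Rightarrow> real) \<Rightarrow> real \<times> (real^'n) \<Rightarrow> real \<Rightarrow> real^'n \<Rightarrow> real^'n^'n \<Rightarrow> bool" where
  "touched_above F z a p X \<longleftrightarrow> transpose X = X \<and> (\<exists>d>0. \<exists>K\<ge>0. \<forall>\<tau> h. \<bar>\<tau>\<bar> < d \<longrightarrow> norm h < d \<longrightarrow>
     F (fst z + \<tau>, snd z + h) \<le> F z + a * \<tau> + p \<bullet> h + 1/2 * ((X *v h) \<bullet> h) + K * (\<tau>\<^sup>2 + norm h ^ 3))"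

text \<open>Testing with \<open>v = s *\<^sub>R A\<close> gives 1 <= C s for small s > 0 unless
  \<open>A\<close> vanishes.\<close>

lemma inner_le_quadratic_imp_zero:
  fixes A :: "'a::real_inner"
  assumes d: "d > 0" and C: "C \<ge> 0" and le: "\<And>v. norm v < d \<Longrightarrow> A \<bullet> v \<le> C * (norm v)\<^sup>2"
  shows "A = 0"
proof (rule ccontr)
  assume A: "A \<noteq> 0"
  define s where "s = min (d / (2 * norm A)) (1 / (2 * (C + 1)))"
  have s: "s > 0" "s \<le> d / (2 * norm A)" "s \<le> 1 / (2 * (C + 1))"
    using A d C by (auto simp: s_def)
  have "s * norm A \<le> d / 2" using s(2) A by (simp add: field_simps)
  then have "norm (s *\<^sub>R A) < d" using s(1) d by simp
  from le[OF this] have "s * (norm A)\<^sup>2 \<le> C * (s\<^sup>2 * (norm A)\<^sup>2)"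
    by (simp add: power2_norm_eq_inner power_mult_distrib)
  then have "s * (norm A)\<^sup>2 * 1 \<le> s * (norm A)\<^sup>2 * (C * s)"
    by (simp add: power2_eq_square mult_ac)
  then have "1 \<le> C * s" using s(1) A by (subst (asm) mult_le_cancel_left_pos) auto
  moreover have "s * (2 * (C + 1)) \<le> 1" using s(3) C by (simp add: field_simps)
  then have "2 * (C * s) + 2 * s \<le> 1" by (simp add: algebra_simps)
  ultimately show False using s(1) by linarith
qed

text \<open>Translation by w - z carries a jet of the sup-convolution at \<open>z\<close> to a jet
  of \<open>f\<close> at the maximiser \<open>w\<close>. The displacement also reveals the
  first-order part, which later confines the relevant jets to a small set.\<close>

lemma supconv_jet:
  fixes f :: "real \<times> (real^'n) \<Rightarrow> real"
  assumes K: "compact K" "continuous_on K f" and e: "e > 0"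
    and star: "supconv_star K e f z w" and int: "w \<in> interior K"
    and touch: "touched_above (supconv K e f) z a p X"
  shows "(a, p, X) \<in> P2plus T f w" and "w - z = e *\<^sub>R (a, p)"
proof -
  have ne: "K \<noteq> {}" using star by (auto simp: supconv_star_def)
  note ge = supconv_attained(2)[OF K(1) ne K(2)]
  obtain d L where d: "d > 0" and L: "L \<ge> 0" and X: "transpose X = X" and
    le: "\<And>\<tau> h. \<bar>\<tau>\<bar> < d \<Longrightarrow> norm h < d \<Longrightarrow> supconv K e f (fst z + \<tau>, snd z + h)
      \<le> supconv K e f z + a * \<tau> + p \<bullet> h + 1/2 * ((X *v h) \<bullet> h) + L * (\<tau>\<^sup>2 + norm h ^ 3)"
    using touch unfolding touched_above_def by blast
  obtain r where r: "r > 0" "ball w r \<subseteq> K" using int unfolding mem_interior by blast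
  have sw: "supconv K e f z = f w - (norm (w - z))\<^sup>2 / (2 * e)" and "w \<in> K"
    using star by (auto simp: supconv_star_def)
  have "(a, p, X) \<in> P2plus T f (fst w, snd w)"
  proof (rule P2plusI[OF X _ L])
    show "min d (r / 2) > 0" using d r by simp
    fix t x assume t: "\<bar>t - fst w\<bar> < min d (r / 2)" and x: "norm (x - snd w) < min d (r / 2)"
    have "norm ((t, x) - w) \<le> \<bar>t - fst w\<bar> + norm (x - snd w)"
      using norm_Pair_le[of "t - fst w" "x - snd w"] by (cases w) simp
    then have "(t, x) \<in> K" using t x r(2) by (auto simp: dist_norm norm_minus_commute subset_iff)
    \<comment> \<open>The point (t, x) competes at \<open>z\<close> shifted by the same increment,
      so the quadratic penalty is the same as for \<open>w\<close> at \<open>z\<close>.\<close>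
    from ge[OF this, of "(fst z + (t - fst w), snd z + (x - snd w))" e]
    have "f (t, x) - (norm (w - z))\<^sup>2 / (2 * e) \<le> supconv K e f (fst z + (t - fst w), snd z + (x - snd w))"
      by (cases w; cases z) (simp add: algebra_simps)
    also have "\<dots> \<le> supconv K e f z + a * (t - fst w) + p \<bullet> (x - snd w)
        + 1/2 * ((X *v (x - snd w)) \<bullet> (x - snd w)) + L * ((t - fst w)\<^sup>2 + norm (x - snd w) ^ 3)"
      using t x by (intro le) auto
    finally show "f (t, x) \<le> f (fst w, snd w) + a * (t - fst w) + p \<bullet> (x - snd w)
        + 1/2 * ((X *v (x - snd w)) \<bullet> (x - snd w)) + L * ((t - fst w)\<^sup>2 + norm (x - snd w) ^ 3)"
      using sw by simp
  qed
  then show "(a, p, X) \<in> P2plus T f w" by simp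
  obtain C where C: "C \<ge> 0" "\<And>h. \<bar>(X *v h) \<bullet> h\<bar> \<le> C * (norm h)\<^sup>2"
    using inner_matrix_bound[of X] by blast
  \<comment> \<open>With \<open>w\<close> kept as competitor, a paraboloid with gradient (w - z)/e
    touches the sup-convolution from below at \<open>z\<close>; it must have the same first-order
    part as the contact from above.\<close>
  have "(1/e) *\<^sub>R (w - z) - (a, p) = 0"
  proof (rule inner_le_quadratic_imp_zero)
    show "min d 1 > 0" using d by simp
    show "1 / (2 * e) + C + 2 * L \<ge> 0" using e C L by simp
    fix v :: "real \<times> (real^'n)" assume v: "norm v < min d 1"
    obtain \<tau> h where vv: "v = (\<tau>, h)" by (cases v)
    have n: "(norm v)\<^sup>2 = \<tau>\<^sup>2 + (norm h)\<^sup>2" by (simp add: vv norm_Pair)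
    have vt: "\<bar>\<tau>\<bar> \<le> norm v" and vh: "norm h \<le> norm v"
      using norm_fst_le[of \<tau> h] norm_snd_le[of h \<tau>] by (auto simp: vv)
    have "z + v = (fst z + \<tau>, snd z + h)" by (cases z) (simp add: vv)
    then have "supconv K e f (z + v)
      \<le> supconv K e f z + a * \<tau> + p \<bullet> h + 1/2 * ((X *v h) \<bullet> h) + L * (\<tau>\<^sup>2 + norm h ^ 3)"
      using le[of \<tau> h] v vt vh by simp
    moreover have "f w - (norm (w - (z + v)))\<^sup>2 / (2 * e) \<le> supconv K e f (z + v)"
      by (rule ge[OF \<open>w \<in> K\<close>])
    moreover have "(a, p) \<bullet> v = a * \<tau> + p \<bullet> h" by (simp add: vv)
    ultimately have "(norm (w - z))\<^sup>2 / (2 * e) - (norm (w - (z + v)))\<^sup>2 / (2 * e) - (a, p) \<bullet> v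
        \<le> 1/2 * ((X *v h) \<bullet> h) + L * (\<tau>\<^sup>2 + norm h ^ 3)"
      unfolding sw by linarith
    moreover have "(norm (w - z))\<^sup>2 / (2 * e) - (norm (w - (z + v)))\<^sup>2 / (2 * e)
        = (1/e) * ((w - z) \<bullet> v) - (norm v)\<^sup>2 / (2 * e)"
      using e by (simp add: power2_norm_eq_inner inner_diff_left inner_diff_right inner_add_left
          inner_add_right inner_commute field_simps)
    moreover have "1/2 * ((X *v h) \<bullet> h) \<le> C * (norm v)\<^sup>2"
    proof -
      have "(X *v h) \<bullet> h \<le> C * (norm h)\<^sup>2" "0 \<le> C * (norm h)\<^sup>2" using C(2)[of h] C(1) by auto
      moreover have "C * (norm h)\<^sup>2 \<le> C * (norm v)\<^sup>2" using C(1) vh by (intro mult_left_mono power_mono) auto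
      ultimately show ?thesis by linarith
    qed
    moreover have "L * (\<tau>\<^sup>2 + norm h ^ 3) \<le> L * (2 * (norm v)\<^sup>2)"
    proof (rule mult_left_mono[OF _ L])
      have "norm h ^ 3 \<le> (norm h)\<^sup>2" using v vh by (intro power_decreasing) auto
      then show "\<tau>\<^sup>2 + norm h ^ 3 \<le> 2 * (norm v)\<^sup>2"
        using n zero_le_power2[of \<tau>] zero_le_power2[of "norm h"] by linarith
    qed
    ultimately show "((1/e) *\<^sub>R (w - z) - (a, p)) \<bullet> v \<le> (1 / (2 * e) + C + 2 * L) * (norm v)\<^sup>2"
      by (simp add: inner_diff_left algebra_simps)
  qed
  then have "e *\<^sub>R ((1/e) *\<^sub>R (w - z)) = e *\<^sub>R (a, p)" by (simp only: right_minus_eq)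
  then show "w - z = e *\<^sub>R (a, p)" using e by simp
qed

text \<open>The equation with frozen coefficients: near one base point and one first-order part, it
  leaves a constant lower bound for the Laplacian.\<close>

definition local_trace_ge ::
  "real \<Rightarrow> (real \<times> (real^'n) \<Rightarrow> real) \<Rightarrow> real \<times> (real^'n) \<Rightarrow> real \<times> (real^'n) \<Rightarrow> real \<Rightarrow> bool" where
  "local_trace_ge T f w0 ap0 q \<longleftrightarrow> (\<exists>r>0. \<forall>w a p X. norm (w - w0) < r \<longrightarrow>
     (a, p, X) \<in> P2plus T f w \<longrightarrow> norm ((a, p) - ap0) < r \<longrightarrow> trace X \<ge> q)"

text \<open>If comparison with \<open>h\<close> failed at time \<open>t0\<close>, adding a steep
  penalty in time and maximising over a small cylinder would give an interior contact point. Its jet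
  passes to \<open>f\<close> near \<open>w0\<close>, with first-order part near (w0 - z0)/e, where
  the trace is at least \<open>q\<close>. The dilation by \<open>c\<close> turns this into
  \<open>c\<^sup>2 * q\<close>.\<close>

lemma supconv_laplace_sub:
  fixes f :: "real \<times> (real^'n) \<Rightarrow> real"
  assumes K: "compact K" "continuous_on K f" and e: "e > 0"
    and star: "supconv_star K e f z0 w0" and uniq: "\<And>w. supconv_star K e f z0 w \<Longrightarrow> w = w0"
    and int: "w0 \<in> interior K"
    and trace: "local_trace_ge T f w0 ((1/e) *\<^sub>R (w0 - z0)) q"
    and c: "c > 0"
  shows "\<exists>r0>0. laplace_sub (\<lambda>z. supconv K e f (fst z0, snd z0 + c *\<^sub>R z)) (c\<^sup>2 * q) r0"
proof -
  obtain r where r: "r > 0" and loc: "\<And>w a p X. norm (w - w0) < r \<Longrightarrow> (a, p, X) \<in> P2plus T f w \<Longrightarrow>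
      norm ((a, p) - (1/e) *\<^sub>R (w0 - z0)) < r \<Longrightarrow> trace X \<ge> q"
    using trace unfolding local_trace_ge_def by blast
  define F where "F = supconv K e f"
  have ne: "K \<noteq> {}" using star by (auto simp: supconv_star_def)
  define t0 x0 where "t0 = fst z0" and "x0 = snd z0"
  have z0: "z0 = (t0, x0)" by (simp add: t0_def x0_def)
  obtain \<rho>1 where rho1: "\<rho>1 > 0" "ball w0 \<rho>1 \<subseteq> K" using int unfolding mem_interior by blast
  \<comment> \<open>The error of (a, p), multiplied by e, equals (w - w0) - (z - z0); the bound e r
    is shared equally between \<rho>2 and \<delta>.\<close>
  define \<rho>2 where "\<rho>2 = min \<rho>1 (min r (e * r / 2))"
  have "\<rho>2 > 0" using rho1 r e by (simp add: \<rho>2_def)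
  from supconv_star_near[OF K e star uniq this] obtain \<delta>1 where d1: "\<delta>1 > 0"
    "\<And>z w. norm (z - z0) < \<delta>1 \<Longrightarrow> supconv_star K e f z w \<Longrightarrow> norm (w - w0) < \<rho>2" by blast
  define \<delta> where "\<delta> = min \<delta>1 (e * r / 2)"
  have d: "\<delta> > 0" "\<delta> \<le> \<delta>1" "\<delta> \<le> e * r / 2" using d1 e r by (auto simp: \<delta>_def)
  have trace_ge: "trace X \<ge> q"
    if z: "norm (z - z0) < \<delta>" and t: "touched_above F z a p X" for z a p X
  proof -
    obtain w where w: "supconv_star K e f z w" using supconv_attained(1)[OF K(1) ne K(2)] by blast
    have n: "norm (w - w0) < \<rho>2" by (rule d1(2)[OF _ w]) (use z d in simp)
    then have "w \<in> ball w0 \<rho>1" by (auto simp: \<rho>2_def dist_norm norm_minus_commute)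
    then have "w \<in> interior K" using rho1(2) by (meson interiorI open_ball)
    from supconv_jet[OF K e w this t[unfolded F_def]]
    have P: "(a, p, X) \<in> P2plus T f w" and eq: "w - z = e *\<^sub>R (a, p)" by blast+
    have "e *\<^sub>R ((a, p) - (1/e) *\<^sub>R (w0 - z0)) = (w - w0) - (z - z0)"
      unfolding scaleR_diff_right eq[symmetric] using e by simp
    then have "e * norm ((a, p) - (1/e) *\<^sub>R (w0 - z0)) = norm ((w - w0) - (z - z0))"
      using e by (metis abs_of_pos norm_scaleR)
    also have "\<dots> \<le> norm (w - w0) + norm (z - z0)" by (rule norm_triangle_ineq4)
    also have "\<dots> < e * r" using n z d(3) by (simp add: \<rho>2_def)
    finally have "norm ((a, p) - (1/e) *\<^sub>R (w0 - z0)) < r" using e by simp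
    then show ?thesis using loc[OF _ P] n by (simp add: \<rho>2_def)
  qed
  define \<tau> where "\<tau> = \<delta> / 2"
  have tau: "\<tau> > 0" using d by (simp add: \<tau>_def)
  define r0 where "r0 = \<delta> / (2 * c)"
  have r0: "r0 > 0" using d c by (simp add: r0_def)
  obtain R0 where "\<forall>x\<in>K. norm x \<le> R0"
    using compact_imp_bounded[OF K(1)] unfolding bounded_iff by blast
  then have R0: "K \<subseteq> cball 0 R0" by auto
  define R where "R = max R0 (norm z0 + \<delta>)"
  have R: "K \<subseteq> cball 0 R" "norm z0 + \<delta> \<le> R" using R0 by (auto simp: R_def)
  have "R > 0" using R d norm_ge_zero[of z0] by linarith
  define \<Lambda> where "\<Lambda> = 2 * R / e"
  have Lam: "\<Lambda> > 0" using \<open>R > 0\<close> e by (simp add: \<Lambda>_def)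
  have "laplace_sub (\<lambda>z. F (t0, x0 + c *\<^sub>R z)) (c\<^sup>2 * q) r0"
    unfolding laplace_sub_def
  proof (intro allI impI ballI)
    fix \<rho> and h :: "real^'n \<Rightarrow> real" and m and z :: "real^'n"
    assume rho: "0 < \<rho>" "\<rho> < r0" and h: "poly_deg_le m h" and lap: "\<forall>z\<in>ball 0 \<rho>. lap h z < c\<^sup>2 * q"
      and bd: "\<forall>z\<in>sphere 0 \<rho>. F (t0, x0 + c *\<^sub>R z) < h z" and z: "z \<in> cball 0 \<rho>"
    show "F (t0, x0 + c *\<^sub>R z) \<le> h z"
    proof (rule ccontr)
      assume neg: "\<not> F (t0, x0 + c *\<^sub>R z) \<le> h z"
      have near: "norm ((t, x0 + c *\<^sub>R y) - z0) < \<delta>" if "\<bar>t - t0\<bar> \<le> \<tau>" "norm y \<le> \<rho>" for t y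
      proof -
        have "norm ((t, x0 + c *\<^sub>R y) - z0) \<le> \<bar>t - t0\<bar> + norm (c *\<^sub>R y)"
          using norm_Pair_le[of "t - t0" "c *\<^sub>R y"] by (simp add: z0)
        moreover have "norm (c *\<^sub>R y) < c * r0" using that rho c by simp
        moreover have "c * r0 = \<delta> / 2" using c by (simp add: r0_def)
        ultimately show ?thesis using that by (simp add: \<tau>_def)
      qed
      have contF: "continuous_on A F" for A
        using supconv_continuous[OF K(1) ne K(2) e] unfolding F_def by (rule continuous_on_subset) simp
      have conth: "continuous_on A h" for A by (rule poly_deg_le_continuous[OF h])
      have lip: "F (t, x0 + c *\<^sub>R y) \<le> F (t0, x0 + c *\<^sub>R y) + \<Lambda> * \<bar>t - t0\<bar>"
        if "\<bar>t - t0\<bar> \<le> \<tau>" "norm y \<le> \<rho>" for t y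
      proof -
        have b: "norm (s, x0 + c *\<^sub>R y) \<le> R" if "\<bar>s - t0\<bar> \<le> \<tau>" for s
        proof -
          have "norm (s, x0 + c *\<^sub>R y) \<le> norm z0 + norm ((s, x0 + c *\<^sub>R y) - z0)"
            by (rule norm_triangle_sub)
          then show ?thesis using near[OF that \<open>norm y \<le> \<rho>\<close>] R by simp
        qed
        show ?thesis
          using supconv_lipschitz[OF K(1) ne K(2) e R(1) b b, of t t0] that tau
          by (simp add: F_def \<Lambda>_def)
      qed
      have "continuous_on (sphere 0 \<rho>) (\<lambda>y. F (t0, x0 + c *\<^sub>R y) - h y)"
        by (intro continuous_intros conth continuous_on_compose2[OF contF[of UNIV]]) auto
      moreover have "sphere (0::real^'n) \<rho> \<noteq> {}" using rho by simp
      ultimately obtain y0 where y0: "y0 \<in> sphere 0 \<rho>"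
        "\<And>y. y \<in> sphere 0 \<rho> \<Longrightarrow> F (t0, x0 + c *\<^sub>R y) - h y \<le> F (t0, x0 + c *\<^sub>R y0) - h y0"
        using continuous_attains_sup[OF compact_sphere] by blast
      define \<gamma> where "\<gamma> = h y0 - F (t0, x0 + c *\<^sub>R y0)"
      have gam: "\<gamma> > 0" "\<And>y. y \<in> sphere 0 \<rho> \<Longrightarrow> F (t0, x0 + c *\<^sub>R y) - h y \<le> - \<gamma>"
        using bd y0 by (auto simp: \<gamma>_def)
      \<comment> \<open>The first bound makes the penalty at distance \<tau> larger than the
        Lipschitz gain \<Lambda> \<tau>, which excludes the time boundary. The second makes the
        largest net gain, \<open>\<Lambda>\<^sup>2 * \<kappa> / 4\<close>, at most half of the gap
        \<gamma> on the lateral boundary.\<close>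
      define \<kappa> where "\<kappa> = min (\<tau> / (2 * \<Lambda>)) (2 * \<gamma> / \<Lambda>\<^sup>2)"
      have kap: "\<kappa> > 0" "\<kappa> \<le> \<tau> / (2 * \<Lambda>)" "\<kappa> \<le> 2 * \<gamma> / \<Lambda>\<^sup>2" using tau Lam gam(1) by (auto simp: \<kappa>_def)
      define g where "g = (\<lambda>(t, y). F (t, x0 + c *\<^sub>R y) - h y - (t - t0)\<^sup>2 / \<kappa>)"
      define D where "D = {t0 - \<tau>..t0 + \<tau>} \<times> cball (0::real^'n) \<rho>"
      have "continuous_on D g"
        unfolding g_def split_beta divide_inverse
        by (intro continuous_intros continuous_on_compose2[OF contF[of UNIV]]
            continuous_on_compose2[OF conth[of UNIV]]) auto
      moreover have "compact D" unfolding D_def by (intro compact_Times compact_Icc compact_cball)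
      moreover have inD: "(t0, z) \<in> D" using z tau by (simp add: D_def)
      ultimately obtain t1 y1 where ty: "(t1, y1) \<in> D" and mx: "\<And>t y. (t, y) \<in> D \<Longrightarrow> g (t, y) \<le> g (t1, y1)"
        using continuous_attains_sup[of D g] by fastforce
      have t1: "\<bar>t1 - t0\<bar> \<le> \<tau>" and y1: "norm y1 \<le> \<rho>" using ty by (auto simp: D_def)
      have pos: "g (t1, y1) > 0" using mx[OF inD] neg by (simp add: g_def)
      have y1': "norm y1 < \<rho>"
      proof (rule ccontr)
        assume "\<not> norm y1 < \<rho>"
        then have "y1 \<in> sphere 0 \<rho>" using y1 by simp
        from gam(2)[OF this] have "g (t1, y1) \<le> - \<gamma> + \<Lambda> * \<bar>t1 - t0\<bar> - (t1 - t0)\<^sup>2 / \<kappa>"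
          using lip[OF t1 y1] by (simp add: g_def)
        moreover have "\<Lambda> * \<bar>t1 - t0\<bar> - (t1 - t0)\<^sup>2 / \<kappa> \<le> \<Lambda>\<^sup>2 * \<kappa> / 4"
        proof -
          have "0 \<le> (\<bar>t1 - t0\<bar> - \<Lambda> * \<kappa> / 2)\<^sup>2 / \<kappa>" using kap(1) by simp
          also have "\<dots> = (t1 - t0)\<^sup>2 / \<kappa> - \<Lambda> * \<bar>t1 - t0\<bar> + \<Lambda>\<^sup>2 * \<kappa> / 4"
            using kap(1) by (simp add: power2_diff field_simps power2_eq_square)
          finally show ?thesis by simp
        qed
        moreover have "\<Lambda>\<^sup>2 * \<kappa> \<le> 2 * \<gamma>" using kap(3) Lam by (simp add: field_simps)
        ultimately show False using pos gam(1) by simp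
      qed
      have t1': "\<bar>t1 - t0\<bar> < \<tau>"
      proof (rule ccontr)
        assume "\<not> \<bar>t1 - t0\<bar> < \<tau>"
        then have eq: "\<bar>t1 - t0\<bar> = \<tau>" using t1 by simp
        then have "(t1 - t0)\<^sup>2 = \<tau>\<^sup>2" by (metis power2_abs)
        moreover have "(t0, y1) \<in> D" using y1 tau by (simp add: D_def)
        ultimately have "\<tau>\<^sup>2 / \<kappa> \<le> \<Lambda> * \<tau>"
          using mx[of t0 y1] lip[OF t1 y1] eq by (simp add: g_def)
        then have "\<tau> * \<tau> \<le> \<tau> * (\<Lambda> * \<kappa>)" using kap(1) by (simp add: field_simps power2_eq_square)
        then have "\<tau> \<le> \<Lambda> * \<kappa>" using tau by simp
        moreover have "2 * (\<Lambda> * \<kappa>) \<le> \<tau>" using kap(2) Lam by (simp add: field_simps)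
        ultimately show False using tau by simp
      qed
      obtain X where X: "has_jet h y1 (grad h y1) X" "lap h y1 = trace X"
        using poly_jet[OF h] by blast
      obtain K0 where K0: "K0 \<ge> 0" "\<And>v. norm v \<le> 1 \<Longrightarrow>
          \<bar>h (y1 + v) - h y1 - grad h y1 \<bullet> v - 1/2 * ((X *v v) \<bullet> v)\<bar> \<le> K0 * norm v ^ 3"
        and tX: "transpose X = X" using X(1) unfolding has_jet_def by metis
      have "touched_above F (t1, x0 + c *\<^sub>R y1) (2 * (t1 - t0) / \<kappa>) ((1/c) *\<^sub>R grad h y1) ((1/c\<^sup>2) *\<^sub>R X)"
        unfolding touched_above_def
      proof (intro conjI exI allI impI)
        show "transpose ((1/c\<^sup>2) *\<^sub>R X) = (1/c\<^sup>2) *\<^sub>R X"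
          using tX by (simp add: transpose_def vec_eq_iff)
        let ?d = "min c (min (\<tau> - \<bar>t1 - t0\<bar>) (c * (\<rho> - norm y1)))"
        let ?K = "1 / \<kappa> + K0 / c ^ 3"
        show "?d > 0" using c t1' y1' by simp
        show "?K \<ge> 0" using kap K0 c by simp
        fix s and v :: "real^'n" assume s: "\<bar>s\<bar> < ?d" and v: "norm v < ?d"
        define v' where "v' = (1/c) *\<^sub>R v"
        have v': "v = c *\<^sub>R v'" using c by (simp add: v'_def)
        have nv: "c * norm v' = norm v" using c by (simp add: v'_def)
        then have "c * norm v' < c * 1" "c * norm v' < c * (\<rho> - norm y1)" using v by auto
        then have nv1: "norm v' \<le> 1" and nv2: "norm v' < \<rho> - norm y1" using c by auto
        have "norm (y1 + v') \<le> \<rho>" using nv2 norm_triangle_ineq[of y1 v'] by simp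
        moreover have "\<bar>t1 + s - t0\<bar> \<le> \<tau>" using s by linarith
        ultimately have "(t1 + s, y1 + v') \<in> D" by (auto simp: D_def abs_le_iff)
        from mx[OF this] have "F (t1 + s, x0 + c *\<^sub>R (y1 + v')) \<le> F (t1, x0 + c *\<^sub>R y1)
            + (h (y1 + v') - h y1) + ((t1 + s - t0)\<^sup>2 / \<kappa> - (t1 - t0)\<^sup>2 / \<kappa>)"
          by (simp add: g_def)
        also have "(t1 + s - t0)\<^sup>2 / \<kappa> - (t1 - t0)\<^sup>2 / \<kappa> = 2 * (t1 - t0) / \<kappa> * s + s\<^sup>2 / \<kappa>"
          using kap(1) by (simp add: field_simps power2_eq_square)
        also have "h (y1 + v') - h y1 \<le> grad h y1 \<bullet> v' + 1/2 * ((X *v v') \<bullet> v') + K0 * norm v' ^ 3"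
          using K0(2)[OF nv1] by linarith
        also have "grad h y1 \<bullet> v' = ((1/c) *\<^sub>R grad h y1) \<bullet> v" by (simp add: v'_def)
        also have "(X *v v') \<bullet> v' = (((1/c\<^sup>2) *\<^sub>R X) *v v) \<bullet> v"
          by (simp add: v'_def matrix_vector_scaleR matrix_vector_mult_scaleR power2_eq_square)
        also have "norm v' ^ 3 = norm v ^ 3 / c ^ 3"
          unfolding nv[symmetric] using c by (simp add: power_mult_distrib)
        finally have *: "F (t1 + s, x0 + c *\<^sub>R (y1 + v')) \<le> F (t1, x0 + c *\<^sub>R y1)
            + (((1/c) *\<^sub>R grad h y1) \<bullet> v + 1/2 * ((((1/c\<^sup>2) *\<^sub>R X) *v v) \<bullet> v) + K0 * (norm v ^ 3 / c ^ 3))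
            + (2 * (t1 - t0) / \<kappa> * s + s\<^sup>2 / \<kappa>)" by simp
        have "s\<^sup>2 / \<kappa> + K0 * (norm v ^ 3 / c ^ 3) \<le> ?K * (s\<^sup>2 + norm v ^ 3)"
        proof -
          have "0 \<le> norm v ^ 3 / \<kappa>" "0 \<le> K0 * s\<^sup>2 / c ^ 3" using kap K0 c by simp_all
          then show ?thesis by (simp add: distrib_left distrib_right)
        qed
        with * show "F (fst (t1, x0 + c *\<^sub>R y1) + s, snd (t1, x0 + c *\<^sub>R y1) + v) \<le> F (t1, x0 + c *\<^sub>R y1)
            + 2 * (t1 - t0) / \<kappa> * s + ((1/c) *\<^sub>R grad h y1) \<bullet> v
            + 1/2 * ((((1/c\<^sup>2) *\<^sub>R X) *v v) \<bullet> v) + ?K * (s\<^sup>2 + norm v ^ 3)"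
          by (simp add: scaleR_add_right v'[symmetric] add.assoc)
      qed
      from trace_ge[OF near[OF t1 y1] this] have "q \<le> trace ((1/c\<^sup>2) *\<^sub>R X)" .
      also have "\<dots> = trace X / c\<^sup>2" by (simp add: trace_def sum_divide_distrib)
      finally have "c\<^sup>2 * q \<le> trace X" using c by (simp add: field_simps)
      then show False using lap[rule_format, of y1] X(2) y1' by simp
    qed
  qed
  then show ?thesis using r0 unfolding F_def t0_def x0_def by blast
qed

section \<open>Doubling of variables\<close>

lemma laplace_sub_mono: "laplace_sub U q r \<Longrightarrow> r' \<le> r \<Longrightarrow> laplace_sub U q r'"
  unfolding laplace_sub_def by (meson less_le_trans)

lemma power2_norm_add: "(norm (x + y))\<^sup>2 = (norm x)\<^sup>2 + 2 * (x \<bullet> y) + (norm y)\<^sup>2"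
  for x y :: "'a::real_inner"
  by (simp add: power2_norm_eq_inner inner_add_left inner_add_right inner_commute)

text \<open>The first-order conditions determine the spatial displacements of the maximisers, but
  only the sum of the two time displacements. The second-order condition is
  \<open>laplace_sub_sum\<close> along z -> (x0 + \<gamma> z, y0 + \<gamma>' z), with independent
  dilations left free for the two values of \<Gamma>.\<close>

lemma supconv_doubling:
  fixes f g :: "real \<times> (real^'n) \<Rightarrow> real"
  assumes K: "compact K" "K \<noteq> {}" "continuous_on K f" "continuous_on K g" and e: "e > 0" and d: "d > 0"
    and max: "\<And>t x y. \<bar>t - t0\<bar> < d \<Longrightarrow> norm (x - x0) < d \<Longrightarrow> norm (y - y0) < d \<Longrightarrow>
      supconv K e f (t, x) + supconv K e g (t, y) - \<Phi> t x y
        \<le> supconv K e f (t0, x0) + supconv K e g (t0, y0) - \<Phi> t0 x0 y0"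
    and \<Phi>: "\<And>x y. \<Phi> t0 x y = c1 * (norm (x - y))\<^sup>2 + \<nu> * (norm x)\<^sup>2 + c0"
    and c1: "c1 \<ge> 0" and nu: "\<nu> \<ge> 0"
    and der: "((\<lambda>t. \<Phi> t x0 y0) has_real_derivative D) (at t0)"
    and int: "\<And>w. supconv_star K e f (t0, x0) w \<Longrightarrow> w \<in> interior K"
      "\<And>w. supconv_star K e g (t0, y0) w \<Longrightarrow> w \<in> interior K"
  obtains w w' a a' where "supconv_star K e f (t0, x0) w" "supconv_star K e g (t0, y0) w'"
    "w - (t0, x0) = e *\<^sub>R (a, 2 *\<^sub>R (c1 *\<^sub>R (x0 - y0) + \<nu> *\<^sub>R x0))"
    "w' - (t0, y0) = e *\<^sub>R (a', - (2 * c1) *\<^sub>R (x0 - y0))"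
    "a + a' = D"
    "\<forall>q q' \<gamma> \<gamma>'. \<gamma> > 0 \<longrightarrow> \<gamma>' > 0 \<longrightarrow> local_trace_ge T f w ((1/e) *\<^sub>R (w - (t0, x0))) q \<longrightarrow>
      local_trace_ge T g w' ((1/e) *\<^sub>R (w' - (t0, y0))) q' \<longrightarrow>
      \<gamma>\<^sup>2 * q + \<gamma>'\<^sup>2 * q' \<le> 2 * real CARD('n) * (c1 * (\<gamma> - \<gamma>')\<^sup>2 + \<nu> * \<gamma>\<^sup>2)"
proof -
  note att = supconv_attained[OF K(1,2,3)] supconv_attained[OF K(1,2,4)]
  define F where "F = supconv K e f"
  define H where "H = supconv K e g"
  have first_order: "snd w - x0 = e *\<^sub>R (2 *\<^sub>R (c1 *\<^sub>R (x0 - y0) + \<nu> *\<^sub>R x0))"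
      "snd w' - y0 = e *\<^sub>R (- (2 * c1) *\<^sub>R (x0 - y0))"
      "(fst w - t0) + (fst w' - t0) = e * D"
    if w: "supconv_star K e f (t0, x0) w" and w': "supconv_star K e g (t0, y0) w'" for w w'
  proof -
    define s \<xi> s' \<eta> where "s = fst w" and "\<xi> = snd w" and "s' = fst w'" and "\<eta> = snd w'"
    have ww: "w = (s, \<xi>)" "w' = (s', \<eta>)" by (auto simp: s_def \<xi>_def s'_def \<eta>_def)
    have n: "(norm (w - (t, x)))\<^sup>2 = (s - t)\<^sup>2 + (norm (\<xi> - x))\<^sup>2"
        "(norm (w' - (t, x)))\<^sup>2 = (s' - t)\<^sup>2 + (norm (\<eta> - x))\<^sup>2" for t x
      by (simp_all add: ww norm_Pair)
    \<comment> \<open>Keeping \<open>w\<close> and \<open>w'\<close> as competitors bounds both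
      sup-convolutions from below, with equality at (t0, x0, y0). Hence an explicit smooth function
      is maximal there.\<close>
    have key: "- (((s - t)\<^sup>2 + (norm (\<xi> - x))\<^sup>2) / (2 * e)) - ((s' - t)\<^sup>2 + (norm (\<eta> - y))\<^sup>2) / (2 * e) - \<Phi> t x y
       \<le> - (((s - t0)\<^sup>2 + (norm (\<xi> - x0))\<^sup>2) / (2 * e)) - ((s' - t0)\<^sup>2 + (norm (\<eta> - y0))\<^sup>2) / (2 * e) - \<Phi> t0 x0 y0"
      if "\<bar>t - t0\<bar> < d" "norm (x - x0) < d" "norm (y - y0) < d" for t x y
      using max[OF that] att(2)[of w "(t, x)" e] att(4)[of w' "(t, y)" e] w w'
      unfolding supconv_star_def n by linarith
    have split: "(N - 2 * A + n) / (2 * e) = N / (2 * e) - A / e + n * (1 / (2 * e))" for N A n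
      using e by (simp add: field_simps)
    have lhs: "((1/e) *\<^sub>R X - 2 *\<^sub>R (c1 *\<^sub>R Y + \<nu> *\<^sub>R Z)) \<bullet> v = X \<bullet> v / e - 2 * (c1 * (Y \<bullet> v) + \<nu> * (Z \<bullet> v))"
        "((1/e) *\<^sub>R X - (- (2 * c1) *\<^sub>R Y)) \<bullet> v = X \<bullet> v / e + 2 * (c1 * (Y \<bullet> v))" for X Y Z v :: "real^'n"
      by (simp_all add: inner_diff_left inner_add_left)
    have "(1/e) *\<^sub>R (\<xi> - x0) - 2 *\<^sub>R (c1 *\<^sub>R (x0 - y0) + \<nu> *\<^sub>R x0) = 0"
    proof (rule inner_le_quadratic_imp_zero[OF d])
      show "1 / (2 * e) + c1 + \<nu> \<ge> 0" using e c1 nu by simp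
      fix v :: "real^'n" assume v: "norm v < d"
      have 1: "(norm (\<xi> - (x0 + v)))\<^sup>2 = (norm (\<xi> - x0))\<^sup>2 - 2 * ((\<xi> - x0) \<bullet> v) + (norm v)\<^sup>2"
        using power2_norm_add[of "\<xi> - x0" "- v"] by (simp add: algebra_simps)
      have 2: "(norm (x0 + v - y0))\<^sup>2 = (norm (x0 - y0))\<^sup>2 + 2 * ((x0 - y0) \<bullet> v) + (norm v)\<^sup>2"
        using power2_norm_add[of "x0 - y0" v] by (simp add: algebra_simps)
      have "- ((norm (\<xi> - (x0 + v)))\<^sup>2 / (2 * e)) - c1 * (norm (x0 + v - y0))\<^sup>2 - \<nu> * (norm (x0 + v))\<^sup>2
          \<le> - ((norm (\<xi> - x0))\<^sup>2 / (2 * e)) - c1 * (norm (x0 - y0))\<^sup>2 - \<nu> * (norm x0)\<^sup>2"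
        using key[of t0 "x0 + v" y0] d v unfolding \<Phi> by (simp add: add_divide_distrib)
      then show "((1/e) *\<^sub>R (\<xi> - x0) - 2 *\<^sub>R (c1 *\<^sub>R (x0 - y0) + \<nu> *\<^sub>R x0)) \<bullet> v
          \<le> (1 / (2 * e) + c1 + \<nu>) * (norm v)\<^sup>2"
        unfolding 1 2 power2_norm_add lhs split by (simp add: algebra_simps)
    qed
    then have "e *\<^sub>R ((1/e) *\<^sub>R (\<xi> - x0)) = e *\<^sub>R (2 *\<^sub>R (c1 *\<^sub>R (x0 - y0) + \<nu> *\<^sub>R x0))"
      by (simp only: right_minus_eq)
    then show "snd w - x0 = e *\<^sub>R (2 *\<^sub>R (c1 *\<^sub>R (x0 - y0) + \<nu> *\<^sub>R x0))" using e by (simp add: ww)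
    have "(1/e) *\<^sub>R (\<eta> - y0) - (- (2 * c1) *\<^sub>R (x0 - y0)) = 0"
    proof (rule inner_le_quadratic_imp_zero[OF d])
      show "1 / (2 * e) + c1 \<ge> 0" using e c1 by simp
      fix v :: "real^'n" assume v: "norm v < d"
      have 1: "(norm (\<eta> - (y0 + v)))\<^sup>2 = (norm (\<eta> - y0))\<^sup>2 - 2 * ((\<eta> - y0) \<bullet> v) + (norm v)\<^sup>2"
        using power2_norm_add[of "\<eta> - y0" "- v"] by (simp add: algebra_simps)
      have 2: "(norm (x0 - (y0 + v)))\<^sup>2 = (norm (x0 - y0))\<^sup>2 - 2 * ((x0 - y0) \<bullet> v) + (norm v)\<^sup>2"
        using power2_norm_add[of "x0 - y0" "- v"] by (simp add: algebra_simps)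
      have "- ((norm (\<eta> - (y0 + v)))\<^sup>2 / (2 * e)) - c1 * (norm (x0 - (y0 + v)))\<^sup>2
          \<le> - ((norm (\<eta> - y0))\<^sup>2 / (2 * e)) - c1 * (norm (x0 - y0))\<^sup>2"
        using key[of t0 x0 "y0 + v"] d v unfolding \<Phi> by (simp add: add_divide_distrib)
      then show "((1/e) *\<^sub>R (\<eta> - y0) - (- (2 * c1) *\<^sub>R (x0 - y0))) \<bullet> v \<le> (1 / (2 * e) + c1) * (norm v)\<^sup>2"
        unfolding 1 2 lhs split by (simp add: algebra_simps)
    qed
    then have "e *\<^sub>R ((1/e) *\<^sub>R (\<eta> - y0)) = e *\<^sub>R (- (2 * c1) *\<^sub>R (x0 - y0))"
      by (simp only: right_minus_eq)
    then show "snd w' - y0 = e *\<^sub>R (- (2 * c1) *\<^sub>R (x0 - y0))" using e by (simp add: ww)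
    let ?h = "\<lambda>t. - ((s - t)\<^sup>2 / (2 * e)) - (s' - t)\<^sup>2 / (2 * e) - \<Phi> t x0 y0"
    have "(?h has_real_derivative ((s - t0) / e + (s' - t0) / e - D)) (at t0)"
      using e by (auto intro!: derivative_eq_intros der simp: field_simps)
    moreover have "\<forall>t. \<bar>t0 - t\<bar> < d \<longrightarrow> ?h t \<le> ?h t0"
    proof (intro allI impI)
      fix t assume "\<bar>t0 - t\<bar> < d"
      then show "?h t \<le> ?h t0"
        using key[of t x0 y0] d by (simp add: add_divide_distrib abs_minus_commute)
    qed
    ultimately have "(s - t0) / e + (s' - t0) / e - D = 0"
      using d by (intro DERIV_local_max)
    then have "((s - t0) + (s' - t0)) / e = D"
      unfolding add_divide_distrib by linarith
    then show "(fst w - t0) + (fst w' - t0) = e * D" using e by (simp add: ww divide_eq_eq mult.commute)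
  qed
  obtain w w' where w: "supconv_star K e f (t0, x0) w" and w': "supconv_star K e g (t0, y0) w'"
    using att(1,3) by meson
  \<comment> \<open>Although only the sum of the time displacements is known, pairing both
    \<open>v\<close> and \<open>w\<close> with the same \<open>w'\<close> forces them to agree.
    Uniqueness is needed for maximisers at nearby points to stay close.\<close>
  have uw: "v = w" if "supconv_star K e f (t0, x0) v" for v
  proof -
    have "snd v - x0 = snd w - x0" using first_order(1)[OF that w'] first_order(1)[OF w w'] by (simp only:)
    moreover have "fst v = fst w" using first_order(3)[OF that w'] first_order(3)[OF w w'] by linarith
    ultimately show ?thesis by (simp add: prod_eq_iff)
  qed
  have uw': "v = w'" if "supconv_star K e g (t0, y0) v" for v
  proof -
    have "snd v - y0 = snd w' - y0" using first_order(2)[OF w that] first_order(2)[OF w w'] by (simp only:)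
    moreover have "fst v = fst w'" using first_order(3)[OF w that] first_order(3)[OF w w'] by linarith
    ultimately show ?thesis by (simp add: prod_eq_iff)
  qed
  define a a' where "a = (fst w - t0) / e" and "a' = (fst w' - t0) / e"
  have fo: "w - (t0, x0) = e *\<^sub>R (a, 2 *\<^sub>R (c1 *\<^sub>R (x0 - y0) + \<nu> *\<^sub>R x0))"
    "w' - (t0, y0) = e *\<^sub>R (a', - (2 * c1) *\<^sub>R (x0 - y0))" "a + a' = D"
  proof -
    show "w - (t0, x0) = e *\<^sub>R (a, 2 *\<^sub>R (c1 *\<^sub>R (x0 - y0) + \<nu> *\<^sub>R x0))"
      "w' - (t0, y0) = e *\<^sub>R (a', - (2 * c1) *\<^sub>R (x0 - y0))"
      using first_order(1,2)[OF w w'] e by (simp_all add: prod_eq_iff a_def a'_def)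
    have "a + a' = ((fst w - t0) + (fst w' - t0)) / e"
      unfolding a_def a'_def by (rule add_divide_distrib[symmetric])
    then show "a + a' = D" unfolding first_order(3)[OF w w'] using e by simp
  qed
  have second_order: "\<gamma>\<^sup>2 * q + \<gamma>'\<^sup>2 * q' \<le> 2 * real CARD('n) * (c1 * (\<gamma> - \<gamma>')\<^sup>2 + \<nu> * \<gamma>\<^sup>2)"
    if gam: "\<gamma> > 0" "\<gamma>' > 0"
      and lf: "local_trace_ge T f w ((1/e) *\<^sub>R (w - (t0, x0))) q"
      and lg: "local_trace_ge T g w' ((1/e) *\<^sub>R (w' - (t0, y0))) q'"
    for q q' \<gamma> \<gamma>'
  proof -
    obtain r1 where r1: "r1 > 0" "laplace_sub (\<lambda>z. F (t0, x0 + \<gamma> *\<^sub>R z)) (\<gamma>\<^sup>2 * q) r1"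
      using supconv_laplace_sub[OF K(1,3) e w uw int(1)[OF w] lf gam(1)] unfolding F_def by auto
    obtain r2 where r2: "r2 > 0" "laplace_sub (\<lambda>z. H (t0, y0 + \<gamma>' *\<^sub>R z)) (\<gamma>'\<^sup>2 * q') r2"
      using supconv_laplace_sub[OF K(1,4) e w' uw' int(2)[OF w'] lg gam(2)] unfolding H_def by auto
    define r0 where "r0 = min (min r1 r2) (min (d / \<gamma>) (d / \<gamma>'))"
    have r0: "r0 > 0" "r0 \<le> r1" "r0 \<le> r2" "r0 \<le> d / \<gamma>" "r0 \<le> d / \<gamma>'"
      using r1 r2 d gam by (auto simp: r0_def)
    \<comment> \<open>Gradient and quadratic coefficient of \<open>\<Phi>\<close> along the dilated
      directions; the coefficient \<open>c1\<close> meets only the difference of the two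
      dilations.\<close>
    define A B where "A = (2 * c1 * (\<gamma> - \<gamma>')) *\<^sub>R (x0 - y0) + (2 * \<nu> * \<gamma>) *\<^sub>R x0"
      and "B = c1 * (\<gamma> - \<gamma>')\<^sup>2 + \<nu> * \<gamma>\<^sup>2"
    define k where "k = F (t0, x0) + H (t0, y0)"
    define Q where "Q = (\<lambda>z. (k + A \<bullet> z) + B * (norm z)\<^sup>2)"
    have p1: "poly_deg_le (Suc 0) (\<lambda>z. k + A \<bullet> z)"
      by (intro poly_deg_le.add poly_deg_le.const poly_deg_le_inner)
    have p2: "poly_deg_le 2 (\<lambda>z::real^'n. B * (norm z)\<^sup>2)"
      by (intro poly_deg_le_cmult poly_deg_le_norm_square)
    have Qp: "poly_deg_le 2 Q"
      unfolding Q_def by (intro poly_deg_le.add p2 poly_deg_le_mono[OF p1]) simp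
    have Ql: "lap Q z = 2 * real CARD('n) * B" for z
      unfolding Q_def
      by (simp add: poly_add(1)[OF p1 p2] poly_deg_le_1_lap[OF p1] poly_cmult(1)[OF poly_deg_le_norm_square]
          lap_norm_square)
    have contF: "continuous_on UNIV F" "continuous_on UNIV H"
      unfolding F_def H_def by (intro supconv_continuous K e)+
    have "\<gamma>\<^sup>2 * q + \<gamma>'\<^sup>2 * q' \<le> 2 * real CARD('n) * B"
    proof (rule laplace_sub_sum[OF laplace_sub_mono[OF r1(2) r0(2)] _ laplace_sub_mono[OF r2(2) r0(3)] _
          Qp Ql r0(1)])
      show "continuous_on UNIV (\<lambda>z. F (t0, x0 + \<gamma> *\<^sub>R z))" "continuous_on UNIV (\<lambda>z. H (t0, y0 + \<gamma>' *\<^sub>R z))"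
        by (auto intro!: continuous_on_compose2[OF contF(1)] continuous_on_compose2[OF contF(2)] continuous_intros)
      show "F (t0, x0 + \<gamma> *\<^sub>R 0) + H (t0, y0 + \<gamma>' *\<^sub>R 0) = Q 0"
        by (simp add: Q_def k_def)
      fix z :: "real^'n" assume "z \<in> ball 0 r0"
      then have "norm z < d / \<gamma>" "norm z < d / \<gamma>'" using r0 by auto
      then have "norm (\<gamma> *\<^sub>R z) < d" "norm (\<gamma>' *\<^sub>R z) < d"
        using gam by (simp_all add: pos_less_divide_eq mult.commute)
      then have "F (t0, x0 + \<gamma> *\<^sub>R z) + H (t0, y0 + \<gamma>' *\<^sub>R z)
          \<le> k + (\<Phi> t0 (x0 + \<gamma> *\<^sub>R z) (y0 + \<gamma>' *\<^sub>R z) - \<Phi> t0 x0 y0)"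
        using max[of t0 "x0 + \<gamma> *\<^sub>R z" "y0 + \<gamma>' *\<^sub>R z"] d by (simp add: F_def H_def k_def)
      also have "\<Phi> t0 (x0 + \<gamma> *\<^sub>R z) (y0 + \<gamma>' *\<^sub>R z) - \<Phi> t0 x0 y0 = A \<bullet> z + B * (norm z)\<^sup>2"
      proof -
        have eq: "x0 + \<gamma> *\<^sub>R z - (y0 + \<gamma>' *\<^sub>R z) = (x0 - y0) + (\<gamma> - \<gamma>') *\<^sub>R z"
          by (simp add: algebra_simps)
        have 1: "(norm (x0 + \<gamma> *\<^sub>R z - (y0 + \<gamma>' *\<^sub>R z)))\<^sup>2
            = (norm (x0 - y0))\<^sup>2 + 2 * (\<gamma> - \<gamma>') * ((x0 - y0) \<bullet> z) + (\<gamma> - \<gamma>')\<^sup>2 * (norm z)\<^sup>2"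
          unfolding eq power2_norm_add by (simp add: power_mult_distrib)
        have 2: "(norm (x0 + \<gamma> *\<^sub>R z))\<^sup>2 = (norm x0)\<^sup>2 + 2 * \<gamma> * (x0 \<bullet> z) + \<gamma>\<^sup>2 * (norm z)\<^sup>2"
          using power2_norm_add[of x0 "\<gamma> *\<^sub>R z"] by (simp add: power_mult_distrib)
        show ?thesis
          unfolding \<Phi> 1 2 A_def B_def inner_add_left inner_scaleR_left by (simp add: algebra_simps)
      qed
      finally show "F (t0, x0 + \<gamma> *\<^sub>R z) + H (t0, y0 + \<gamma>' *\<^sub>R z) \<le> Q z" by (simp add: Q_def)
    qed
    then show ?thesis by (simp add: B_def)
  qed
  show thesis by (rule that[OF w w' fo]) (intro allI impI second_order)
qed

section \<open>Freezing the coefficients and the doubling estimate\<close>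

lemma compact_parameter_pos:
  fixes N :: "'a::metric_space \<Rightarrow> 'c::topological_space \<Rightarrow> real"
  assumes A: "compact A" and V: "open V" "y0 \<in> V"
    and N: "continuous_on (V \<times> A) (\<lambda>(y, c). N y c)" and pos: "\<And>c. c \<in> A \<Longrightarrow> N y0 c > 0"
  shows "\<exists>r>0. \<forall>y. dist y y0 < r \<longrightarrow> y \<in> V \<and> (\<forall>c\<in>A. N y c > 0)"
proof -
  \<comment> \<open>The tube argument: each control has a product neighbourhood on which positivity
    persists, and finitely many of them cover \<open>A\<close>.\<close>
  have "\<exists>B W. y0 \<in> B \<and> open B \<and> c \<in> W \<and> open W \<and> (\<forall>y\<in>B. y \<in> V) \<and> (\<forall>y\<in>B. \<forall>c'\<in>W \<inter> A. N y c' > 0)"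
    if c: "c \<in> A" for c
  proof -
    have "open {0::real<..}" by simp
    then obtain O' where O': "open O'" "O' \<inter> (V \<times> A) = (\<lambda>(y, c). N y c) -` {0<..} \<inter> (V \<times> A)"
      using N unfolding continuous_on_open_invariant by blast
    then have "(y0, c) \<in> O'" using pos[OF c] V(2) c by auto
    then obtain B W where "open B" "open W" "(y0, c) \<in> B \<times> W" "B \<times> W \<subseteq> O'"
      by (rule open_prod_elim[OF O'(1)])
    then show ?thesis
      using V O'(2) by (intro exI[of _ "B \<inter> V"] exI[of _ W]) (auto simp: set_eq_iff)
  qed
  then obtain B W where BW: "\<And>c. c \<in> A \<Longrightarrow> y0 \<in> B c \<and> open (B c) \<and> c \<in> W c \<and> open (W c) \<and>
      (\<forall>y\<in>B c. y \<in> V) \<and> (\<forall>y\<in>B c. \<forall>c'\<in>W c \<inter> A. N y c' > 0)"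
    by metis
  obtain C where C: "C \<subseteq> A" "finite C" "A \<subseteq> (\<Union>c\<in>C. W c)"
    using A BW by (elim compactE_image[of A A W]) auto
  have "open (V \<inter> (\<Inter>c\<in>C. B c))" "y0 \<in> V \<inter> (\<Inter>c\<in>C. B c)"
    using C BW V by (auto intro!: open_INT)
  then obtain r where "r > 0" "\<And>y. dist y y0 < r \<Longrightarrow> y \<in> V \<inter> (\<Inter>c\<in>C. B c)"
    unfolding open_dist by metis
  with C BW show ?thesis by (intro exI[of _ r]) blast
qed

text \<open>The strict inequality at the limit jet persists nearby uniformly in the control;
  subtracting it from the viscosity inequality leaves q < tr X after division by the positive factor
  \<open>(\<Gamma> x c)\<^sup>2 / 2\<close>. The sign \<open>\<sigma>\<close> covers both uses: -1
  for f = u with a single control, 1 for f = -u with all controls.\<close>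

lemma local_trace_bound:
  fixes f u :: "real \<times> (real^'n) \<Rightarrow> real" and \<Gamma> :: "real^'n \<Rightarrow> 'c::topological_space \<Rightarrow> real"
    and b :: "real^'n \<Rightarrow> 'c \<Rightarrow> real^'n" and L :: "real \<Rightarrow> real^'n \<Rightarrow> 'c \<Rightarrow> real"
  assumes A: "compact A" and V: "open V" "w0 \<in> V"
    and contG: "continuous_on (UNIV \<times> A) (\<lambda>(x, c). \<Gamma> x c)"
    and contb: "continuous_on (UNIV \<times> A) (\<lambda>(x, c). b x c)"
    and contL: "continuous_on (fst ` V \<times> UNIV \<times> A) (\<lambda>(t, x, c). L t x c)"
    and contu: "continuous_on V u"
    and G: "\<And>x c. c \<in> A \<Longrightarrow> \<Gamma> x c > 0"
    and pos: "\<And>c. c \<in> A \<Longrightarrow> 0 < - a0 - (\<Gamma> (snd w0) c)\<^sup>2 / 2 * q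
      + \<sigma> * (L (fst w0) (snd w0) c - lam * u w0) - p0 \<bullet> b (snd w0) c"
    and jet: "\<And>t x a p X. (t, x) \<in> V \<Longrightarrow> (a, p, X) \<in> P2plus T f (t, x) \<Longrightarrow>
      \<exists>c\<in>A. - a - (\<Gamma> x c)\<^sup>2 / 2 * trace X + \<sigma> * (L t x c - lam * u (t, x)) - p \<bullet> b x c \<le> 0"
  shows "local_trace_ge T f w0 (a0, p0) q"
proof -
  define N where "N = (\<lambda>(w, (a, p)) c. - a - (\<Gamma> (snd w) c)\<^sup>2 / 2 * q
      + \<sigma> * (L (fst w) (snd w) c - lam * u w) - p \<bullet> b (snd w) c)"
  have "continuous_on ((V \<times> UNIV) \<times> A) (\<lambda>(y, c). N y c)"
    unfolding N_def split_beta
    by (intro continuous_intros continuous_on_compose2[OF contu]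
        continuous_on_compose2[OF contG[unfolded split_beta], of _ "\<lambda>z. (snd (fst (fst z)), snd z)", simplified]
        continuous_on_compose2[OF contb[unfolded split_beta], of _ "\<lambda>z. (snd (fst (fst z)), snd z)", simplified]
        continuous_on_compose2[OF contL[unfolded split_beta], of _ "\<lambda>z. (fst (fst (fst z)), snd (fst (fst z)), snd z)", simplified])
      auto
  then have "\<exists>r>0. \<forall>y. dist y (w0, (a0, p0)) < r \<longrightarrow> y \<in> V \<times> UNIV \<and> (\<forall>c\<in>A. N y c > 0)"
    using V pos by (intro compact_parameter_pos[OF A]) (auto simp: N_def open_Times)
  then obtain r where r: "r > 0" "\<And>y. dist y (w0, (a0, p0)) < r \<Longrightarrow> y \<in> V \<times> UNIV \<and> (\<forall>c\<in>A. N y c > 0)"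
    by blast
  have "trace X \<ge> q" if w: "norm (w - w0) < r / 2" and P: "(a, p, X) \<in> P2plus T f w"
    and ap: "norm ((a, p) - (a0, p0)) < r / 2" for w a p X
  proof -
    obtain t x where tx: "w = (t, x)" by (cases w)
    have "dist (w, (a, p)) (w0, (a0, p0)) \<le> norm (w - w0) + norm ((a, p) - (a0, p0))"
      using norm_Pair_le[of "w - w0" "(a, p) - (a0, p0)"] by (simp add: dist_norm)
    then have N: "w \<in> V" "\<And>c. c \<in> A \<Longrightarrow> N (w, (a, p)) c > 0" using r(2)[of "(w, (a, p))"] w ap by auto
    obtain c where c: "c \<in> A"
      "- a - (\<Gamma> x c)\<^sup>2 / 2 * trace X + \<sigma> * (L t x c - lam * u (t, x)) - p \<bullet> b x c \<le> 0"
      using jet[of t x a p X] N(1) P tx by blast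
    have "(\<Gamma> x c)\<^sup>2 / 2 * q < (\<Gamma> x c)\<^sup>2 / 2 * trace X"
      using N(2)[OF c(1)] c(2) by (simp add: N_def tx)
    then show ?thesis using G[OF c(1), of x] by (simp add: mult_less_cancel_left)
  qed
  then show ?thesis unfolding local_trace_ge_def using r(1) half_gt_zero by blast
qed

text \<open>The three summands of \<open>k\<close> are the prices of the drift, the diffusion and
  the running cost, each measured in multiples of the penalty. The hypothesis C >= 1 keeps the
  exponential factor at least 1, so that the penalty also dominates |x-y| itself.\<close>

lemma bellman_doubling_bound:
  fixes u :: "real \<times> (real^'n) \<Rightarrow> real" and A :: "'c::metric_space set"
    and \<Gamma> :: "real^'n \<Rightarrow> 'c \<Rightarrow> real"
    and b :: "real^'n \<Rightarrow> 'c \<Rightarrow> real^'n" and L :: "real \<Rightarrow> real^'n \<Rightarrow> 'c \<Rightarrow> real"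
  assumes T: "T > 0" and lam: "lam \<ge> 0" and A: "compact A" "A \<noteq> {}"
    and contG: "continuous_on (UNIV \<times> A) (\<lambda>(x, c). \<Gamma> x c)"
    and contb: "continuous_on (UNIV \<times> A) (\<lambda>(x, c). b x c)"
    and contL: "continuous_on ({0..T} \<times> UNIV \<times> A) (\<lambda>(t, x, c). L t x c)"
    and G: "\<And>x c. c \<in> A \<Longrightarrow> 0 < \<Gamma> x c \<and> \<Gamma> x c \<le> \<Lambda>"
    and b: "\<And>x c. c \<in> A \<Longrightarrow> norm (b x c) \<le> M"
    and lipG: "\<And>x y c. c \<in> A \<Longrightarrow> \<bar>\<Gamma> x c - \<Gamma> y c\<bar> \<le> lG * norm (x - y)" "lG \<ge> 0"
    and lipb: "\<And>x y c. c \<in> A \<Longrightarrow> norm (b x c - b y c) \<le> lb * norm (x - y)" "lb \<ge> 0"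
    and lipL: "\<And>t x y c. t \<in> {0..T} \<Longrightarrow> c \<in> A \<Longrightarrow> \<bar>L t x c - L t y c\<bar> \<le> lL * norm (x - y)" "lL \<ge> 0"
    and contu: "continuous_on ({0<..T} \<times> UNIV) u"
    and B: "\<And>t x. t \<in> {0<..T} \<Longrightarrow> \<bar>u (t, x)\<bar> \<le> B" "B > 0"
    and sub: "\<And>t x a p X c. t \<in> {0<..<T} \<Longrightarrow> (a, p, X) \<in> P2plus T u (t, x) \<Longrightarrow> c \<in> A \<Longrightarrow>
      - a - (\<Gamma> x c)\<^sup>2 / 2 * trace X - L t x c - p \<bullet> b x c + lam * u (t, x) \<le> 0"
    and super: "\<And>t x a p X. t \<in> {0<..<T} \<Longrightarrow> (a, p, X) \<in> P2plus T (\<lambda>w. - u w) (t, x) \<Longrightarrow>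
      \<exists>c\<in>A. - a - (\<Gamma> x c)\<^sup>2 / 2 * trace X + L t x c - p \<bullet> b x c - lam * u (t, x) \<le> 0"
    and C: "C \<ge> 1" "\<And>x y. u (T, x) - u (T, y) \<le> C * norm (x - y)"
    and k: "k = 2 * lb + real CARD('n) * lG\<^sup>2 + lL"
    and m: "m > 0" and th: "\<theta> > 0" and t1: "t1 \<in> {0<..T}"
  shows "u (t1, x1) - u (t1, y1) \<le> C * exp (k * (T - t1)) * ((norm (x1 - y1))\<^sup>2 / m + m) / 2 + \<theta> / t1"
proof (rule ccontr)
  define E where "E = (\<lambda>t. C * exp (k * (T - t)))"
  define n where "n = real CARD('n)"
  \<comment> \<open>A smooth majorant of |x-y| by the inequality of means, exact where |x-y| =
    m.\<close>
  define S where "S = (\<lambda>x y :: real^'n. ((norm (x - y))\<^sup>2 / m + m) / 2)"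
  have k0: "k \<ge> 0" using k lipb(2) lipG(2) lipL(2) by simp
  have E1: "1 \<le> E t" "C \<le> E t" "E t \<le> E 0" if "t \<in> {0..T}" for t
  proof -
    have "1 \<le> exp (k * (T - t))" using k0 that by simp
    then have "C * 1 \<le> C * exp (k * (T - t))" using C(1) by (intro mult_left_mono) auto
    then show "C \<le> E t" by (simp add: E_def)
    then show "1 \<le> E t" using C(1) by linarith
    have "k * (T - t) \<le> k * (T - 0)" using k0 that by (intro mult_left_mono) auto
    then show "E t \<le> E 0" using C(1) by (auto simp: E_def)
  qed
  have S_ge: "norm (x - y) \<le> S x y" "S x y \<ge> 0" "(norm (x - y))\<^sup>2 / (2 * m) \<le> S x y" for x y
  proof -
    have "0 \<le> (norm (x - y) - m)\<^sup>2 / (2 * m)" using m by simp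
    also have "\<dots> = S x y - norm (x - y)"
      using m by (simp add: S_def power2_diff field_simps power2_eq_square)
    finally show "norm (x - y) \<le> S x y" by simp
    then show "S x y \<ge> 0" using norm_ge_zero order_trans by blast
    show "(norm (x - y))\<^sup>2 / (2 * m) \<le> S x y" using m by (simp add: S_def field_simps)
  qed
  assume neg: "\<not> ?thesis"
  define \<mu> where "\<mu> = u (t1, x1) - u (t1, y1) - E t1 * S x1 y1 - \<theta> / t1"
  have mu: "\<mu> > 0" using neg by (simp add: \<mu>_def E_def S_def)
  \<comment> \<open>The first bound keeps the doubled function at least \<mu>/2 at the starting
    point. The second bounds all that the localising term contributes later:
    \<open>\<nu> * n * \<Lambda>\<^sup>2\<close> through the diffusion, the root through the
    drift.\<close>
  have "\<exists>\<nu>>0. \<nu> * (norm x1)\<^sup>2 < \<mu> / 2 \<and> \<nu> * n * \<Lambda>\<^sup>2 + 2 * M * sqrt (2 * B * \<nu>) < \<theta> / (2 * T\<^sup>2)"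
  proof -
    have "((\<lambda>\<nu>. \<nu> * (norm x1)\<^sup>2) \<longlongrightarrow> 0) (at_right 0)"
      by (auto intro!: tendsto_eq_intros)
    then have "\<forall>\<^sub>F \<nu> in at_right 0. \<nu> * (norm x1)\<^sup>2 < \<mu> / 2"
      by (rule order_tendstoD(2)) (use mu in simp)
    moreover have "((\<lambda>\<nu>. \<nu> * n * \<Lambda>\<^sup>2 + 2 * M * sqrt (2 * B * \<nu>)) \<longlongrightarrow> 0) (at_right 0)"
      by (auto intro!: tendsto_eq_intros)
    then have "\<forall>\<^sub>F \<nu> in at_right 0. \<nu> * n * \<Lambda>\<^sup>2 + 2 * M * sqrt (2 * B * \<nu>) < \<theta> / (2 * T\<^sup>2)"
      by (rule order_tendstoD(2)) (use th T in simp)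
    moreover have "\<forall>\<^sub>F \<nu> in at_right (0::real). \<nu> > 0" by (rule eventually_at_right_less)
    ultimately have "\<forall>\<^sub>F \<nu> in at_right 0. \<nu> > 0 \<and> \<nu> * (norm x1)\<^sup>2 < \<mu> / 2 \<and>
        \<nu> * n * \<Lambda>\<^sup>2 + 2 * M * sqrt (2 * B * \<nu>) < \<theta> / (2 * T\<^sup>2)"
      by eventually_elim auto
    then show ?thesis using eventually_happens trivial_limit_at_right_real by blast
  qed
  then obtain \<nu> where nu: "\<nu> > 0" "\<nu> * (norm x1)\<^sup>2 < \<mu> / 2"
    "\<nu> * n * \<Lambda>\<^sup>2 + 2 * M * sqrt (2 * B * \<nu>) < \<theta> / (2 * T\<^sup>2)" by blast
  define \<Phi> where "\<Phi> = (\<lambda>t x y. E t * S x y + \<nu> * (norm x)\<^sup>2 + \<theta> / t)"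
  \<comment> \<open>Nonnegativity forces \<theta>/t <= 2 B, that is t >= 2 \<tau>; a compact set
    starting at \<tau> leaves a margin.\<close>
  define \<tau> where "\<tau> = \<theta> / (4 * B)"
  have tau: "\<tau> > 0" using th B(2) by (simp add: \<tau>_def)
  define Z where "Z = sqrt (4 * B * m)"
  have Z: "Z \<ge> 0" using B(2) m by (simp add: Z_def)
  \<comment> \<open>The root bounds |x|, the summand \<open>Z\<close> passes the bound on to |y|,
    and the rest is room around both points.\<close>
  define R where "R = sqrt (2 * B / \<nu>) + Z + 2"
  have apriori: "2 * \<tau> \<le> t" "norm x \<le> R - 1" "norm y \<le> R - 1" "norm (x - y) \<le> Z"
      "\<nu> * norm x \<le> sqrt (2 * B * \<nu>)"
    if t: "t \<in> {0<..T}" and ge: "u (t, x) - u (t, y) - \<Phi> t x y \<ge> 0" for t x y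
  proof -
    have u: "u (t, x) - u (t, y) \<le> 2 * B" using B(1)[OF t, of x] B(1)[OF t, of y] by linarith
    have E0: "1 \<le> E t" using E1(1) t by auto
    have nn: "E t * S x y \<ge> 0" "\<nu> * (norm x)\<^sup>2 \<ge> 0" "\<theta> / t \<ge> 0"
      using E0 S_ge(2)[of x y] nu(1) th t by auto
    have "\<theta> / t \<le> 2 * B" using u ge nn by (simp add: \<Phi>_def)
    then show "2 * \<tau> \<le> t" using t B(2) by (simp add: \<tau>_def field_simps)
    have 1: "\<nu> * (norm x)\<^sup>2 \<le> 2 * B" using u ge nn by (simp add: \<Phi>_def)
    then have "(norm x)\<^sup>2 \<le> 2 * B / \<nu>" using nu(1) by (simp add: field_simps)
    then have x: "norm x \<le> sqrt (2 * B / \<nu>)" by (rule real_le_rsqrt)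
    then show "norm x \<le> R - 1" using Z by (simp add: R_def)
    have "1 * S x y \<le> E t * S x y" using E0 S_ge(2) by (intro mult_right_mono) auto
    then have "(norm (x - y))\<^sup>2 / (2 * m) \<le> 2 * B" using S_ge(3)[of x y] u ge nn by (simp add: \<Phi>_def)
    then have "(norm (x - y))\<^sup>2 \<le> 4 * B * m" using m by (simp add: field_simps)
    then show z: "norm (x - y) \<le> Z" unfolding Z_def by (rule real_le_rsqrt)
    then show "norm y \<le> R - 1" using x norm_triangle_ineq3[of x y] by (simp add: R_def)
    have "(\<nu> * norm x)\<^sup>2 = \<nu> * (\<nu> * (norm x)\<^sup>2)" by (simp add: power2_eq_square)
    also have "\<dots> \<le> \<nu> * (2 * B)" using 1 nu(1) by (intro mult_left_mono) auto
    finally show "\<nu> * norm x \<le> sqrt (2 * B * \<nu>)" by (intro real_le_rsqrt) (simp add: mult_ac)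
  qed
  have start: "u (t1, x1) - u (t1, y1) - \<Phi> t1 x1 y1 \<ge> \<mu> / 2"
  proof -
    have "u (t1, x1) - u (t1, y1) - \<Phi> t1 x1 y1 = \<mu> - \<nu> * (norm x1)\<^sup>2"
      by (simp add: \<Phi>_def \<mu>_def)
    then show ?thesis using nu(2) by linarith
  qed
  then have "u (t1, x1) - u (t1, y1) - \<Phi> t1 x1 y1 \<ge> 0" using mu by linarith
  from apriori(1-3)[OF t1 this] have ap1: "2 * \<tau> \<le> t1" "norm x1 \<le> R - 1" "norm y1 \<le> R - 1" .
  define K where "K = {\<tau>..T} \<times> cball (0::real^'n) R"
  have Ksub: "K \<subseteq> {0<..T} \<times> UNIV" using tau by (auto simp: K_def)
  have compK: "compact K" unfolding K_def by (intro compact_Times compact_Icc compact_cball)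
  have contK: "continuous_on K u" using contu Ksub by (rule continuous_on_subset)
  have inK1: "(t1, x1) \<in> K" "(t1, y1) \<in> K" using ap1 tau t1 by (auto simp: K_def)
  have Kne: "K \<noteq> {}" using inK1 by auto
  \<comment> \<open>This modulus serves twice: for the loss in returning from the sup-convolutions
    to \<open>u\<close>, and for keeping the maximum away from t = T.\<close>
  obtain \<omega>1 where om1: "\<omega>1 > 0" "\<And>w z. w \<in> K \<Longrightarrow> z \<in> K \<Longrightarrow> norm (w - z) < \<omega>1 \<Longrightarrow> \<bar>u w - u z\<bar> < \<mu> / 8"
  proof -
    have "uniformly_continuous_on K u" by (rule compact_uniformly_continuous[OF contK compK])
    moreover have "\<mu> / 8 > 0" using mu by simp
    ultimately show thesis using that unfolding uniformly_continuous_on_def dist_norm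
      by (metis norm_minus_commute real_norm_def)
  qed
  define h0 where "h0 = \<theta> / (20 * T\<^sup>2)"
  have h0: "h0 > 0" using th T by (simp add: h0_def)
  obtain \<omega>2 where om2: "\<omega>2 > 0" "\<And>t x s y c. (t, x) \<in> K \<Longrightarrow> (s, y) \<in> K \<Longrightarrow> c \<in> A \<Longrightarrow>
      norm ((t, x) - (s, y)) < \<omega>2 \<Longrightarrow> \<bar>L t x c - L s y c\<bar> < h0"
  proof -
    have "continuous_on ({\<tau>..T} \<times> cball 0 R \<times> A) (\<lambda>(t, x, c). L t x c)"
      using contL by (rule continuous_on_subset) (use tau in auto)
    moreover have "compact ({\<tau>..T} \<times> cball (0::real^'n) R \<times> A)"
      by (intro compact_Times compact_Icc compact_cball A)
    ultimately have uc: "uniformly_continuous_on ({\<tau>..T} \<times> cball 0 R \<times> A) (\<lambda>(t, x, c). L t x c)"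
      by (rule compact_uniformly_continuous)
    define Lf where "Lf = (\<lambda>(t, x, c). L t x c)"
    obtain \<delta> where d: "\<delta> > 0" "\<And>w w'. w \<in> {\<tau>..T} \<times> cball 0 R \<times> A \<Longrightarrow> w' \<in> {\<tau>..T} \<times> cball 0 R \<times> A \<Longrightarrow>
        dist w' w < \<delta> \<Longrightarrow> dist (Lf w') (Lf w) < h0"
      using uc[folded Lf_def] h0 unfolding uniformly_continuous_on_def by meson
    have "\<bar>L t x c - L s y c\<bar> < h0"
      if "(t, x) \<in> K" "(s, y) \<in> K" "c \<in> A" "norm ((t, x) - (s, y)) < \<delta>" for t x s y c
      using d(2)[of "(s, y, c)" "(t, x, c)"] that
      by (simp add: K_def dist_Pair_Pair norm_Pair dist_norm Lf_def)
    with d(1) that show thesis by blast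
  qed
  \<comment> \<open>A bound for the later \<open>c1\<close> that does not depend on
    \<open>t0\<close>: \<omega>, and with it the parameter \<open>e\<close>, must be fixed before
    the maximum point is known. \<open>W\<close> then collects the coefficients of the errors of
    order \<omega>.\<close>
  define cb where "cb = E 0 / (2 * m)"
  have cb: "cb \<ge> 0" using E1(1)[of 0] T m by (simp add: cb_def)
  define W where "W = 4 * cb * Z * lb + n * cb * lG\<^sup>2 * (4 * Z + 4)"
  have W: "W \<ge> 0" using cb Z lipb(2) by (simp add: W_def n_def)
  define \<omega> where "\<omega> = min (min (\<omega>1 / 2) \<omega>2) (min (min (\<tau> / 2) (1 / 2)) (h0 / (W + 1)))"
  have om: "\<omega> > 0" "\<omega> \<le> \<omega>1 / 2" "\<omega> \<le> \<omega>2" "\<omega> \<le> \<tau> / 2" "\<omega> \<le> 1 / 2" "\<omega> \<le> h0 / (W + 1)"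
  proof -
    show "\<omega> > 0" using om1(1) om2(1) tau h0 W by (simp add: \<omega>_def)
    show "\<omega> \<le> \<omega>1 / 2" "\<omega> \<le> \<omega>2" "\<omega> \<le> \<tau> / 2" "\<omega> \<le> 1 / 2" "\<omega> \<le> h0 / (W + 1)"
      by (simp_all only: \<omega>_def min_le_iff_disj order_refl simp_thms)
  qed
  have "\<omega> * (W + 1) \<le> h0" using om(6) W by (simp add: field_simps)
  then have omW: "W * \<omega> \<le> h0" using om(1) by (simp add: algebra_simps)
  \<comment> \<open>A maximiser satisfies |w - z|^2 <= 4 B e, which is half of
    \<open>\<omega>\<^sup>2\<close>.\<close>
  define e where "e = \<omega>\<^sup>2 / (8 * B)"
  have e: "e > 0" using om(1) B(2) by (simp add: e_def)
  define F H where "F = supconv K e u" and "H = supconv K e (\<lambda>w. - u w)"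
  have contK': "continuous_on K (\<lambda>w. - u w)" by (intro continuous_on_minus contK)
  note att = supconv_attained[OF compK Kne contK] supconv_attained[OF compK Kne contK']
  have star_close: "w \<in> K" "norm (w - z) < \<omega>" "supconv K e f z \<le> f w"
    if w: "supconv_star K e f z w" and z: "z \<in> K" and f: "f = u \<or> f = (\<lambda>w. - u w)" for f z w
  proof -
    have cf: "continuous_on K f" using f contK contK' by auto
    have bd: "\<bar>f v\<bar> \<le> B" if "v \<in> K" for v
      using f B(1)[of "fst v" "snd v"] Ksub that by (auto simp: mem_Times_iff)
    show wK: "w \<in> K" using w by (simp add: supconv_star_def)
    have eq: "supconv K e f z = f w - (norm (w - z))\<^sup>2 / (2 * e)" using w by (simp add: supconv_star_def)
    then show "supconv K e f z \<le> f w" using e by simp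
    have "f z \<le> supconv K e f z" using supconv_attained(2)[OF compK Kne cf z, of z e] by simp
    then have "(norm (w - z))\<^sup>2 / (2 * e) \<le> 2 * B" using eq bd[OF wK] bd[OF z] by linarith
    then have "(norm (w - z))\<^sup>2 \<le> 4 * B * e" using e by (simp add: field_simps)
    also have "4 * B * e = \<omega>\<^sup>2 / 2" using B(2) by (simp add: e_def)
    also have "\<dots> < \<omega>\<^sup>2" using om(1) by simp
    finally show "norm (w - z) < \<omega>" using om(1) power2_less_imp_less by fastforce
  qed
  define D where "D = {\<tau>..T} \<times> cball (0::real^'n) R \<times> cball (0::real^'n) R"
  define \<Psi> where "\<Psi> = (\<lambda>(t, x, y). F (t, x) + H (t, y) - \<Phi> t x y)"
  have contFH: "continuous_on UNIV F" "continuous_on UNIV H"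
    unfolding F_def H_def by (intro supconv_continuous compK Kne contK contK' e)+
  have "continuous_on D \<Psi>"
    unfolding \<Psi>_def \<Phi>_def E_def S_def split_beta
    using tau m
    by (intro continuous_intros continuous_on_compose2[OF contFH(1)] continuous_on_compose2[OF contFH(2)])
      (auto simp: D_def)
  moreover have "compact D" unfolding D_def by (intro compact_Times compact_Icc compact_cball)
  moreover have "(t1, x1, y1) \<in> D" using inK1 by (auto simp: D_def K_def)
  ultimately obtain z0 where z0: "z0 \<in> D" "\<And>z. z \<in> D \<Longrightarrow> \<Psi> z \<le> \<Psi> z0"
    using continuous_attains_sup[of D \<Psi>] by blast
  obtain t0 x0 y0 where zz: "z0 = (t0, x0, y0)" by (metis surj_pair)
  have in0: "(t0, x0) \<in> K" "(t0, y0) \<in> K" and t0: "t0 \<in> {0<..T}" "t0 \<in> {0..T}"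
    using z0(1) tau by (auto simp: zz D_def K_def)
  have Psi0: "\<mu> / 2 \<le> F (t0, x0) + H (t0, y0) - \<Phi> t0 x0 y0"
  proof -
    have "u (t1, x1) \<le> F (t1, x1)" "- u (t1, y1) \<le> H (t1, y1)"
      using att(2)[OF inK1(1), of "(t1, x1)" e] att(4)[OF inK1(2), of "(t1, y1)" e] by (auto simp: F_def H_def)
    then have "\<mu> / 2 \<le> \<Psi> (t1, x1, y1)" using start by (simp add: \<Psi>_def)
    also have "\<dots> \<le> \<Psi> z0" by (rule z0(2)) fact
    finally show ?thesis by (simp add: \<Psi>_def zz)
  qed
  have stars: "norm (w - (t0, x0)) < \<omega>" "norm (w' - (t0, y0)) < \<omega>" "w \<in> K" "w' \<in> K"
      "F (t0, x0) \<le> u w" "H (t0, y0) \<le> - u w'"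
    if "supconv_star K e u (t0, x0) w" "supconv_star K e (\<lambda>w. - u w) (t0, y0) w'" for w w'
    using star_close[OF that(1) in0(1)] star_close[OF that(2) in0(2)] by (auto simp: F_def H_def)
  \<comment> \<open>The maximum point belongs to the regularised functions; returning to
    \<open>u\<close> costs at most \<mu>/4 and makes \<open>apriori\<close> available there.\<close>
  have hat: "\<mu> / 4 < u (t0, x0) - u (t0, y0) - \<Phi> t0 x0 y0"
  proof -
    obtain w w' where ww: "supconv_star K e u (t0, x0) w" "supconv_star K e (\<lambda>w. - u w) (t0, y0) w'"
      using att(1,3) by meson
    note st = stars[OF ww]
    have "\<bar>u w - u (t0, x0)\<bar> < \<mu> / 8" "\<bar>u w' - u (t0, y0)\<bar> < \<mu> / 8"
      using st(1,2) om(1,2) by (auto intro!: om1(2) st(3,4) in0 simp del: less_divide_eq_numeral1)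
    then show ?thesis using st Psi0 mu unfolding abs_less_iff by linarith
  qed
  then have hat0: "u (t0, x0) - u (t0, y0) - \<Phi> t0 x0 y0 \<ge> 0" using mu by linarith
  note ap0 = apriori[OF t0(1) hat0]
  have nonneg: "E t0 * S x0 y0 \<ge> 0" "\<nu> * (norm x0)\<^sup>2 \<ge> 0" "\<theta> / t0 \<ge> 0"
    using E1(1)[OF t0(2)] S_ge(2)[of x0 y0] nu(1) th t0 by auto
  \<comment> \<open>Closer to T, the terminal Lipschitz bound and the modulus of \<open>u\<close>
    would hold the doubled function below \<mu>/4.\<close>
  have t0T: "\<omega>1 \<le> T - t0"
  proof (rule ccontr)
    assume "\<not> \<omega>1 \<le> T - t0"
    then have "norm ((t0, x) - (T, x)) < \<omega>1" for x :: "real^'n" using t0 by (simp add: norm_Pair)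
    moreover have "(T, x0) \<in> K" "(T, y0) \<in> K" using in0 by (auto simp: K_def)
    ultimately have "\<bar>u (t0, x0) - u (T, x0)\<bar> < \<mu> / 8" "\<bar>u (t0, y0) - u (T, y0)\<bar> < \<mu> / 8"
      using om1(2) in0 by blast+
    moreover have "u (T, x0) - u (T, y0) \<le> E t0 * S x0 y0"
      using C E1[OF t0(2)] S_ge[of x0 y0] by (intro order_trans[OF C(2)] mult_mono) auto
    ultimately show False using hat nonneg unfolding \<Phi>_def abs_less_iff by linarith
  qed
  define V where "V = {\<tau><..<T} \<times> ball (0::real^'n) R"
  have V: "open V" "V \<subseteq> interior K"
  proof -
    show "open V" unfolding V_def by (intro open_Times open_greaterThanLessThan open_ball)
    moreover have "V \<subseteq> K" by (auto simp: V_def K_def)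
    ultimately show "V \<subseteq> interior K" by (rule interior_maximal[rotated])
  qed
  have inV: "w \<in> V" if "norm (w - (t0, x)) < \<omega>" "norm x \<le> R - 1" for w x
  proof -
    have "\<bar>fst w - t0\<bar> < \<omega>" "norm (snd w - x) < \<omega>"
      using that(1) norm_fst_le[of "fst w - t0" "snd w - x"] norm_snd_le[of "snd w - x" "fst w - t0"]
      by (cases w; simp)+
    moreover have "norm (snd w) \<le> norm x + norm (snd w - x)" by (rule norm_triangle_sub)
    ultimately have "\<tau> < fst w" "fst w < T" "norm (snd w) < R"
      using om om1(1) ap0(1) tau t0T that(2) unfolding abs_less_iff by linarith+
    then show ?thesis by (simp add: V_def mem_Times_iff)
  qed
  define d where "d = min (min \<tau> \<omega>1) 1"
  have d: "d > 0" "d \<le> \<tau>" "d \<le> \<omega>1" "d \<le> 1" using tau om1(1) by (auto simp: d_def)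
  define c1 where "c1 = E t0 / (2 * m)"
  have c1: "c1 \<ge> 0" "c1 \<le> cb" using E1[OF t0(2)] m by (auto simp: c1_def cb_def divide_right_mono)
  have max: "supconv K e u (t, x) + supconv K e (\<lambda>w. - u w) (t, y) - \<Phi> t x y
        \<le> supconv K e u (t0, x0) + supconv K e (\<lambda>w. - u w) (t0, y0) - \<Phi> t0 x0 y0"
    if "\<bar>t - t0\<bar> < d" "norm (x - x0) < d" "norm (y - y0) < d" for t x y
  proof -
    have "norm x \<le> norm x0 + norm (x - x0)" "norm y \<le> norm y0 + norm (y - y0)"
      by (rule norm_triangle_sub)+
    then have "norm x \<le> R" "norm y \<le> R" "\<tau> \<le> t" "t \<le> T"
      using that d ap0(1-3) tau t0T unfolding abs_less_iff by linarith+
    then have "(t, x, y) \<in> D" by (auto simp: D_def)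
    from z0(2)[OF this] show ?thesis by (simp add: \<Psi>_def F_def H_def zz)
  qed
  have Phi0: "\<Phi> t0 x y = c1 * (norm (x - y))\<^sup>2 + \<nu> * (norm x)\<^sup>2 + (E t0 * m / 2 + \<theta> / t0)" for x y
    using m by (simp add: \<Phi>_def S_def c1_def field_simps)
  have der: "((\<lambda>t. \<Phi> t x0 y0) has_real_derivative (- k * E t0 * S x0 y0 - \<theta> / t0\<^sup>2)) (at t0)"
    unfolding \<Phi>_def E_def using t0
    by (auto intro!: derivative_eq_intros simp: power2_eq_square)
  have int: "w \<in> interior K" if "supconv_star K e u (t0, x0) w" for w
    using inV[OF star_close(2)[OF that in0(1)] ap0(2)] V(2) by auto
  have int': "w \<in> interior K" if "supconv_star K e (\<lambda>w. - u w) (t0, y0) w" for w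
    using inV[OF star_close(2)[OF that in0(2)] ap0(3)] V(2) by auto
  define p p' where "p = 2 *\<^sub>R (c1 *\<^sub>R (x0 - y0) + \<nu> *\<^sub>R x0)" and "p' = - (2 * c1) *\<^sub>R (x0 - y0)"
  obtain w w' a a' where ww: "supconv_star K e u (t0, x0) w" "supconv_star K e (\<lambda>w. - u w) (t0, y0) w'"
    and wp: "w - (t0, x0) = e *\<^sub>R (a, p)" and wp': "w' - (t0, y0) = e *\<^sub>R (a', p')"
    and aa: "a + a' = - k * E t0 * S x0 y0 - \<theta> / t0\<^sup>2"
    and sums: "\<forall>q q' \<gamma> \<gamma>'. \<gamma> > 0 \<longrightarrow> \<gamma>' > 0 \<longrightarrow> local_trace_ge T u w ((1/e) *\<^sub>R (w - (t0, x0))) q \<longrightarrow>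
      local_trace_ge T (\<lambda>w. - u w) w' ((1/e) *\<^sub>R (w' - (t0, y0))) q' \<longrightarrow>
      \<gamma>\<^sup>2 * q + \<gamma>'\<^sup>2 * q' \<le> 2 * real CARD('n) * (c1 * (\<gamma> - \<gamma>')\<^sup>2 + \<nu> * \<gamma>\<^sup>2)"
    unfolding p_def p'_def
    by (rule supconv_doubling[OF compK Kne contK contK' e d(1) max Phi0 c1(1) less_imp_le[OF nu(1)] der int int',
        where T = T])
  note st = stars[OF ww]
  have wV: "w \<in> V" "w' \<in> V" using inV[OF st(1) ap0(2)] inV[OF st(2) ap0(3)] .
  have hats: "(1/e) *\<^sub>R (w - (t0, x0)) = (a, p)" "(1/e) *\<^sub>R (w' - (t0, y0)) = (a', p')"
    using e by (simp_all add: wp wp')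
  define s \<xi> s' \<eta> where "s = fst w" and "\<xi> = snd w" and "s' = fst w'" and "\<eta> = snd w'"
  have sT: "s \<in> {0..T}" "s' \<in> {0..T}" using wV tau by (auto simp: s_def s'_def V_def mem_Times_iff)
  define f where "f = (\<lambda>c. - 2 * (a + p \<bullet> b \<xi> c + L s \<xi> c - lam * u w) / (\<Gamma> \<xi> c)\<^sup>2)"
  define g where "g = (\<lambda>c. 2 * (- a' + L s' \<eta> c - p' \<bullet> b \<eta> c - lam * u w') / (\<Gamma> \<eta> c)\<^sup>2)"
  have Gne: "\<Gamma> x c \<noteq> 0" if "c \<in> A" for x c using G[OF that, of x] by simp
  have "continuous_on A g"
  proof -
    have pair: "continuous_on A (\<lambda>c. (\<eta>, c))" "continuous_on A (\<lambda>c. (s', \<eta>, c))"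
      by (intro continuous_intros)+
    have "continuous_on A (\<lambda>c. \<Gamma> \<eta> c)"
      using continuous_on_compose2[OF contG pair(1)] by auto
    moreover have "continuous_on A (\<lambda>c. b \<eta> c)"
      using continuous_on_compose2[OF contb pair(1)] by auto
    moreover have "continuous_on A (\<lambda>c. L s' \<eta> c)"
    proof -
      have "(\<lambda>c. (s', \<eta>, c)) ` A \<subseteq> {0..T} \<times> UNIV \<times> A" using sT(2) by auto
      from continuous_on_compose2[OF contL pair(2) this] show ?thesis by simp
    qed
    moreover have "\<forall>c\<in>A. (\<Gamma> \<eta> c)\<^sup>2 \<noteq> 0" using Gne by simp
    ultimately show ?thesis unfolding g_def by (intro continuous_intros) auto
  qed
  \<comment> \<open>Since -u satisfies its inequality only for some control, its guaranteed trace
    bound is the minimum of \<open>g\<close>. The subsolution is tested with this same control, so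
    that the differences of coefficients below compare equal controls.\<close>
  then obtain c where c: "c \<in> A" "\<And>c'. c' \<in> A \<Longrightarrow> g c \<le> g c'"
    using continuous_attains_inf[OF A] by blast
  define G1 G2 where "G1 = \<Gamma> \<xi> c" and "G2 = \<Gamma> \<eta> c"
  have Gp: "G1 > 0" "G2 > 0" "G1 \<le> \<Lambda>" using G c(1) by (auto simp: G1_def G2_def)
  have Gf: "G1\<^sup>2 * f c = - 2 * (a + p \<bullet> b \<xi> c + L s \<xi> c - lam * u w)"
    and Gg: "\<And>c'. c' \<in> A \<Longrightarrow> (\<Gamma> \<eta> c')\<^sup>2 * g c' = 2 * (- a' + L s' \<eta> c' - p' \<bullet> b \<eta> c' - lam * u w')"
    using Gne c(1) by (simp_all add: f_def g_def G1_def)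
  have Vt: "fst ` V \<subseteq> {0..T}" and contuV: "continuous_on V u"
    using tau by (auto simp: V_def intro: continuous_on_subset[OF contu])
  have approx: "G1\<^sup>2 * (f c - \<epsilon>) + G2\<^sup>2 * (g c - \<epsilon>) \<le> 2 * n * (c1 * (G1 - G2)\<^sup>2 + \<nu> * G1\<^sup>2)"
    if eps: "\<epsilon> > 0" for \<epsilon>
    unfolding n_def
  proof (rule sums[rule_format, OF Gp(1,2)])
    show "local_trace_ge T u w ((1/e) *\<^sub>R (w - (t0, x0))) (f c - \<epsilon>)"
      unfolding hats
    proof (rule local_trace_bound[where A = "{c}" and V = V and u = u and \<Gamma> = \<Gamma> and b = b and L = L
          and lam = lam and \<sigma> = "-1"])
      show "continuous_on (UNIV \<times> {c}) (\<lambda>(x, c). \<Gamma> x c)" "continuous_on (UNIV \<times> {c}) (\<lambda>(x, c). b x c)"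
        "continuous_on (fst ` V \<times> UNIV \<times> {c}) (\<lambda>(t, x, c). L t x c)"
        using c(1) Vt by (auto intro: continuous_on_subset[OF contG] continuous_on_subset[OF contb]
            continuous_on_subset[OF contL])
      fix c' assume "c' \<in> {c}"
      then have c': "c' = c" by simp
      have "G1\<^sup>2 / 2 * (f c - \<epsilon>) = (G1\<^sup>2 * f c) / 2 - G1\<^sup>2 * \<epsilon> / 2" by (simp add: field_simps)
      then have eq: "G1\<^sup>2 / 2 * (f c - \<epsilon>)
          = - (a + p \<bullet> b \<xi> c + L s \<xi> c - lam * u w) - G1\<^sup>2 * \<epsilon> / 2"
        unfolding Gf by (simp only: minus_mult_left[symmetric] divide_minus_left nonzero_mult_div_cancel_left
            zero_neq_numeral not_False_eq_True mult_minus_left)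
      have "G1\<^sup>2 * \<epsilon> > 0" using Gp(1) eps by simp
      then have "0 < - a - G1\<^sup>2 / 2 * (f c - \<epsilon>) + - 1 * (L s \<xi> c - lam * u w) - p \<bullet> b \<xi> c"
        unfolding eq by (simp add: algebra_simps)
      then show "0 < - a - (\<Gamma> (snd w) c')\<^sup>2 / 2 * (f c - \<epsilon>) + - 1 * (L (fst w) (snd w) c' - lam * u w)
          - p \<bullet> b (snd w) c'"
        by (simp only: c' G1_def \<xi>_def s_def)
    next
      fix t x a2 p2 X assume "(t, x) \<in> V" "(a2, p2, X) \<in> P2plus T u (t, x)"
      then show "\<exists>c\<in>{c}. - a2 - (\<Gamma> x c)\<^sup>2 / 2 * trace X + - 1 * (L t x c - lam * u (t, x)) - p2 \<bullet> b x c \<le> 0"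
        using sub[of t a2 p2 X x c] c(1) tau by (simp add: V_def)
    qed (use V wV c(1) G contuV in auto)
    show "local_trace_ge T (\<lambda>w. - u w) w' ((1/e) *\<^sub>R (w' - (t0, y0))) (g c - \<epsilon>)"
      unfolding hats
    proof (rule local_trace_bound[where A = A and V = V and u = u and \<Gamma> = \<Gamma> and b = b and L = L
          and lam = lam and \<sigma> = 1])
      show "continuous_on (fst ` V \<times> UNIV \<times> A) (\<lambda>(t, x, c). L t x c)"
        using Vt by (auto intro: continuous_on_subset[OF contL])
      fix c' assume c': "c' \<in> A"
      have "(\<Gamma> \<eta> c')\<^sup>2 * (g c - \<epsilon>) < (\<Gamma> \<eta> c')\<^sup>2 * g c'"
        using c(2)[OF c'] G[OF c', of \<eta>] eps by (intro mult_strict_left_mono) auto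
      then have "0 < - a' - (\<Gamma> \<eta> c')\<^sup>2 / 2 * (g c - \<epsilon>) + 1 * (L s' \<eta> c' - lam * u w') - p' \<bullet> b \<eta> c'"
        unfolding Gg[OF c'] by simp
      then show "0 < - a' - (\<Gamma> (snd w') c')\<^sup>2 / 2 * (g c - \<epsilon>) + 1 * (L (fst w') (snd w') c' - lam * u w')
          - p' \<bullet> b (snd w') c'"
        by (simp only: \<eta>_def s'_def)
    next
      fix t x a2 p2 X assume "(t, x) \<in> V" "(a2, p2, X) \<in> P2plus T (\<lambda>w. - u w) (t, x)"
      then show "\<exists>c\<in>A. - a2 - (\<Gamma> x c)\<^sup>2 / 2 * trace X + 1 * (L t x c - lam * u (t, x)) - p2 \<bullet> b x c \<le> 0"
        using super[of t a2 p2 X x] tau by (auto simp: V_def algebra_simps)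
    qed (use V wV A G contG contb contuV in auto)
  qed
  have "G1\<^sup>2 * f c + G2\<^sup>2 * g c \<le> 2 * n * (c1 * (G1 - G2)\<^sup>2 + \<nu> * G1\<^sup>2)"
  proof (rule field_le_epsilon)
    fix \<epsilon> :: real assume "\<epsilon> > 0"
    define q where "q = G1\<^sup>2 + G2\<^sup>2"
    have q: "q > 0" using Gp by (simp add: q_def add_pos_pos)
    have "G1\<^sup>2 * (f c - \<epsilon> / q) + G2\<^sup>2 * (g c - \<epsilon> / q) = G1\<^sup>2 * f c + G2\<^sup>2 * g c - q * (\<epsilon> / q)"
      unfolding q_def by (simp only: right_diff_distrib distrib_right)
    moreover have "q * (\<epsilon> / q) = \<epsilon>" using q by simp
    ultimately show "G1\<^sup>2 * f c + G2\<^sup>2 * g c \<le> 2 * n * (c1 * (G1 - G2)\<^sup>2 + \<nu> * G1\<^sup>2) + \<epsilon>"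
      using approx[of "\<epsilon> / q"] \<open>\<epsilon> > 0\<close> q by simp
  qed
  then have main: "- (a + a') \<le> (p \<bullet> b \<xi> c + p' \<bullet> b \<eta> c) + (L s \<xi> c - L s' \<eta> c)
      - lam * (u w - u w') + n * (c1 * (G1 - G2)\<^sup>2 + \<nu> * G1\<^sup>2)"
    unfolding Gf using Gg[OF c(1)] by (simp add: G2_def algebra_simps)
  define \<zeta> where "\<zeta> = norm (x0 - y0)"
  define Y where "Y = E t0 * S x0 y0"
  have zeta: "\<zeta> \<ge> 0" "\<zeta> \<le> Z" using ap0(4) by (auto simp: \<zeta>_def)
  have snd_le: "norm (\<xi> - x0) \<le> \<omega>" "norm (\<eta> - y0) \<le> \<omega>"
    using st(1,2) norm_snd_le[of "\<xi> - x0" "s - t0"] norm_snd_le[of "\<eta> - y0" "s' - t0"]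
    by (auto simp: \<xi>_def \<eta>_def s_def s'_def minus_prod_def)
  have dist: "norm (\<xi> - \<eta>) \<le> \<zeta> + 2 * \<omega>"
  proof -
    have "\<xi> - \<eta> = (\<xi> - x0) + (x0 - y0) - (\<eta> - y0)" by simp
    then show ?thesis
      using norm_triangle_ineq4[of "(\<xi> - x0) + (x0 - y0)" "\<eta> - y0"] norm_triangle_ineq[of "\<xi> - x0" "x0 - y0"] snd_le
      by (simp only: \<zeta>_def)
  qed
  have Y0: "Y \<ge> 0" using nonneg(1) by (simp add: Y_def)
  have c1Y: "c1 * \<zeta>\<^sup>2 \<le> Y"
  proof -
    have "E t0 * ((norm (x0 - y0))\<^sup>2 / (2 * m)) \<le> E t0 * S x0 y0"
      using E1(1)[OF t0(2)] S_ge(3)[of x0 y0] by (intro mult_left_mono) auto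
    then show ?thesis by (simp add: c1_def \<zeta>_def Y_def)
  qed
  have zY: "\<zeta> \<le> Y"
    using mult_mono[OF E1(1)[OF t0(2)] S_ge(1)[of x0 y0]] E1(1)[OF t0(2)] by (simp add: Y_def \<zeta>_def)
  \<comment> \<open>The squared Lipschitz bound of \<Gamma> meets the quadratic penalty, and
    \<open>c1 * \<zeta>\<^sup>2 \<le> Y\<close> absorbs it. The \<omega>-term comes from evaluating
    at \<open>\<xi>\<close> and \<open>\<eta>\<close> instead of \<open>x0\<close> and
    \<open>y0\<close>.\<close>
  have b1: "n * (c1 * (G1 - G2)\<^sup>2) \<le> n * lG\<^sup>2 * Y + n * cb * lG\<^sup>2 * (4 * Z + 4) * \<omega>"
  proof -
    have "\<bar>G1 - G2\<bar> \<le> lG * (\<zeta> + 2 * \<omega>)"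
      unfolding G1_def G2_def using lipG(1)[OF c(1), of \<xi> \<eta>] mult_left_mono[OF dist lipG(2)] by linarith
    then have "\<bar>G1 - G2\<bar>\<^sup>2 \<le> (lG * (\<zeta> + 2 * \<omega>))\<^sup>2" by (intro power_mono) auto
    then have "c1 * (G1 - G2)\<^sup>2 \<le> c1 * (lG\<^sup>2 * (\<zeta> + 2 * \<omega>)\<^sup>2)"
      using c1(1) by (intro mult_left_mono) (simp_all add: power_mult_distrib)
    also have "(\<zeta> + 2 * \<omega>)\<^sup>2 \<le> \<zeta>\<^sup>2 + (4 * Z + 4) * \<omega>"
    proof -
      have "\<zeta> * \<omega> \<le> Z * \<omega>" "\<omega> * \<omega> \<le> 1 * \<omega>" using zeta om by (auto intro!: mult_right_mono)
      then show ?thesis by (simp add: power2_eq_square algebra_simps)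
    qed
    also have "c1 * (lG\<^sup>2 * (\<zeta>\<^sup>2 + (4 * Z + 4) * \<omega>)) = lG\<^sup>2 * (c1 * \<zeta>\<^sup>2) + c1 * (lG\<^sup>2 * (4 * Z + 4) * \<omega>)"
      by (simp add: algebra_simps)
    also have "\<dots> \<le> lG\<^sup>2 * Y + cb * (lG\<^sup>2 * (4 * Z + 4) * \<omega>)"
      using c1Y c1(2) Z om(1) by (intro add_mono mult_left_mono mult_right_mono) auto
    finally have "c1 * (G1 - G2)\<^sup>2 \<le> lG\<^sup>2 * Y + cb * (lG\<^sup>2 * (4 * Z + 4) * \<omega>)"
      using c1(1) by (simp add: mult_left_mono)
    then have "n * (c1 * (G1 - G2)\<^sup>2) \<le> n * (lG\<^sup>2 * Y + cb * (lG\<^sup>2 * (4 * Z + 4) * \<omega>))"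
      by (intro mult_left_mono) (simp_all add: n_def)
    then show ?thesis by (simp add: algebra_simps)
  qed
  have b2: "p \<bullet> b \<xi> c + p' \<bullet> b \<eta> c \<le> 2 * lb * Y + 4 * cb * Z * lb * \<omega> + 2 * M * sqrt (2 * B * \<nu>)"
  proof -
    have eq: "p \<bullet> b \<xi> c + p' \<bullet> b \<eta> c = 2 * c1 * ((x0 - y0) \<bullet> (b \<xi> c - b \<eta> c)) + 2 * (\<nu> * (x0 \<bullet> b \<xi> c))"
      by (simp add: p_def p'_def inner_add_left inner_diff_left inner_diff_right algebra_simps)
    have "(x0 - y0) \<bullet> (b \<xi> c - b \<eta> c) \<le> \<zeta> * norm (b \<xi> c - b \<eta> c)"
      unfolding \<zeta>_def by (rule norm_cauchy_schwarz)
    also have "norm (b \<xi> c - b \<eta> c) \<le> lb * (\<zeta> + 2 * \<omega>)"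
      using lipb(1)[OF c(1), of \<xi> \<eta>] mult_left_mono[OF dist lipb(2)] by linarith
    finally have "(x0 - y0) \<bullet> (b \<xi> c - b \<eta> c) \<le> \<zeta> * (lb * (\<zeta> + 2 * \<omega>))"
      using zeta(1) by (simp add: mult_left_mono)
    then have "2 * c1 * ((x0 - y0) \<bullet> (b \<xi> c - b \<eta> c)) \<le> 2 * c1 * (\<zeta> * (lb * (\<zeta> + 2 * \<omega>)))"
      using c1(1) by (intro mult_left_mono) auto
    also have "\<dots> = 2 * lb * (c1 * \<zeta>\<^sup>2) + 4 * (c1 * \<zeta>) * (lb * \<omega>)"
      by (simp add: power2_eq_square algebra_simps)
    also have "\<dots> \<le> 2 * lb * Y + 4 * (cb * Z) * (lb * \<omega>)"
      using c1Y c1 cb zeta lipb(2) om(1)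
      by (intro add_mono mult_left_mono mult_right_mono mult_mono) auto
    finally have 1: "2 * c1 * ((x0 - y0) \<bullet> (b \<xi> c - b \<eta> c)) \<le> 2 * lb * Y + 4 * (cb * Z) * (lb * \<omega>)" .
    have "x0 \<bullet> b \<xi> c \<le> norm x0 * M"
      using norm_cauchy_schwarz[of x0 "b \<xi> c"] mult_left_mono[OF b[OF c(1), of \<xi>], of "norm x0"] by simp
    then have "\<nu> * (x0 \<bullet> b \<xi> c) \<le> \<nu> * (norm x0 * M)" using nu(1) by (intro mult_left_mono) auto
    also have "\<dots> = M * (\<nu> * norm x0)" by simp
    also have "\<dots> \<le> M * sqrt (2 * B * \<nu>)"
      using ap0(5) order_trans[OF norm_ge_zero b[OF c(1), of \<xi>]] by (rule mult_left_mono)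
    finally show ?thesis unfolding eq using 1 by (simp add: algebra_simps)
  qed
  have b3: "L s \<xi> c - L s' \<eta> c \<le> 2 * h0 + lL * Y"
  proof -
    have w: "w = (s, \<xi>)" "w' = (s', \<eta>)" by (auto simp: s_def \<xi>_def s'_def \<eta>_def)
    have "\<bar>L s \<xi> c - L t0 x0 c\<bar> < h0" "\<bar>L s' \<eta> c - L t0 y0 c\<bar> < h0"
      using om(3) st(1-4) in0 c(1) unfolding w by (auto intro!: om2(2))
    moreover have "\<bar>L t0 x0 c - L t0 y0 c\<bar> \<le> lL * \<zeta>"
      unfolding \<zeta>_def by (rule lipL(1)[OF t0(2) c(1)])
    moreover have "lL * \<zeta> \<le> lL * Y" using zY lipL(2) by (rule mult_left_mono)
    ultimately show ?thesis unfolding abs_less_iff abs_le_iff by linarith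
  qed
  have b4: "n * (\<nu> * G1\<^sup>2) \<le> \<nu> * n * \<Lambda>\<^sup>2"
  proof -
    have "n * \<nu> * G1\<^sup>2 \<le> n * \<nu> * \<Lambda>\<^sup>2"
      using Gp nu(1) by (intro mult_left_mono power_mono) (auto simp: n_def)
    then show ?thesis by (simp add: mult_ac)
  qed
  \<comment> \<open>Positivity at the maximum point gives the zeroth-order term its favourable
    sign.\<close>
  have "u w - u w' \<ge> 0"
    using st(5,6) Psi0 mu nonneg unfolding \<Phi>_def by linarith
  then have b5: "lam * (u w - u w') \<ge> 0" using lam by simp
  \<comment> \<open>By the choice of \<open>k\<close> all multiples of \<open>Y\<close> cancel. What
    is left is \<open>\<theta> / t0\<^sup>2\<close> against errors that stay below
    \<open>\<theta> / T\<^sup>2\<close>.\<close>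
  have "- (a + a') = 2 * lb * Y + n * lG\<^sup>2 * Y + lL * Y + \<theta> / t0\<^sup>2"
    unfolding aa k Y_def n_def by (simp add: algebra_simps)
  moreover have "n * (c1 * (G1 - G2)\<^sup>2 + \<nu> * G1\<^sup>2) = n * (c1 * (G1 - G2)\<^sup>2) + n * (\<nu> * G1\<^sup>2)"
    by (simp add: algebra_simps)
  moreover have "W * \<omega> = 4 * cb * Z * lb * \<omega> + n * cb * lG\<^sup>2 * (4 * Z + 4) * \<omega>"
    by (simp add: W_def algebra_simps)
  ultimately have "\<theta> / t0\<^sup>2 \<le> W * \<omega> + 2 * h0 + (\<nu> * n * \<Lambda>\<^sup>2 + 2 * M * sqrt (2 * B * \<nu>))"
    using main b1 b2 b3 b4 b5 by linarith
  also have "\<dots> < 3 * h0 + \<theta> / (2 * T\<^sup>2)" using omW nu(3) by linarith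
  also have "\<dots> < \<theta> / T\<^sup>2" using th T by (simp add: h0_def field_simps)
  also have "\<dots> \<le> \<theta> / t0\<^sup>2"
    using th t0 by (intro divide_left_mono power_mono) auto
  finally show False by simp
qed

section \<open>Lipschitz bounds for solutions\<close>

lemma lipschitz_if_doubling_bound:
  fixes u :: "real \<times> 'a::real_normed_vector \<Rightarrow> real"
  assumes C: "C \<ge> 0" and k: "k \<ge> 0"
    and bd: "\<And>t x y m \<theta>. t \<in> {0<..T} \<Longrightarrow> m > 0 \<Longrightarrow> \<theta> > 0 \<Longrightarrow>
      u (t, x) - u (t, y) \<le> C * exp (k * (T - t)) * ((norm (x - y))\<^sup>2 / m + m) / 2 + \<theta> / t"
    and t: "t \<in> {0<..T}"
  shows "(C * exp (k * T))-lipschitz_on UNIV (\<lambda>x. u (t, x))"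
proof -
  have le: "u (t, x) - u (t, y) \<le> C * exp (k * T) * norm (x - y)" for x y
  proof (cases "x = y")
    case False
    then have m: "norm (x - y) > 0" by simp
    have "u (t, x) - u (t, y) \<le> C * exp (k * (T - t)) * norm (x - y)"
    proof (rule field_le_epsilon)
      fix e :: real assume "e > 0"
      \<comment> \<open>Taking \<theta> = e t turns the barrier into the error
        \<open>e\<close>.\<close>
      then show "u (t, x) - u (t, y) \<le> C * exp (k * (T - t)) * norm (x - y) + e"
        using bd[OF t m, of "e * t" x y] t m by (simp add: power2_eq_square)
    qed
    also have "\<dots> \<le> C * exp (k * T) * norm (x - y)"
      using C k t by (intro mult_right_mono mult_left_mono) (auto simp: mult_left_mono)
    finally show ?thesis .
  qed simp
  show ?thesis
  proof (rule lipschitz_onI)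
    show "dist (u (t, x)) (u (t, y)) \<le> C * exp (k * T) * dist x y" for x y
      using le[of x y] le[of y x] by (simp add: dist_norm norm_minus_commute abs_le_iff)
  qed (use C in auto)
qed

section \<open>Infima over compact control sets\<close>

lemma continuous_INF_attained:
  fixes f :: "'a::topological_space \<Rightarrow> real"
  assumes "compact A" "A \<noteq> {}" "continuous_on A f"
  shows "\<exists>c\<in>A. (INF c\<in>A. f c) = f c" and "c \<in> A \<Longrightarrow> (INF c\<in>A. f c) \<le> f c"
proof -
  obtain v where v: "v \<in> A" "\<And>w. w \<in> A \<Longrightarrow> f v \<le> f w"
    using continuous_attains_inf[OF assms] by blast
  have eq: "(INF c\<in>A. f c) = f v"
    using v by (intro cInf_eq_minimum) auto
  show "\<exists>c\<in>A. (INF c\<in>A. f c) = f c" using eq v(1) by blast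
  show "c \<in> A \<Longrightarrow> (INF c\<in>A. f c) \<le> f c" using eq v(2) by simp
qed

text \<open>The two exponentials cancel on the term that is linear in \<open>p\<close>. Rescaling
  thus keeps the Bellman form and only multiplies the running cost by exp(-lam (T-t)), a factor at
  most 1 for lam >= 0 and t <= T, which does not increase its Lipschitz constant.\<close>

lemma rescaled_Ham1_attained:
  assumes "compact U" "U \<noteq> {}" "continuous_on (UNIV \<times> U) (\<lambda>(x, \<alpha>). b x \<alpha>)"
    and L: "continuous_on ({0..T} \<times> UNIV \<times> U) (\<lambda>(t, x, \<alpha>). L1 t x \<alpha>)" and t: "t \<in> {0..T}"
  shows "\<exists>\<alpha>\<in>U. rescaled_Ham T lam (Ham1 U b L1) t x p = p \<bullet> b x \<alpha> + exp (- lam * (T - t)) * L1 t x \<alpha>"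
    and "\<alpha> \<in> U \<Longrightarrow> rescaled_Ham T lam (Ham1 U b L1) t x p \<le> p \<bullet> b x \<alpha> + exp (- lam * (T - t)) * L1 t x \<alpha>"
proof -
  define \<delta> where "\<delta> = exp (lam * (T - t))"
  have d: "exp (- lam * (T - t)) * (\<delta> * y) = y" "\<delta> > 0" for y
    by (simp_all add: \<delta>_def mult.assoc[symmetric] exp_add[symmetric])
  have pair: "continuous_on U (\<lambda>\<alpha>. (x, \<alpha>))" "continuous_on U (\<lambda>\<alpha>. (t, x, \<alpha>))"
    by (intro continuous_intros)+
  have "continuous_on U (\<lambda>\<alpha>. b x \<alpha>)"
    using continuous_on_compose2[OF assms(3) pair(1)] by auto
  moreover have "(\<lambda>\<alpha>. (t, x, \<alpha>)) ` U \<subseteq> {0..T} \<times> UNIV \<times> U" using t by auto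
  from continuous_on_compose2[OF L pair(2) this] have "continuous_on U (\<lambda>\<alpha>. L1 t x \<alpha>)" by simp
  ultimately have "continuous_on U (\<lambda>\<alpha>. (\<delta> *\<^sub>R p) \<bullet> b x \<alpha> + L1 t x \<alpha>)"
    by (intro continuous_intros)
  note inf = continuous_INF_attained[OF assms(1,2) this]
  have eq: "rescaled_Ham T lam (Ham1 U b L1) t x p
      = exp (- lam * (T - t)) * (INF \<alpha>\<in>U. (\<delta> *\<^sub>R p) \<bullet> b x \<alpha> + L1 t x \<alpha>)"
    by (simp add: rescaled_Ham_def Ham1_def \<delta>_def)
  have scale: "exp (- lam * (T - t)) * ((\<delta> *\<^sub>R p) \<bullet> b x \<alpha> + L1 t x \<alpha>)
      = p \<bullet> b x \<alpha> + exp (- lam * (T - t)) * L1 t x \<alpha>" for \<alpha>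
    using d(1)[of "p \<bullet> b x \<alpha>"] by (simp only: inner_scaleR_left distrib_left)
  show "\<exists>\<alpha>\<in>U. rescaled_Ham T lam (Ham1 U b L1) t x p = p \<bullet> b x \<alpha> + exp (- lam * (T - t)) * L1 t x \<alpha>"
    using inf(1) unfolding eq scale[symmetric] by metis
  show "\<alpha> \<in> U \<Longrightarrow> rescaled_Ham T lam (Ham1 U b L1) t x p \<le> p \<bullet> b x \<alpha> + exp (- lam * (T - t)) * L1 t x \<alpha>"
    unfolding eq scale[symmetric] by (intro mult_left_mono inf(2)) auto
qed

lemma rescaled_Ham2_attained:
  assumes "compact S" "S \<noteq> {}" "continuous_on (UNIV \<times> S) (\<lambda>(x, \<sigma>). \<Gamma> x \<sigma>)"
    and L: "continuous_on ({0..T} \<times> UNIV \<times> S) (\<lambda>(t, x, \<sigma>). L2 t x \<sigma>)" and t: "t \<in> {0..T}"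
  shows "\<exists>\<sigma>\<in>S. rescaled_Ham T lam (Ham2 S \<Gamma> L2) t x q
      = (\<Gamma> x \<sigma>)\<^sup>2 / 2 * q + exp (- lam * (T - t)) * L2 t x \<sigma>"
    and "\<sigma> \<in> S \<Longrightarrow> rescaled_Ham T lam (Ham2 S \<Gamma> L2) t x q
      \<le> (\<Gamma> x \<sigma>)\<^sup>2 / 2 * q + exp (- lam * (T - t)) * L2 t x \<sigma>"
proof -
  define \<delta> where "\<delta> = exp (lam * (T - t))"
  have d: "exp (- lam * (T - t)) * \<delta> = 1"
    by (simp add: \<delta>_def exp_add[symmetric])
  have pair: "continuous_on S (\<lambda>\<sigma>. (x, \<sigma>))" "continuous_on S (\<lambda>\<sigma>. (t, x, \<sigma>))"
    by (intro continuous_intros)+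
  have "continuous_on S (\<lambda>\<sigma>. \<Gamma> x \<sigma>)"
    using continuous_on_compose2[OF assms(3) pair(1)] by auto
  moreover have "(\<lambda>\<sigma>. (t, x, \<sigma>)) ` S \<subseteq> {0..T} \<times> UNIV \<times> S" using t by auto
  from continuous_on_compose2[OF L pair(2) this] have "continuous_on S (\<lambda>\<sigma>. L2 t x \<sigma>)" by simp
  ultimately have "continuous_on S (\<lambda>\<sigma>. (\<Gamma> x \<sigma>)\<^sup>2 / 2 * (\<delta> * q) + L2 t x \<sigma>)"
    by (intro continuous_intros) auto
  note inf = continuous_INF_attained[OF assms(1,2) this]
  have eq: "rescaled_Ham T lam (Ham2 S \<Gamma> L2) t x q
      = exp (- lam * (T - t)) * (INF \<sigma>\<in>S. (\<Gamma> x \<sigma>)\<^sup>2 / 2 * (\<delta> * q) + L2 t x \<sigma>)"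
    by (simp add: rescaled_Ham_def Ham2_def \<delta>_def)
  have scale: "exp (- lam * (T - t)) * ((\<Gamma> x \<sigma>)\<^sup>2 / 2 * (\<delta> * q) + L2 t x \<sigma>)
      = (\<Gamma> x \<sigma>)\<^sup>2 / 2 * q + exp (- lam * (T - t)) * L2 t x \<sigma>" for \<sigma>
  proof -
    have "exp (- lam * (T - t)) * ((\<Gamma> x \<sigma>)\<^sup>2 / 2 * (\<delta> * q))
        = (exp (- lam * (T - t)) * \<delta>) * ((\<Gamma> x \<sigma>)\<^sup>2 / 2 * q)"
      by (simp only: mult_ac)
    then show ?thesis unfolding d distrib_left by simp
  qed
  show "\<exists>\<sigma>\<in>S. rescaled_Ham T lam (Ham2 S \<Gamma> L2) t x q
      = (\<Gamma> x \<sigma>)\<^sup>2 / 2 * q + exp (- lam * (T - t)) * L2 t x \<sigma>"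
    using inf(1) unfolding eq scale[symmetric] by metis
  show "\<sigma> \<in> S \<Longrightarrow> rescaled_Ham T lam (Ham2 S \<Gamma> L2) t x q
      \<le> (\<Gamma> x \<sigma>)\<^sup>2 / 2 * q + exp (- lam * (T - t)) * L2 t x \<sigma>"
    unfolding eq scale[symmetric] by (intro mult_left_mono inf(2)) auto
qed

text \<open>The two infima become one over pairs of controls: a subsolution satisfies the linear
  inequality for every pair, a supersolution for the pair at which both infima are attained.
  Allowing lam = 0 covers the second equation too.\<close>

lemma rescaled_visc_solution_lipschitz:
  fixes T M lam1 lam2 lam :: real
    and U :: "(real^'n) set" and S :: "real set"
    and b :: "real^'n \<Rightarrow> real^'n \<Rightarrow> real^'n"
    and \<Gamma> :: "real^'n \<Rightarrow> real \<Rightarrow> real"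
    and L1 :: "real \<Rightarrow> real^'n \<Rightarrow> real^'n \<Rightarrow> real"
    and L2 :: "real \<Rightarrow> real^'n \<Rightarrow> real \<Rightarrow> real"
    and G :: "real^'n \<Rightarrow> real"
  assumes T: "T > 0"
    and U: "compact U" "U \<noteq> {}" and S: "compact S" "S \<noteq> {}"
    and contb: "continuous_on (UNIV \<times> U) (\<lambda>(x, \<alpha>). b x \<alpha>)"
    and contG: "continuous_on (UNIV \<times> S) (\<lambda>(x, \<sigma>). \<Gamma> x \<sigma>)"
    and b: "\<And>x \<alpha>. \<alpha> \<in> U \<Longrightarrow> norm (b x \<alpha>) \<le> M"
    and lam12: "0 < lam1"
    and \<Gamma>: "\<And>x \<sigma>. \<sigma> \<in> S \<Longrightarrow> lam1 < \<Gamma> x \<sigma> \<and> \<Gamma> x \<sigma> < lam2"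
    and contL1: "continuous_on ({0..T} \<times> UNIV \<times> U) (\<lambda>(t, x, \<alpha>). L1 t x \<alpha>)"
    and contL2: "continuous_on ({0..T} \<times> UNIV \<times> S) (\<lambda>(t, x, \<sigma>). L2 t x \<sigma>)"
    and lipL1: "\<exists>C. \<forall>t\<in>{0..T}. \<forall>\<alpha>\<in>U. C-lipschitz_on UNIV (\<lambda>x. L1 t x \<alpha>)"
    and lipL2: "\<exists>C. \<forall>t\<in>{0..T}. \<forall>\<sigma>\<in>S. C-lipschitz_on UNIV (\<lambda>x. L2 t x \<sigma>)"
    and lipb: "\<exists>C. \<forall>\<alpha>\<in>U. C-lipschitz_on UNIV (\<lambda>x. b x \<alpha>)"
    and lipG: "\<exists>C. \<forall>\<sigma>\<in>S. C-lipschitz_on UNIV (\<lambda>x. \<Gamma> x \<sigma>)"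
    and G: "\<exists>C. C-lipschitz_on UNIV G"
    and lam: "lam \<ge> 0"
    and sol: "visc_solution T lam (rescaled_Ham T lam (Ham2 S \<Gamma> L2)) (rescaled_Ham T lam (Ham1 U b L1)) G u"
  shows "\<exists>C. \<forall>t\<in>{0<..T}. C-lipschitz_on UNIV (\<lambda>x. u (t, x))"
proof -
  define A where "A = S \<times> U"
  define \<Gamma>' :: "real^'n \<Rightarrow> real \<times> (real^'n) \<Rightarrow> real" where "\<Gamma>' = (\<lambda>x c. \<Gamma> x (fst c))"
  define b' :: "real^'n \<Rightarrow> real \<times> (real^'n) \<Rightarrow> real^'n" where "b' = (\<lambda>x c. b x (snd c))"
  define L' where "L' = (\<lambda>t x c. exp (- lam * (T - t)) * (L2 t x (fst c) + L1 t x (snd c)))"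
  have A: "compact A" "A \<noteq> {}" using U S by (auto simp: A_def intro: compact_Times)
  have Ac: "fst c \<in> S" "snd c \<in> U" if "c \<in> A" for c using that by (auto simp: A_def)
  obtain l1 where l1: "\<And>t \<alpha>. t \<in> {0..T} \<Longrightarrow> \<alpha> \<in> U \<Longrightarrow> l1-lipschitz_on UNIV (\<lambda>x. L1 t x \<alpha>)"
    using lipL1 by blast
  obtain l2 where l2: "\<And>t \<sigma>. t \<in> {0..T} \<Longrightarrow> \<sigma> \<in> S \<Longrightarrow> l2-lipschitz_on UNIV (\<lambda>x. L2 t x \<sigma>)"
    using lipL2 by blast
  obtain lb where lb: "\<And>\<alpha>. \<alpha> \<in> U \<Longrightarrow> lb-lipschitz_on UNIV (\<lambda>x. b x \<alpha>)"
    using lipb by blast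
  obtain lG where lG: "\<And>\<sigma>. \<sigma> \<in> S \<Longrightarrow> lG-lipschitz_on UNIV (\<lambda>x. \<Gamma> x \<sigma>)"
    using lipG by blast
  obtain g where g: "g-lipschitz_on UNIV G" using G by blast
  obtain \<sigma>0 \<alpha>0 where "\<sigma>0 \<in> S" "\<alpha>0 \<in> U" using U S by blast
  then have nonneg: "l1 \<ge> 0" "l2 \<ge> 0" "lb \<ge> 0" "lG \<ge> 0"
    using lipschitz_on_nonneg[OF l1[of 0 \<alpha>0]] lipschitz_on_nonneg[OF l2[of 0 \<sigma>0]]
      lipschitz_on_nonneg[OF lb] lipschitz_on_nonneg[OF lG] T by auto
  have sub: "visc_subsolution T lam (rescaled_Ham T lam (Ham2 S \<Gamma> L2)) (rescaled_Ham T lam (Ham1 U b L1)) G u"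
    and super: "visc_supersolution T lam (rescaled_Ham T lam (Ham2 S \<Gamma> L2)) (rescaled_Ham T lam (Ham1 U b L1)) G u"
    and contu: "continuous_on ({0<..T} \<times> UNIV) u" and bdd: "bounded (u ` ({0<..T} \<times> UNIV))"
    using sol by (auto simp: visc_solution_def)
  obtain B where B: "B > 0" "\<And>t x. t \<in> {0<..T} \<Longrightarrow> \<bar>u (t, x)\<bar> \<le> B"
    using bdd unfolding bounded_pos by force
  have uT: "u (T, x) = G x" for x
    using sub super by (auto simp: visc_subsolution_def visc_supersolution_def intro: antisym)
  define C k where "C = max 1 g" and "k = 2 * lb + real CARD('n) * lG\<^sup>2 + (l1 + l2)"
  have main: "u (t1, x1) - u (t1, y1) \<le> C * exp (k * (T - t1)) * ((norm (x1 - y1))\<^sup>2 / m + m) / 2 + \<theta> / t1"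
    if m: "m > 0" and th: "\<theta> > 0" and t1: "t1 \<in> {0<..T}" for t1 x1 y1 m \<theta>
  proof (rule bellman_doubling_bound[where A = A and \<Gamma> = \<Gamma>' and b = b' and L = L' and M = M and \<Lambda> = lam2
        and lG = lG and lb = lb and lL = "l1 + l2" and lam = lam and B = B])
    show "continuous_on (UNIV \<times> A) (\<lambda>(x, c). \<Gamma>' x c)"
      unfolding \<Gamma>'_def split_beta
      by (rule continuous_on_compose2[OF contG[unfolded split_beta], of _ "\<lambda>z. (fst z, fst (snd z))", simplified])
        (auto intro!: continuous_intros simp: A_def)
    show "continuous_on (UNIV \<times> A) (\<lambda>(x, c). b' x c)"
      unfolding b'_def split_beta
      by (rule continuous_on_compose2[OF contb[unfolded split_beta], of _ "\<lambda>z. (fst z, snd (snd z))", simplified])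
        (auto intro!: continuous_intros simp: A_def)
    show "continuous_on ({0..T} \<times> UNIV \<times> A) (\<lambda>(t, x, c). L' t x c)"
      unfolding L'_def split_beta
      by (intro continuous_intros
          continuous_on_compose2[OF contL2[unfolded split_beta], of _ "\<lambda>z. (fst z, fst (snd z), fst (snd (snd z)))", simplified]
          continuous_on_compose2[OF contL1[unfolded split_beta], of _ "\<lambda>z. (fst z, fst (snd z), snd (snd (snd z)))", simplified])
        (auto simp: A_def)
    show "0 < \<Gamma>' x c \<and> \<Gamma>' x c \<le> lam2" if "c \<in> A" for x c
      using \<Gamma>[OF Ac(1)[OF that], of x] lam12 by (simp add: \<Gamma>'_def)
    show "norm (b' x c) \<le> M" if "c \<in> A" for x c
      using b[OF Ac(2)[OF that]] by (simp add: b'_def)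
    show "\<bar>\<Gamma>' x c - \<Gamma>' y c\<bar> \<le> lG * norm (x - y)" if "c \<in> A" for x y c
      using lipschitz_onD[OF lG[OF Ac(1)[OF that]], of x y] by (simp add: \<Gamma>'_def dist_norm)
    show "norm (b' x c - b' y c) \<le> lb * norm (x - y)" if "c \<in> A" for x y c
      using lipschitz_onD[OF lb[OF Ac(2)[OF that]], of x y] by (simp add: b'_def dist_norm)
    show "\<bar>L' t x c - L' t y c\<bar> \<le> (l1 + l2) * norm (x - y)" if t: "t \<in> {0..T}" and c: "c \<in> A" for t x y c
    proof -
      have "\<bar>L2 t x (fst c) - L2 t y (fst c)\<bar> \<le> l2 * norm (x - y)" "\<bar>L1 t x (snd c) - L1 t y (snd c)\<bar> \<le> l1 * norm (x - y)"
        using lipschitz_onD[OF l2[OF t Ac(1)[OF c]], of x y] lipschitz_onD[OF l1[OF t Ac(2)[OF c]], of x y]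
        by (simp_all add: dist_norm)
      then have "\<bar>(L2 t x (fst c) + L1 t x (snd c)) - (L2 t y (fst c) + L1 t y (snd c))\<bar> \<le> (l1 + l2) * norm (x - y)"
        by (simp add: distrib_right)
      moreover have "exp (- lam * (T - t)) \<le> 1" using lam t by simp
      ultimately have "exp (- lam * (T - t)) * \<bar>(L2 t x (fst c) + L1 t x (snd c)) - (L2 t y (fst c) + L1 t y (snd c))\<bar>
          \<le> 1 * ((l1 + l2) * norm (x - y))"
        by (intro mult_mono) auto
      then show ?thesis
        unfolding L'_def right_diff_distrib[symmetric] abs_mult by simp
    qed
    show "- a - (\<Gamma>' x c)\<^sup>2 / 2 * trace X - L' t x c - p \<bullet> b' x c + lam * u (t, x) \<le> 0"
      if t: "t \<in> {0<..<T}" and P: "(a, p, X) \<in> P2plus T u (t, x)" and c: "c \<in> A" for t x a p X c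
    proof -
      have t': "t \<in> {0..T}" using t by simp
      have "- a - rescaled_Ham T lam (Ham2 S \<Gamma> L2) t x (trace X) - rescaled_Ham T lam (Ham1 U b L1) t x p
          + lam * u (t, x) \<le> 0"
        using sub t P unfolding visc_subsolution_def by blast
      then show ?thesis
        using rescaled_Ham2_attained(2)[OF S contG contL2 t' Ac(1)[OF c], of lam x "trace X"]
          rescaled_Ham1_attained(2)[OF U contb contL1 t' Ac(2)[OF c], of lam x p]
        by (simp add: \<Gamma>'_def b'_def L'_def distrib_left)
    qed
    show "\<exists>c\<in>A. - a - (\<Gamma>' x c)\<^sup>2 / 2 * trace X + L' t x c - p \<bullet> b' x c - lam * u (t, x) \<le> 0"
      if t: "t \<in> {0<..<T}" and P: "(a, p, X) \<in> P2plus T (\<lambda>w. - u w) (t, x)" for t x a p X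
    proof -
      have t': "t \<in> {0..T}" using t by simp
      \<comment> \<open>The doubling estimate speaks of superjets of -u, the definition of
        supersolutions of subjets of \<open>u\<close>; all three entries change sign.\<close>
      have "(- a, - p, - X) \<in> P2minus T u (t, x)"
        unfolding P2minus_def by (rule image_eqI[OF _ P]) simp
      then have ineq: "- (- a) - rescaled_Ham T lam (Ham2 S \<Gamma> L2) t x (trace (- X))
          - rescaled_Ham T lam (Ham1 U b L1) t x (- p) + lam * u (t, x) \<ge> 0"
        using super t unfolding visc_supersolution_def by blast
      obtain \<sigma> where \<sigma>: "\<sigma> \<in> S" "rescaled_Ham T lam (Ham2 S \<Gamma> L2) t x (trace (- X))
          = (\<Gamma> x \<sigma>)\<^sup>2 / 2 * trace (- X) + exp (- lam * (T - t)) * L2 t x \<sigma>"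
        using rescaled_Ham2_attained(1)[OF S contG contL2 t'] by blast
      obtain \<alpha> where \<alpha>: "\<alpha> \<in> U" "rescaled_Ham T lam (Ham1 U b L1) t x (- p)
          = (- p) \<bullet> b x \<alpha> + exp (- lam * (T - t)) * L1 t x \<alpha>"
        using rescaled_Ham1_attained(1)[OF U contb contL1 t'] by blast
      have "trace (- X) = - trace X" by (simp add: trace_def sum_negf)
      then have "- a - (\<Gamma>' x (\<sigma>, \<alpha>))\<^sup>2 / 2 * trace X + L' t x (\<sigma>, \<alpha>) - p \<bullet> b' x (\<sigma>, \<alpha>) - lam * u (t, x) \<le> 0"
        using ineq unfolding \<sigma>(2) \<alpha>(2) by (simp add: \<Gamma>'_def b'_def L'_def distrib_left)
      then show ?thesis using \<sigma>(1) \<alpha>(1) unfolding A_def by blast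
    qed
    show "u (T, x) - u (T, y) \<le> C * norm (x - y)" for x y
    proof -
      have "G x - G y \<le> g * norm (x - y)" using lipschitz_onD[OF g, of x y] by (simp add: dist_norm)
      also have "\<dots> \<le> C * norm (x - y)" unfolding C_def by (intro mult_right_mono) auto
      finally show ?thesis by (simp add: uT)
    qed
  qed (use T lam A contu B nonneg m th t1 in \<open>simp_all add: C_def k_def\<close>)
  have "C \<ge> 0" "k \<ge> 0" using nonneg by (auto simp: C_def k_def)
  from lipschitz_if_doubling_bound[OF this main] show ?thesis by blast
qed

lemma rescaled_Ham_0: "rescaled_Ham T 0 H = H"
  by (simp add: rescaled_Ham_def fun_eq_iff)

text \<open>Both claims are instances of one estimate, lam > 0 and lam = 0; at lam = 0 the rescaling
  is the identity, so no change of unknown between the two equations is made.\<close>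

theorem theorem3p6:
  fixes T M lam1 lam2 :: real
    and U :: "(real^'n) set" and S :: "real set"
    and b :: "real^'n \<Rightarrow> real^'n \<Rightarrow> real^'n"
    and \<Gamma> :: "real^'n \<Rightarrow> real \<Rightarrow> real"
    and L1 :: "real \<Rightarrow> real^'n \<Rightarrow> real^'n \<Rightarrow> real"
    and L2 :: "real \<Rightarrow> real^'n \<Rightarrow> real \<Rightarrow> real"
    and G :: "real^'n \<Rightarrow> real"
  assumes "T > 0"
    and "compact U" "U \<noteq> {}" and "compact S" "S \<noteq> {}"
    and "continuous_on (UNIV \<times> U) (\<lambda>(x, \<alpha>). b x \<alpha>)"
    and "continuous_on (UNIV \<times> S) (\<lambda>(x, \<sigma>). \<Gamma> x \<sigma>)"
    and "M > 0" and "\<And>x \<alpha>. \<alpha> \<in> U \<Longrightarrow> norm (b x \<alpha>) \<le> M"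
    and "0 < lam1" "lam1 < lam2"
    and "\<And>x \<sigma>. \<sigma> \<in> S \<Longrightarrow> lam1 < \<Gamma> x \<sigma> \<and> \<Gamma> x \<sigma> < lam2"
    and "continuous_on ({0..T} \<times> UNIV \<times> U) (\<lambda>(t, x, \<alpha>). L1 t x \<alpha>)"
    and "continuous_on ({0..T} \<times> UNIV \<times> S) (\<lambda>(t, x, \<sigma>). L2 t x \<sigma>)"
    and "\<exists>C. \<forall>t\<in>{0..T}. \<forall>\<alpha>\<in>U. C-lipschitz_on UNIV (\<lambda>x. L1 t x \<alpha>)"
    and "\<exists>C. \<forall>t\<in>{0..T}. \<forall>\<sigma>\<in>S. C-lipschitz_on UNIV (\<lambda>x. L2 t x \<sigma>)"
    and "\<exists>C. \<forall>\<alpha>\<in>U. C-lipschitz_on UNIV (\<lambda>x. b x \<alpha>)"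
    and "\<exists>C. \<forall>\<sigma>\<in>S. C-lipschitz_on UNIV (\<lambda>x. \<Gamma> x \<sigma>)"
    and "\<exists>C. C-lipschitz_on UNIV G"
  shows "(\<forall>lam>0. \<forall>u. visc_solution T lam (rescaled_Ham T lam (Ham2 S \<Gamma> L2))
              (rescaled_Ham T lam (Ham1 U b L1)) G u
            \<longrightarrow> (\<exists>C. \<forall>t\<in>{0<..T}. C-lipschitz_on UNIV (\<lambda>x. u (t, x))))
       \<and> (\<forall>u. visc_solution T 0 (Ham2 S \<Gamma> L2) (Ham1 U b L1) G u
            \<longrightarrow> (\<exists>C. \<forall>t\<in>{0<..T}. C-lipschitz_on UNIV (\<lambda>x. u (t, x))))"
proof (intro conjI allI impI)
  fix lam :: real and u
  assume "lam > 0" and "visc_solution T lam (rescaled_Ham T lam (Ham2 S \<Gamma> L2)) (rescaled_Ham T lam (Ham1 U b L1)) G u"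
  then show "\<exists>C. \<forall>t\<in>{0<..T}. C-lipschitz_on UNIV (\<lambda>x. u (t, x))"
    by (intro rescaled_visc_solution_lipschitz[OF assms(1-7,9,10,12-19)]) auto
next
  fix u
  assume "visc_solution T 0 (Ham2 S \<Gamma> L2) (Ham1 U b L1) G u"
  then show "\<exists>C. \<forall>t\<in>{0<..T}. C-lipschitz_on UNIV (\<lambda>x. u (t, x))"
    by (intro rescaled_visc_solution_lipschitz[OF assms(1-7,9,10,12-19), of 0]) (auto simp: rescaled_Ham_0)
qed

end
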